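(* Let $C$ be a proper open convex cone in a finite-dimensional real vector space $V$. Then there exists a gauge-reversing map $\phi\colon C\to C$ if and only if $C$ is symmetric.
   Context: A proper open convex cone $C\subset V$ is a non-empty open convex set, invariant under multiplication by positive scalars, with $\overline{C}\cap(-\overline{C})=\{0\}$. Write $x\le_C y$ if $y-x\in\overline{C}$. The gauge on $C$ is $M_C(x,y):=\inf\{\lambda>0 \mid x\le_C\lambda y\}$ for $x,y\in C$. A map $\phi\colon C\to C$ is gauge-reversing if $M_C(\phi(x),\phi(y))=M_C(y,x)$ for all $x,y\in C$. The cone $C$ is homogeneous if the group $\{A\in \mathrm{GL}(V)\mid A(C)=C\}$ acts transitively on $C$; it is self-dual if there is an inner product $\langle\cdot,\cdot\rangle$ on $V$ for which $C=\{y\in V\mid \langle y,x\rangle>0 \text{ for all } x\in\overline{C}\setminus\{0\}\}$; it is symmetric if it is both homogeneous and self-dual. *)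

theory Defs
  imports "HOL-Analysis.Analysis"
begin

text \<open>The library predicate \<^const>\<open>cone\<close> requires closure under multiplication by
  \<^emph>\<open>non-negative\<close> scalars, hence contains the origin when non-empty; open cones here are
  closed under \<^emph>\<open>positive\<close> scalars only.\<close>

definition proper_open_convex_cone :: "'a::euclidean_space set \<Rightarrow> bool" where
  "proper_open_convex_cone C \<longleftrightarrow>
     C \<noteq> {} \<and> open C \<and> convex C \<and>
     (\<forall>x\<in>C. \<forall>t::real. t > 0 \<longrightarrow> t *\<^sub>R x \<in> C) \<and>
     closure C \<inter> uminus ` closure C = {0}"

definition cone_le :: "'a::euclidean_space set \<Rightarrow> 'a \<Rightarrow> 'a \<Rightarrow> bool" where
  "cone_le C x y \<longleftrightarrow> y - x \<in> closure C"

text \<open>For \<open>x, y \<in> C\<close> with \<open>C\<close> a proper open convex cone, the set below is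
  non-empty (as \<open>y\<close> is interior) and bounded below by 0, so the real infimum is the actual one.\<close>

definition gauge_on :: "'a::euclidean_space set \<Rightarrow> 'a \<Rightarrow> 'a \<Rightarrow> real" where
  "gauge_on C x y = Inf {l::real. l > 0 \<and> cone_le C x (l *\<^sub>R y)}"

definition gauge_reversing :: "'a::euclidean_space set \<Rightarrow> ('a \<Rightarrow> 'a) \<Rightarrow> bool" where
  "gauge_reversing C \<phi> \<longleftrightarrow>
     \<phi> \<in> C \<rightarrow> C \<and> (\<forall>x\<in>C. \<forall>y\<in>C. gauge_on C (\<phi> x) (\<phi> y) = gauge_on C y x)"

definition homogeneous_cone :: "'a::euclidean_space set \<Rightarrow> bool" where
  "homogeneous_cone C \<longleftrightarrow>
     (\<forall>x\<in>C. \<forall>y\<in>C. \<exists>A. linear A \<and> bij A \<and> A ` C = C \<and> A x = y)"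

text \<open>Self-duality refers to an arbitrary inner product on the vector space, not to the one
  that comes with the type class \<^class>\<open>euclidean_space\<close>.\<close>

definition is_inner_product :: "('a::real_vector \<Rightarrow> 'a \<Rightarrow> real) \<Rightarrow> bool" where
  "is_inner_product B \<longleftrightarrow>
     bilinear B \<and> (\<forall>x y. B x y = B y x) \<and> (\<forall>x. x \<noteq> 0 \<longrightarrow> B x x > 0)"

definition self_dual_cone :: "'a::euclidean_space set \<Rightarrow> bool" where
  "self_dual_cone C \<longleftrightarrow>
     (\<exists>B. is_inner_product B \<and> C = {y. \<forall>x \<in> closure C - {0}. B y x > 0})"

definition symmetric_cone :: "'a::euclidean_space set \<Rightarrow> bool" where
  "symmetric_cone C \<longleftrightarrow> homogeneous_cone C \<and> self_dual_cone C"

end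

theory Submission
  imports Defs
begin

text \<open>
  Let \<open>\<phi>\<close> be gauge-reversing. Invariance of domain makes it bijective, so the inverse \<open>\<psi>\<close> is
  gauge-reversing too. For an exposed ray \<open>f\<close> of the dual cone, letting \<open>y\<close> run to infinity along a
  vector exposing \<open>f\<close> yields a point \<open>q\<close> of the closed cone with \<open>f(y) = M(q, \<phi> y)\<close> for all \<open>y\<close>.
  If \<open>r\<close> is the analogous point for \<open>g\<close> and \<open>\<psi>\<close>, then \<open>g(q) = f(r)\<close>; hence \<open>f \<mapsto> q\<close> extends to a linear
  isomorphism \<open>L\<close> from the dual cone onto the closed cone. In particular \<open>\<phi>\<close> is convex, so it is
  differentiable at a dense set of points \<open>m\<close>, with derivative \<open>- T\<close> for an automorphism \<open>T\<close> of
  \<open>C\<close>. Replacing \<open>\<phi>\<close> by \<open>T\<^sup>-\<^sup>1 \<circ> \<phi>\<close> gives an involution with derivative \<open>- id\<close> at a fixed point \<open>e\<close>, for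
  which \<open>L\<close> is symmetric. Near \<open>e\<close> convexity gives \<open>T e = e - 2 (m - e) + o(m - e)\<close>. Therefore the
  orbit of \<open>e\<close> is open, which is homogeneity, and the form defined by \<open>L\<^sup>-\<^sup>1\<close> is positive, which is
  self-duality.

  Conversely, for a symmetric cone let \<open>x\<^sup>*\<close> be the centroid of \<open>C\<close> for the density \<open>exp (- \<langle>x, y\<rangle>) dy\<close>,
  that is, minus the gradient of the logarithm of the characteristic function. It satisfies
  \<open>(A x)\<^sup>* = A\<^sup>-\<^sup>T x\<^sup>*\<close> and has a fixed point \<open>e\<close>, so it is an involution; its derivative at \<open>e\<close> is
  negative semidefinite with square \<open>id\<close>, hence \<open>- id\<close>. By equivariance its derivative is
  everywhere minus an automorphism, so it reverses the order and the gauge.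
\<close>


section \<open>Closed cones and exposed rays\<close>

text \<open>Nothing is assumed of \<open>\<phi>\<close> beyond the gauge identity, and regularity
  stays scarce: order intervals give a local Lipschitz bound, and differentiability is obtained on a
  dense set only. Near \<open>e\<close>, derivatives are known just to first order, which is why the
  orbit is shown to be open by a nearest point argument together with relative closedness, and why
  the form is tested at differentiability points close to a given direction. Exposed functionals are
  the ones that can be represented: along an exposing vector every functional of the dual cone
  outside the ray of \<open>f\<close> grows without bound, so in the limit \<open>f\<close> alone
  decides comparability. They suffice because they determine the closed cone. Convexity comes from
  reading the representation through the inverse: \<open>f(\<phi> y)\<close> is the gauge
  \<open>M(p, y)\<close> of the point \<open>p\<close> representing \<open>f\<close> for the
  inverse, and the reciprocal of that gauge, the largest \<open>c\<close> with \<open>c p\<close>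
  below \<open>y\<close>, is concave in \<open>y\<close>. The converse needs a fixed point inside
  the cone, hence blow-up of the characteristic function at the boundary.\<close>

definition dual_cone :: "'a::real_inner set \<Rightarrow> 'a set" where
  "dual_cone K = {f. \<forall>x\<in>K. 0 \<le> f \<bullet> x}"

definition exposed_rays :: "'a::real_inner set \<Rightarrow> 'a set" where
  "exposed_rays P = {f \<in> P - {0}. \<exists>z. f \<bullet> z = 0 \<and>
     (\<forall>g\<in>P. 0 \<le> g \<bullet> z \<and> (g \<bullet> z = 0 \<longrightarrow> (\<exists>c\<ge>0. g = c *\<^sub>R f)))}"

text \<open>On the unit vectors of the closed cone, a compact set, the functional attains a positive
  minimum; homogeneity extends the bound to the whole cone.\<close>

lemma closed_cone_inner_lower_bound:
  fixes P :: "'a::euclidean_space set"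
  assumes "closed P" and scale: "\<And>f t. f \<in> P \<Longrightarrow> 0 \<le> t \<Longrightarrow> t *\<^sub>R f \<in> P"
    and pos: "\<And>f. f \<in> P \<Longrightarrow> f \<noteq> 0 \<Longrightarrow> 0 < f \<bullet> e"
  shows "\<exists>m>0. \<forall>f\<in>P. m * norm f \<le> f \<bullet> e"
proof (cases "P \<inter> sphere 0 1 = {}")
  case True
  have "f = 0" if "f \<in> P" for f
  proof (rule ccontr)
    assume "f \<noteq> 0"
    then have "(1 / norm f) *\<^sub>R f \<in> P \<inter> sphere 0 1" using that scale by auto
    then show False using True by auto
  qed
  then show ?thesis by (intro exI[of _ 1]) force
next
  case False
  have "compact (P \<inter> sphere 0 1)" using \<open>closed P\<close> by (simp add: closed_Int_compact)
  then obtain g where g: "g \<in> P \<inter> sphere 0 1" "\<forall>f\<in>P \<inter> sphere 0 1. g \<bullet> e \<le> f \<bullet> e"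
    using continuous_attains_inf[OF _ False, of "\<lambda>f. f \<bullet> e"]
      continuous_on_inner[OF continuous_on_id continuous_on_const] by blast
  have "g \<noteq> 0" using g by auto
  then have gpos: "0 < g \<bullet> e" using g pos by auto
  have "(g \<bullet> e) * norm f \<le> f \<bullet> e" if "f \<in> P" for f
  proof (cases "f = 0")
    case False
    then have "(1 / norm f) *\<^sub>R f \<in> P \<inter> sphere 0 1" using that scale by auto
    then have "g \<bullet> e \<le> ((1 / norm f) *\<^sub>R f) \<bullet> e" using g by blast
    then show ?thesis using False by (simp add: field_simps)
  qed auto
  then show ?thesis using gpos by blast
qed

text \<open>The farthest point of a base of the cone from a remote multiple of \<open>x\<close> is exposed.\<close>

lemma exposed_ray_negative:
  fixes P :: "'a::euclidean_space set"
  assumes "closed P" and scale: "\<And>f t. f \<in> P \<Longrightarrow> 0 \<le> t \<Longrightarrow> t *\<^sub>R f \<in> P"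
    and pos: "\<And>f. f \<in> P \<Longrightarrow> f \<noteq> 0 \<Longrightarrow> 0 < f \<bullet> e"
    and f: "f \<in> P" "f \<bullet> x < 0"
  shows "\<exists>g\<in>exposed_rays P. g \<bullet> x < 0"
proof -
  obtain m where m: "m > 0" "\<And>f. f \<in> P \<Longrightarrow> m * norm f \<le> f \<bullet> e"
    using closed_cone_inner_lower_bound[OF assms(1) scale pos] by blast
  define S where "S = P \<inter> {f. f \<bullet> e = 1}"
  have bnd: "norm g \<le> 1 / m" if "g \<in> S" for g
    using m(2)[of g] that m(1) by (auto simp: S_def field_simps)
  have "closed {f. f \<bullet> e = 1}" by (intro closed_Collect_eq continuous_intros)
  then have "closed S" unfolding S_def using \<open>closed P\<close> by auto
  moreover have "bounded S" using bnd by (auto simp: bounded_iff)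
  ultimately have "compact S" by (simp add: compact_eq_bounded_closed)
  have "f \<noteq> 0" using f by auto
  then have fe: "f \<bullet> e > 0" using pos f by auto
  define f1 where "f1 = (1 / (f \<bullet> e)) *\<^sub>R f"
  have f1: "f1 \<in> S" "f1 \<bullet> x < 0"
    using fe f scale by (auto simp: S_def f1_def divide_less_0_iff)
  \<comment> \<open>Chosen so that \<open>R * (f1 \<bullet> x)\<close> outweighs the squared bound
    \<open>1 / m\<close> on norms in the base: a point at least as far from
    \<open>R *\<^sub>R x\<close> as \<open>f1\<close> must then also be negative on
    \<open>x\<close>.\<close>
  define R where "R = (1 / m)\<^sup>2 / (- (f1 \<bullet> x))"
  have R: "R > 0" using m f1 unfolding R_def by (intro divide_pos_pos) auto
  have Rx: "R * (f1 \<bullet> x) = - (1/m)\<^sup>2" using f1 by (simp add: R_def field_simps)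
  obtain g where g: "g \<in> S" "\<forall>h\<in>S. dist h (R *\<^sub>R x) \<le> dist g (R *\<^sub>R x)"
    using continuous_attains_sup[OF \<open>compact S\<close>, of "\<lambda>h. dist h (R *\<^sub>R x)"] f1
      continuous_on_dist[OF continuous_on_id continuous_on_const] by blast
  define a where "a = R *\<^sub>R x - g"
  have far: "(norm (h - g))\<^sup>2 / 2 \<le> (h - g) \<bullet> a" if "h \<in> S" for h
  proof -
    have "norm ((h - g) - a) \<le> norm a"
      using g(2) that by (auto simp: a_def dist_norm norm_minus_commute)
    then have "(norm ((h - g) - a))\<^sup>2 \<le> (norm a)\<^sup>2" by (rule power_mono) auto
    then show ?thesis
      by (simp add: power2_norm_eq_inner inner_diff_left inner_diff_right inner_add_left inner_add_right
        inner_commute field_simps)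
  qed
  have gx: "g \<bullet> x < 0"
  proof -
    have "norm (f1 - R *\<^sub>R x) \<le> norm (g - R *\<^sub>R x)" using g f1 by (auto simp: dist_norm)
    then have "(norm (f1 - R *\<^sub>R x))\<^sup>2 \<le> (norm (g - R *\<^sub>R x))\<^sup>2" by (rule power_mono) auto
    then have "f1 \<bullet> f1 - 2 * (R * (f1 \<bullet> x)) \<le> g \<bullet> g - 2 * (R * (g \<bullet> x))"
      by (simp add: power2_norm_eq_inner inner_diff_left inner_diff_right inner_commute field_simps)
    moreover have "g \<bullet> g \<le> (1/m)\<^sup>2"
      using power_mono[OF bnd[OF g(1)], of 2] by (simp add: power2_norm_eq_inner)
    ultimately have "2 * (R * (g \<bullet> x)) \<le> - (1/m)\<^sup>2" using Rx inner_ge_zero[of f1] by linarith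
    moreover have "(1/m)\<^sup>2 > 0" using m by simp
    ultimately have "R * (g \<bullet> x) < 0" by linarith
    then show ?thesis using R by (simp add: mult_less_0_iff)
  qed
  \<comment> \<open>On the base \<open>h \<bullet> e = 1\<close>, so subtracting a multiple of
    \<open>e\<close> shifts all values of \<open>a\<close> by one constant and brings the value at
    \<open>g\<close> to zero.\<close>
  define z where "z = a - (g \<bullet> a) *\<^sub>R e"
  have gz: "g \<bullet> z = 0" using g by (simp add: z_def S_def inner_diff_right)
  have main: "0 \<le> h \<bullet> z \<and> (h \<bullet> z = 0 \<longrightarrow> (\<exists>c\<ge>0. h = c *\<^sub>R g))" if h: "h \<in> P" for h
  proof (cases "h = 0")
    case False
    then have he: "h \<bullet> e > 0" using pos h by auto
    define h1 where "h1 = (1 / (h \<bullet> e)) *\<^sub>R h"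
    have h1: "h1 \<in> S" using he h scale by (auto simp: S_def h1_def)
    have hh: "h = (h \<bullet> e) *\<^sub>R h1" using he by (simp add: h1_def)
    have "h1 \<bullet> z = (h1 - g) \<bullet> a"
      using h1 by (simp add: z_def S_def inner_diff_right inner_diff_left)
    then have ge: "(norm (h1 - g))\<^sup>2 / 2 \<le> h1 \<bullet> z" using far[OF h1] by simp
    have hz: "h \<bullet> z = (h \<bullet> e) * (h1 \<bullet> z)" by (subst hh) simp
    have "0 \<le> (norm (h1 - g))\<^sup>2 / 2" by simp
    then have "0 \<le> h1 \<bullet> z" using ge by linarith
    then have "0 \<le> h \<bullet> z" using hz he by simp
    moreover have "\<exists>c\<ge>0. h = c *\<^sub>R g" if "h \<bullet> z = 0"
    proof -
      have "h1 = g" using ge hz he that by simp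
      then show ?thesis using hh he by (intro exI[of _ "h \<bullet> e"]) auto
    qed
    ultimately show ?thesis by blast
  qed (auto intro: exI[of _ 0])
  have "g \<noteq> 0" "g \<in> P" using g by (auto simp: S_def)
  then have "g \<in> exposed_rays P" using gz main unfolding exposed_rays_def by blast
  then show ?thesis using gx by blast
qed

lemma span_eq_UNIV:
  fixes S :: "'a::euclidean_space set"
  assumes "\<And>a. (\<And>f. f \<in> S \<Longrightarrow> f \<bullet> a = 0) \<Longrightarrow> a = 0" shows "span S = UNIV"
proof (rule ccontr)
  assume "span S \<noteq> UNIV"
  then obtain a where a: "a \<noteq> 0" "\<And>f. f \<in> span S \<Longrightarrow> a \<bullet> f = 0"
    using span_not_UNIV_orthogonal by blast
  have "f \<bullet> a = 0" if "f \<in> S" for f using a(2) that span_base by (metis inner_commute)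
  then show False using assms a(1) by blast
qed

lemma spanning_set_basis:
  fixes S :: "'a::euclidean_space set"
  assumes "span S = UNIV"
  obtains B where "B \<subseteq> S" "independent B" "finite B" "span B = UNIV"
proof -
  obtain B where B: "B \<subseteq> S" "independent B" "S \<subseteq> span B"
    using maximal_independent_subset by blast
  moreover have "span B = UNIV" using assms span_minimal[OF B(3)] by (simp add: subset_antisym)
  ultimately show thesis using that independent_imp_finite by blast
qed

section \<open>Order and duality of a proper open convex cone\<close>

locale proper_cone =
  fixes C :: "'a::euclidean_space set"
  assumes poc: "proper_open_convex_cone C"
begin

abbreviation K where "K \<equiv> closure C"
abbreviation Kd where "Kd \<equiv> dual_cone (closure C)"
abbreviation X where "X \<equiv> exposed_rays (dual_cone (closure C))"

lemma C_nonempty: "C \<noteq> {}" and C_open: "open C" and C_convex: "convex C"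
  and C_scale: "x \<in> C \<Longrightarrow> t > 0 \<Longrightarrow> t *\<^sub>R x \<in> C"
  using poc unfolding proper_open_convex_cone_def by auto

lemma C_sub_K: "x \<in> C \<Longrightarrow> x \<in> K"
  using closure_subset by blast

lemma K_pointed: "x \<in> K \<Longrightarrow> - x \<in> K \<Longrightarrow> x = 0"
  using poc unfolding proper_open_convex_cone_def by (metis IntI image_eqI minus_minus singletonD)

lemma K_zero: "0 \<in> K"
  using poc unfolding proper_open_convex_cone_def by (metis IntD1 singletonI)

lemma K_scale:
  assumes "x \<in> K" "t \<ge> 0" shows "t *\<^sub>R x \<in> K"
proof (cases "t = 0")
  case False
  then have "(*\<^sub>R) t ` C \<subseteq> C" using assms C_scale by auto
  then have "closure ((*\<^sub>R) t ` C) \<subseteq> K" by (rule closure_mono)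
  then show ?thesis using assms closure_scaleR[of t C] by auto
qed (simp add: K_zero)

lemma K_convex: "convex K"
  by (simp add: C_convex convex_closure)

lemma K_add:
  assumes "x \<in> K" "y \<in> K" shows "x + y \<in> K"
proof -
  have "(1/2) *\<^sub>R x + (1/2) *\<^sub>R y \<in> K" using K_convex assms by (rule convexD) auto
  from K_scale[OF this, of 2] show ?thesis by (simp add: scaleR_add_right)
qed

lemma K_trans: "y - x \<in> K \<Longrightarrow> z - y \<in> K \<Longrightarrow> z - x \<in> K"
  using K_add[of "y - x" "z - y"] by simp

lemma interior_K: "interior K = C"
  using convex_interior_closure[OF C_convex] C_open by (simp add: interior_open)

lemma C_add_K:
  assumes "x \<in> C" "y \<in> K" shows "x + y \<in> C"
proof -
  have "(\<lambda>x. x + y) ` C \<subseteq> K" using assms K_add C_sub_K by auto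
  moreover have "open ((\<lambda>x. x + y) ` C)" using open_translation[OF C_open, of y] by (simp add: add.commute)
  ultimately have "(\<lambda>x. x + y) ` C \<subseteq> interior K" by (simp add: interior_maximal)
  then show ?thesis using assms interior_K by auto
qed

lemma K_limit: "(\<And>n. f n \<in> K) \<Longrightarrow> f \<longlonglongrightarrow> x \<Longrightarrow> x \<in> K"
  using closed_sequentially[OF closed_closure] by blast

lemma K_archimedean:
  assumes "\<And>d. d > 0 \<Longrightarrow> x + d *\<^sub>R y \<in> K" shows "x \<in> K"
proof -
  have "(\<lambda>n. x + (1 / real (Suc n)) *\<^sub>R y) \<longlonglongrightarrow> x + 0 *\<^sub>R y"
    by (intro tendsto_intros LIMSEQ_Suc lim_1_over_n)
  then show ?thesis using K_limit[of "\<lambda>n. x + (1 / real (Suc n)) *\<^sub>R y"] assms by auto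
qed

lemma Kd_nonneg: "f \<in> Kd \<Longrightarrow> x \<in> K \<Longrightarrow> 0 \<le> f \<bullet> x"
  by (simp add: dual_cone_def)

lemma Kd_closed: "closed Kd"
proof -
  have "Kd = (\<Inter>x\<in>K. {f. 0 \<le> f \<bullet> x})" by (auto simp: dual_cone_def)
  then show ?thesis by (auto intro!: closed_INT closed_Collect_le continuous_intros)
qed

lemma Kd_scale: "f \<in> Kd \<Longrightarrow> t \<ge> 0 \<Longrightarrow> t *\<^sub>R f \<in> Kd"
  by (simp add: dual_cone_def)

text \<open>Hyperplane separation. The separating level is negative because the cone contains 0, and
  rescaling a point where \<open>a\<close> is negative to exactly that level contradicts strictness,
  so \<open>a\<close> lies in the dual cone.\<close>

lemma bipolar: "x \<in> K \<longleftrightarrow> (\<forall>f\<in>Kd. 0 \<le> f \<bullet> x)"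
proof (rule iffI)
  assume r: "\<forall>f\<in>Kd. 0 \<le> f \<bullet> x"
  show "x \<in> K"
  proof (rule ccontr)
    assume "x \<notin> K"
    then obtain a b where ab: "a \<bullet> x < b" "\<forall>y\<in>K. a \<bullet> y > b"
      using separating_hyperplane_closed_point[OF K_convex closed_closure] by blast
    have b0: "b < 0" using ab K_zero by fastforce
    have "a \<in> Kd" unfolding dual_cone_def
    proof (clarify, rule ccontr)
      fix y assume y: "y \<in> K" "\<not> 0 \<le> a \<bullet> y"
      have "b / (a \<bullet> y) \<ge> 0" using y b0 by (simp add: divide_nonpos_neg)
      then have "(b / (a \<bullet> y)) *\<^sub>R y \<in> K" using y K_scale by blast
      then have "a \<bullet> ((b / (a \<bullet> y)) *\<^sub>R y) > b" using ab by blast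
      then show False using y by simp
    qed
    then show False using r ab b0 by force
  qed
qed (simp add: Kd_nonneg)

text \<open>A point of the open cone can be moved a little against \<open>f\<close> without leaving
  the cone, and \<open>f\<close> is still nonnegative there.\<close>

lemma Kd_pos:
  assumes "x \<in> C" "f \<in> Kd" "f \<noteq> 0" shows "0 < f \<bullet> x"
proof -
  obtain r where r: "r > 0" "ball x r \<subseteq> C" using C_open assms(1) openE by blast
  define y where "y = x - (r / (2 * norm f)) *\<^sub>R f"
  have "y \<in> C" using r assms by (intro subsetD[OF r(2)]) (auto simp: y_def dist_norm)
  then have "0 \<le> f \<bullet> y" using assms Kd_nonneg C_sub_K by blast
  moreover have "f \<bullet> y = f \<bullet> x - r / 2 * norm f"
    using assms by (simp add: y_def inner_diff_right dot_square_norm power2_eq_square)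
  moreover have "r / 2 * norm f > 0" using r assms by simp
  ultimately show ?thesis by linarith
qed

lemma Kd_lower_bound:
  assumes "x \<in> C" shows "\<exists>m>0. \<forall>f\<in>Kd. m * norm f \<le> f \<bullet> x"
  by (rule closed_cone_inner_lower_bound[OF Kd_closed]) (use Kd_scale Kd_pos assms in auto)

text \<open>By compactness, strict positivity comes with a margin proportional to
  \<open>norm f\<close>, so a whole ball around \<open>x\<close> lies in the closed cone, whose
  interior is \<open>C\<close>.\<close>

lemma C_I:
  assumes "\<And>f. f \<in> Kd \<Longrightarrow> f \<noteq> 0 \<Longrightarrow> 0 < f \<bullet> x" shows "x \<in> C"
proof -
  obtain m where m: "m > 0" "\<And>f. f \<in> Kd \<Longrightarrow> m * norm f \<le> f \<bullet> x"
    using closed_cone_inner_lower_bound[OF Kd_closed Kd_scale assms] by blast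
  have "ball x m \<subseteq> K"
  proof
    fix y assume "y \<in> ball x m"
    then have y: "norm (y - x) \<le> m" by (simp add: dist_norm norm_minus_commute)
    have "0 \<le> f \<bullet> y" if f: "f \<in> Kd" for f
    proof -
      have "\<bar>f \<bullet> (y - x)\<bar> \<le> norm f * norm (y - x)" by (rule Cauchy_Schwarz_ineq2)
      also have "\<dots> \<le> norm f * m" using y by (simp add: mult_left_mono)
      finally have "\<bar>f \<bullet> y - f \<bullet> x\<bar> \<le> m * norm f" by (simp add: inner_diff_right mult.commute)
      then show ?thesis using m(2)[OF f] by linarith
    qed
    then show "y \<in> K" using bipolar by blast
  qed
  then show ?thesis using m interior_K by (metis centre_in_ball interior_maximal open_ball subsetD)
qed

lemma K_boundary_support:
  assumes "x \<in> K" "x \<notin> C" shows "\<exists>g\<in>Kd. g \<noteq> 0 \<and> g \<bullet> x = 0"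
proof -
  obtain g where "g \<in> Kd" "g \<noteq> 0" "\<not> 0 < g \<bullet> x" using C_I assms(2) by blast
  then show ?thesis using Kd_nonneg assms(1) by (metis antisym_conv2)
qed

lemma span_Kd: "span Kd = UNIV"
  by (rule span_eq_UNIV) (metis K_pointed bipolar inner_minus_right neg_0_le_iff_le order_refl)

text \<open>The sum of a basis taken from the dual cone works: if it vanished at \<open>x\<close>,
  each summand would vanish there, forcing \<open>x = 0\<close>.\<close>

lemma Kd_interior_point: "\<exists>f\<in>Kd. \<forall>x\<in>K. x \<noteq> 0 \<longrightarrow> 0 < f \<bullet> x"
proof -
  obtain B where B: "B \<subseteq> Kd" "independent B" and fin: "finite B" and sB: "span B = UNIV"
    by (rule spanning_set_basis[OF span_Kd])
  have "(\<Sum>B) \<in> Kd" using B by (auto simp: dual_cone_def inner_sum_left intro!: sum_nonneg)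
  moreover have "0 < (\<Sum>B) \<bullet> x" if x: "x \<in> K" "x \<noteq> 0" for x
  proof (rule ccontr)
    assume "\<not> 0 < (\<Sum>B) \<bullet> x"
    then have "(\<Sum>f\<in>B. f \<bullet> x) \<le> 0" by (simp add: inner_sum_left)
    moreover have nn: "\<And>f. f \<in> B \<Longrightarrow> 0 \<le> f \<bullet> x" using B x Kd_nonneg by blast
    ultimately have "\<And>f. f \<in> B \<Longrightarrow> f \<bullet> x = 0"
      using fin sum_nonneg_eq_0_iff[OF fin, of "\<lambda>f. f \<bullet> x"] by (metis sum_nonneg order_antisym)
    then have "x \<bullet> y = 0" if "y \<in> span B" for y
      using that by (metis orthogonal_def orthogonal_to_span inner_commute)
    then show False using sB x by (metis UNIV_I inner_eq_zero_iff)
  qed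
  ultimately show ?thesis by blast
qed

text \<open>A functional strictly positive on the nonzero points of the cone is monotone and, on the
  cone, comparable with the norm. The bound converts order estimates into norm estimates.\<close>

lemma K_normal: "\<exists>N>0. \<forall>x\<in>K. \<forall>y. y - x \<in> K \<longrightarrow> norm x \<le> N * norm y"
proof -
  obtain f where f: "f \<in> Kd" "\<And>x. x \<in> K \<Longrightarrow> x \<noteq> 0 \<Longrightarrow> 0 < f \<bullet> x" using Kd_interior_point by blast
  obtain m where m: "m > 0" "\<And>x. x \<in> K \<Longrightarrow> m * norm x \<le> x \<bullet> f"
    using closed_cone_inner_lower_bound[OF closed_closure K_scale, of f] f by (metis inner_commute)
  have "norm x \<le> ((norm f + 1) / m) * norm y" if "x \<in> K" "y - x \<in> K" for x y
  proof -
    have "m * norm x \<le> x \<bullet> f" using m that by blast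
    also have "\<dots> \<le> f \<bullet> y" using Kd_nonneg[OF f(1) that(2)] by (simp add: inner_diff_right inner_commute)
    also have "\<dots> \<le> norm f * norm y" by (rule norm_cauchy_schwarz)
    also have "\<dots> \<le> (norm f + 1) * norm y" by (simp add: mult_right_mono)
    finally show ?thesis using m by (simp add: field_simps)
  qed
  moreover have "(norm f + 1) / m > 0" using m by (simp add: add_nonneg_pos)
  ultimately show ?thesis by blast
qed

text \<open>The reverse conversion, from norm to order: every functional of the dual cone is at
  \<open>x\<close> at least a fixed multiple of its norm, which dominates its value at
  \<open>h\<close>.\<close>

lemma order_unit:
  assumes "x \<in> C" shows "\<exists>c>0. \<forall>h. (c * norm h) *\<^sub>R x - h \<in> K \<and> (c * norm h) *\<^sub>R x + h \<in> K"
proof -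
  obtain m where m: "m > 0" "\<And>f. f \<in> Kd \<Longrightarrow> m * norm f \<le> f \<bullet> x" using Kd_lower_bound[OF assms] by blast
  have "0 \<le> f \<bullet> ((1/m * norm h) *\<^sub>R x - h) \<and> 0 \<le> f \<bullet> ((1/m * norm h) *\<^sub>R x + h)" if "f \<in> Kd" for f h
  proof -
    have "\<bar>f \<bullet> h\<bar> \<le> norm f * norm h" by (rule Cauchy_Schwarz_ineq2)
    also have "\<dots> = 1/m * norm h * (m * norm f)" using m by simp
    also have "\<dots> \<le> 1/m * norm h * (f \<bullet> x)" using m that by (intro mult_left_mono) auto
    finally show ?thesis by (auto simp: inner_diff_right inner_add_right)
  qed
  then show ?thesis using m bipolar by (intro exI[of _ "1/m"]) auto
qed

text \<open>A violated inequality is already violated by some exposed functional. Exposed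
  functionals are the only ones for which representing points are constructed, so membership has to
  be testable on them.\<close>

lemma K_X: "x \<in> K \<longleftrightarrow> (\<forall>f\<in>X. 0 \<le> f \<bullet> x)"
proof
  assume r: "\<forall>f\<in>X. 0 \<le> f \<bullet> x"
  obtain e where e: "e \<in> C" using C_nonempty by blast
  show "x \<in> K"
  proof (rule ccontr)
    assume "x \<notin> K"
    then obtain f where "f \<in> Kd" "f \<bullet> x < 0" using bipolar by force
    then have "\<exists>g\<in>X. g \<bullet> x < 0" using exposed_ray_negative[OF Kd_closed Kd_scale Kd_pos[OF e]] by blast
    then show False using r by force
  qed
qed (auto simp: exposed_rays_def intro: Kd_nonneg)

lemma Kd_Y: "f \<in> Kd \<longleftrightarrow> (\<forall>p\<in>exposed_rays K. 0 \<le> p \<bullet> f)"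
proof
  assume r: "\<forall>p\<in>exposed_rays K. 0 \<le> p \<bullet> f"
  obtain g where g: "g \<in> Kd" "\<And>x. x \<in> K \<Longrightarrow> x \<noteq> 0 \<Longrightarrow> 0 < x \<bullet> g" using Kd_interior_point by (metis inner_commute)
  show "f \<in> Kd"
  proof (rule ccontr)
    assume "f \<notin> Kd"
    then obtain x where "x \<in> K" "x \<bullet> f < 0" unfolding dual_cone_def by (auto simp: inner_commute not_le)
    then have "\<exists>p\<in>exposed_rays K. p \<bullet> f < 0"
      using exposed_ray_negative[OF closed_closure K_scale g(2)] by blast
    then show False using r by force
  qed
next
  assume "f \<in> Kd" then show "\<forall>p\<in>exposed_rays K. 0 \<le> p \<bullet> f"
    by (metis (no_types, lifting) DiffD1 Kd_nonneg exposed_rays_def inner_commute mem_Collect_eq)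
qed

lemma span_X: "span X = UNIV"
  by (rule span_eq_UNIV) (metis K_pointed K_X inner_minus_right neg_0_le_iff_le order_refl)

lemma span_Y: "span (exposed_rays K) = UNIV"
proof (rule span_eq_UNIV, rule ccontr)
  fix a assume a: "\<And>p. p \<in> exposed_rays K \<Longrightarrow> p \<bullet> a = 0" "a \<noteq> 0"
  then have "a \<in> Kd" "- a \<in> Kd" using Kd_Y by auto
  moreover obtain e where "e \<in> C" using C_nonempty by blast
  ultimately show False using Kd_pos[of e a] Kd_pos[of e "-a"] a by auto
qed

lemma eq_on_X: "(\<And>f. f \<in> X \<Longrightarrow> f \<bullet> x = f \<bullet> y) \<Longrightarrow> x = y"
  using K_X[of "x - y"] K_X[of "y - x"] K_pointed[of "x - y"] by (simp add: inner_diff_right)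

text \<open>The admissible multipliers form an up-set, and closedness of the cone extends the
  condition to every positive \<open>l\<close> not below the infimum.\<close>

lemma gauge_le_iff:
  assumes x: "x \<in> C" and y: "y \<in> C" and l: "l > 0"
  shows "gauge_on C x y \<le> l \<longleftrightarrow> l *\<^sub>R y - x \<in> K"
proof -
  define S where "S = {l::real. l > 0 \<and> l *\<^sub>R y - x \<in> K}"
  have g: "gauge_on C x y = Inf S" by (simp add: S_def gauge_on_def cone_le_def)
  have bdd: "bdd_below S" by (rule bdd_belowI[of _ 0]) (auto simp: S_def)
  have up: "b \<in> S" if "a \<in> S" "a \<le> b" for a b
  proof -
    have "(a *\<^sub>R y - x) + (b - a) *\<^sub>R y \<in> K" using that y C_sub_K K_add K_scale by (auto simp: S_def)
    then show ?thesis using that by (auto simp: S_def algebra_simps)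
  qed
  obtain c where c: "c > 0" "(c * norm x) *\<^sub>R y - x \<in> K" using order_unit[OF y] by blast
  have "(c * norm x + 1) *\<^sub>R y - x \<in> K" using K_add[OF c(2) C_sub_K[OF y]] by (simp add: algebra_simps)
  then have ne: "S \<noteq> {}" using c by (auto simp: S_def intro!: exI[of _ "c * norm x + 1"] add_nonneg_pos)
  show ?thesis
  proof
    assume "gauge_on C x y \<le> l"
    then have I: "Inf S \<le> l" using g by simp
    have "(l *\<^sub>R y - x) + d *\<^sub>R y \<in> K" if "d > 0" for d
    proof -
      have "Inf S < l + d" using I that by linarith
      then obtain a where "a \<in> S" "a < l + d" using cInf_lessD[OF ne] by blast
      then have "l + d \<in> S" using up by auto
      then show ?thesis by (simp add: S_def algebra_simps)
    qed
    then show "l *\<^sub>R y - x \<in> K" by (rule K_archimedean)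
  next
    assume "l *\<^sub>R y - x \<in> K"
    then have "l \<in> S" using l by (simp add: S_def)
    then show "gauge_on C x y \<le> l" using g bdd by (simp add: cInf_lower)
  qed
qed

text \<open>Gauges agree exactly when their positive upper bounds agree. The later arguments use
  only this order form; the infimum does not return.\<close>

lemma gauge_reversing_iff:
  "gauge_reversing C \<phi> \<longleftrightarrow> \<phi> \<in> C \<rightarrow> C \<and>
     (\<forall>x\<in>C. \<forall>y\<in>C. \<forall>l>0. l *\<^sub>R \<phi> y - \<phi> x \<in> K \<longleftrightarrow> l *\<^sub>R x - y \<in> K)"
proof
  assume g: "gauge_reversing C \<phi>"
  then have "\<phi> \<in> C \<rightarrow> C" by (simp add: gauge_reversing_def)
  then show "\<phi> \<in> C \<rightarrow> C \<and> (\<forall>x\<in>C. \<forall>y\<in>C. \<forall>l>0. l *\<^sub>R \<phi> y - \<phi> x \<in> K \<longleftrightarrow> l *\<^sub>R x - y \<in> K)"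
    using g unfolding gauge_reversing_def by (metis PiE gauge_le_iff)
next
  assume "\<phi> \<in> C \<rightarrow> C \<and> (\<forall>x\<in>C. \<forall>y\<in>C. \<forall>l>0. l *\<^sub>R \<phi> y - \<phi> x \<in> K \<longleftrightarrow> l *\<^sub>R x - y \<in> K)"
  then show "gauge_reversing C \<phi>"
    unfolding gauge_reversing_def gauge_on_def cone_le_def by (auto intro!: arg_cong[where f = Inf])
qed

end

section \<open>Gauge-reversing maps are bijective\<close>

context proper_cone
begin

text \<open>Bounded by normality. This is the compactness behind surjectivity of
  \<open>\<phi>\<close> and behind the limit points that represent functionals.\<close>

lemma order_interval_compact: "compact {x. x - a \<in> K \<and> b - x \<in> K}"
proof -
  obtain N where N: "\<And>x y. x \<in> K \<Longrightarrow> y - x \<in> K \<Longrightarrow> norm x \<le> N * norm y" using K_normal by blast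
  have "closed {x. x - a \<in> K}" "closed {x. b - x \<in> K}"
    using continuous_closed_vimage[OF closed_closure, of "\<lambda>x. x - a" C]
      continuous_closed_vimage[OF closed_closure, of "\<lambda>x. b - x" C]
    by (simp_all add: vimage_def continuous_intros)
  then have "closed {x. x - a \<in> K \<and> b - x \<in> K}" by (rule closed_Collect_conj)
  moreover have "bounded {x. x - a \<in> K \<and> b - x \<in> K}"
  proof (rule boundedI)
    fix x assume x: "x \<in> {x. x - a \<in> K \<and> b - x \<in> K}"
    then have "norm (x - a) \<le> N * norm (b - a)" using N[of "x - a" "b - a"] by simp
    then show "norm x \<le> norm a + N * norm (b - a)" using norm_triangle_sub[of x a] by linarith
  qed
  ultimately show ?thesis by (simp add: compact_eq_bounded_closed)
qed

context
  fixes \<phi> assumes gr: "gauge_reversing C \<phi>"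
begin

lemma gr_in_C: "x \<in> C \<Longrightarrow> \<phi> x \<in> C"
  using gr gauge_reversing_iff by blast

lemma gr_rev: "x \<in> C \<Longrightarrow> y \<in> C \<Longrightarrow> l > 0 \<Longrightarrow> l *\<^sub>R \<phi> y - \<phi> x \<in> K \<longleftrightarrow> l *\<^sub>R x - y \<in> K"
  using gr gauge_reversing_iff by blast

lemma gr_antitone: "x \<in> C \<Longrightarrow> y \<in> C \<Longrightarrow> \<phi> y - \<phi> x \<in> K \<longleftrightarrow> x - y \<in> K"
  using gr_rev[of x y 1] by simp

lemma gr_inj: "inj_on \<phi> C"
proof (rule inj_onI)
  fix x y assume "x \<in> C" "y \<in> C" "\<phi> x = \<phi> y"
  then have "x - y \<in> K" "- (x - y) \<in> K" using gr_antitone[of x y] gr_antitone[of y x] K_zero by auto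
  then show "x = y" using K_pointed by fastforce
qed

text \<open>\<open>x\<close> and \<open>t *\<^sub>R x\<close> compare exactly in both directions, so
  the reversed relations give both inequalities.\<close>

lemma gr_scale:
  assumes "x \<in> C" "t > 0" shows "\<phi> (t *\<^sub>R x) = (1 / t) *\<^sub>R \<phi> x"
proof -
  have tx: "t *\<^sub>R x \<in> C" using assms C_scale by blast
  have "(1 / t) *\<^sub>R \<phi> x - \<phi> (t *\<^sub>R x) \<in> K" using gr_rev[OF tx assms(1), of "1/t"] assms K_zero by simp
  moreover have "t *\<^sub>R \<phi> (t *\<^sub>R x) - \<phi> x \<in> K" using gr_rev[OF assms(1) tx assms(2)] K_zero by simp
  then have "(1 / t) *\<^sub>R (t *\<^sub>R \<phi> (t *\<^sub>R x) - \<phi> x) \<in> K" using K_scale assms by simp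
  then have "\<phi> (t *\<^sub>R x) - (1 / t) *\<^sub>R \<phi> x \<in> K" using assms by (simp add: scaleR_diff_right)
  ultimately show ?thesis using K_pointed[of "\<phi> (t *\<^sub>R x) - (1 / t) *\<^sub>R \<phi> x"] by simp
qed

text \<open>With \<open>s = c * norm h\<close> the point \<open>x + h\<close> lies between
  \<open>(1 - s) *\<^sub>R x\<close> and \<open>(1 + s) *\<^sub>R x\<close>. Reversal and
  homogeneity of degree -1 confine \<open>\<phi> (x + h)\<close> to an order interval around
  \<open>\<phi> x\<close> of width of order \<open>s\<close>, which normality converts into a norm
  bound.\<close>

lemma gr_locally_lipschitz:
  assumes x: "x \<in> C"
  shows "\<exists>B>0. \<exists>d>0. \<forall>h. norm h < d \<longrightarrow> x + h \<in> C \<and> norm (\<phi> (x + h) - \<phi> x) \<le> B * norm h"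
proof -
  obtain c where c: "c > 0" "\<And>h. (c * norm h) *\<^sub>R x - h \<in> K" "\<And>h. (c * norm h) *\<^sub>R x + h \<in> K"
    using order_unit[OF x] by blast
  obtain N where N: "N > 0" "\<And>x y. x \<in> K \<Longrightarrow> y - x \<in> K \<Longrightarrow> norm x \<le> N * norm y" using K_normal by blast
  have "x + h \<in> C \<and> norm (\<phi> (x + h) - \<phi> x) \<le> (4 * N + 1) * norm (\<phi> x) * c * norm h"
    if h: "norm h < 1 / (2 * c)" for h
  proof -
    define s where "s = c * norm h"
    have s: "0 \<le> s" "s < 1/2" using h c by (auto simp: s_def field_simps)
    have "(1 - s) *\<^sub>R x + (s *\<^sub>R x + h) \<in> C"
      using C_add_K[OF C_scale[OF x, of "1 - s"] c(3)[of h]] s by (simp add: s_def)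
    then have xh: "x + h \<in> C" by (simp add: algebra_simps)
    have l: "(1 - s) *\<^sub>R x \<in> C" "(1 + s) *\<^sub>R x \<in> C" using s x C_scale by auto
    have "(x + h) - (1 - s) *\<^sub>R x \<in> K" using c(3)[of h] by (simp add: s_def algebra_simps)
    then have "(1 / (1 - s)) *\<^sub>R \<phi> x - \<phi> (x + h) \<in> K"
      using gr_antitone[OF xh l(1)] gr_scale[OF x, of "1 - s"] s by simp
    then have up: "((1 / (1 - s) - 1 / (1 + s)) *\<^sub>R \<phi> x) - (\<phi> (x + h) - (1 / (1 + s)) *\<^sub>R \<phi> x) \<in> K"
      by (simp add: algebra_simps)
    have "(1 + s) *\<^sub>R x - (x + h) \<in> K" using c(2)[of h] by (simp add: s_def algebra_simps)
    then have lo: "\<phi> (x + h) - (1 / (1 + s)) *\<^sub>R \<phi> x \<in> K"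
      using gr_antitone[OF l(2) xh] gr_scale[OF x, of "1 + s"] s by simp
    have q: "\<bar>1 / (1 - s) - 1 / (1 + s)\<bar> \<le> 4 * s"
    proof -
      have ss: "s * s \<le> 1/4" using mult_mono[of s "1/2" s "1/2"] s by simp
      have "1 / (1 - s) - 1 / (1 + s) = 2 * s / (1 - s * s)" using s by (simp add: field_simps)
      also have "\<dots> \<le> 2 * s / (1/2)" using s ss by (intro divide_left_mono) auto
      finally have "1 / (1 - s) - 1 / (1 + s) \<le> 4 * s" by simp
      moreover have "1 / (1 + s) \<le> 1 / (1 - s)" using s by (intro divide_left_mono) auto
      ultimately show ?thesis by simp
    qed
    have "norm (\<phi> (x + h) - (1 / (1 + s)) *\<^sub>R \<phi> x) \<le> N * norm ((1 / (1 - s) - 1 / (1 + s)) *\<^sub>R \<phi> x)"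
      by (rule N(2)[OF lo up])
    also have "\<dots> \<le> N * (4 * s * norm (\<phi> x))"
      using mult_right_mono[OF q, of "norm (\<phi> x)"] N(1) by (simp add: mult_left_mono)
    finally have A: "norm (\<phi> (x + h) - (1 / (1 + s)) *\<^sub>R \<phi> x) \<le> N * (4 * s * norm (\<phi> x))" .
    have "(1 / (1 + s)) *\<^sub>R \<phi> x - \<phi> x = (- (s / (1 + s))) *\<^sub>R \<phi> x"
    proof -
      have "1 / (1 + s) - 1 = - (s / (1 + s))" using s by (simp add: field_simps)
      then show ?thesis by (metis scaleR_left_diff_distrib scaleR_one)
    qed
    then have "norm ((1 / (1 + s)) *\<^sub>R \<phi> x - \<phi> x) = s / (1 + s) * norm (\<phi> x)" using s by simp
    also have "\<dots> \<le> s * norm (\<phi> x)" using s by (intro mult_right_mono) (auto simp: divide_le_eq mult_le_cancel_left1)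
    finally have Bq: "norm ((1 / (1 + s)) *\<^sub>R \<phi> x - \<phi> x) \<le> s * norm (\<phi> x)" .
    have "norm (\<phi> (x + h) - \<phi> x) \<le> N * (4 * s * norm (\<phi> x)) + s * norm (\<phi> x)"
      using norm_triangle_ineq[of "\<phi> (x + h) - (1 / (1 + s)) *\<^sub>R \<phi> x" "(1 / (1 + s)) *\<^sub>R \<phi> x - \<phi> x"] A Bq by simp
    then show ?thesis using xh by (simp add: s_def algebra_simps)
  qed
  moreover have "(4 * N + 1) * norm (\<phi> x) * c * norm h \<le> ((4 * N + 1) * norm (\<phi> x) * c + 1) * norm h" for h :: 'a
    by (simp add: mult_right_mono)
  ultimately have "\<forall>h. norm h < 1 / (2 * c) \<longrightarrow> x + h \<in> C \<and> norm (\<phi> (x + h) - \<phi> x) \<le> ((4 * N + 1) * norm (\<phi> x) * c + 1) * norm h"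
    using order_trans by blast
  moreover have "(4 * N + 1) * norm (\<phi> x) * c + 1 > 0" using N c by (intro add_nonneg_pos) auto
  moreover have "1 / (2 * c) > 0" using c by simp
  ultimately show ?thesis by blast
qed

lemma gr_isCont:
  assumes x: "x \<in> C" shows "isCont \<phi> x"
proof -
  obtain B d where B: "B > 0" "d > 0" "\<And>h. norm h < d \<Longrightarrow> norm (\<phi> (x + h) - \<phi> x) \<le> B * norm h"
    using gr_locally_lipschitz[OF x] by blast
  have ev: "\<forall>\<^sub>F h in at 0. norm (\<phi> (x + h) - \<phi> x) \<le> B * norm h"
    unfolding eventually_at using B by (intro exI[of _ d]) auto
  have "((\<lambda>h::'a. B * norm h) \<longlongrightarrow> B * norm (0::'a)) (at 0)"
    by (rule tendsto_mult[OF tendsto_const tendsto_norm[OF tendsto_ident_at]])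
  then have "((\<lambda>h. \<phi> (x + h) - \<phi> x) \<longlongrightarrow> 0) (at 0)" using Lim_null_comparison[OF ev] by simp
  then show ?thesis unfolding isCont_iff by (rule LIM_zero_cancel)
qed

lemma gr_continuous: "continuous_on C \<phi>"
  using gr_isCont by (simp add: continuous_at_imp_continuous_on)

text \<open>The image is open by invariance of domain, and closed because points with comparable
  images lie in a common compact order interval.\<close>

lemma gr_surj: "\<phi> ` C = C"
proof -
  have op: "open (\<phi> ` C)" by (rule invariance_of_domain[OF gr_continuous C_open gr_inj])
  have sub: "\<phi> ` C \<subseteq> C" using gr_in_C by blast
  have cl: "y \<in> \<phi> ` C" if y: "y \<in> closure (\<phi> ` C)" "y \<in> C" for y
  proof -
    \<comment> \<open>Any two points between half and twice \<open>y\<close> compare within a factor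
      of 4, which places their preimages in one order interval around \<open>x0\<close>.\<close>
    define U where "U = {u. u - (1/2) *\<^sub>R y \<in> C} \<inter> {u. 2 *\<^sub>R y - u \<in> C}"
    have "open {u. u - (1/2) *\<^sub>R y \<in> C}" "open {u. 2 *\<^sub>R y - u \<in> C}"
      using continuous_open_vimage[OF C_open, of "\<lambda>u. u - (1/2) *\<^sub>R y"]
        continuous_open_vimage[OF C_open, of "\<lambda>u. 2 *\<^sub>R y - u"]
      by (simp_all add: vimage_def continuous_intros)
    then have oU: "open U" unfolding U_def by (rule open_Int)
    have "y - (1/2) *\<^sub>R y = (1 - 1/2) *\<^sub>R y" "2 *\<^sub>R y - y = (2 - 1) *\<^sub>R y"
      by (simp_all only: scaleR_left_diff_distrib scaleR_one)
    then have "y - (1/2) *\<^sub>R y = (1/2) *\<^sub>R y" "2 *\<^sub>R y - y = y" by simp_all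
    then have yU: "y \<in> U" using y(2) C_scale[OF y(2), of "1/2"] by (auto simp: U_def)
    have cU: "y \<in> closure (U \<inter> \<phi> ` C)" using open_Int_closure_subset[OF oU] yU y by blast
    then have "U \<inter> \<phi> ` C \<noteq> {}" by auto
    then obtain x0 where x0: "x0 \<in> C" "\<phi> x0 \<in> U" by blast
    define I where "I = {x. x - (1/4) *\<^sub>R x0 \<in> K \<and> 4 *\<^sub>R x0 - x \<in> K}"
    have IC: "I \<subseteq> C"
    proof
      fix x assume "x \<in> I"
      then show "x \<in> C" using C_add_K[OF C_scale[OF x0(1), of "1/4"], of "x - (1/4) *\<^sub>R x0"] by (simp add: I_def)
    qed
    have "compact (\<phi> ` I)"
      by (rule compact_continuous_image) (use gr_continuous IC continuous_on_subset order_interval_compact I_def in auto)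
    then have clI: "closed (\<phi> ` I)" by (rule compact_imp_closed)
    have UI: "a \<in> U \<Longrightarrow> b \<in> U \<Longrightarrow> 4 *\<^sub>R b - a \<in> K" for a b
    proof -
      assume "a \<in> U" "b \<in> U"
      then have "4 *\<^sub>R (b - (1/2) *\<^sub>R y) \<in> K" "2 *\<^sub>R y - a \<in> K" using C_sub_K K_scale by (auto simp: U_def)
      then have "4 *\<^sub>R (b - (1/2) *\<^sub>R y) + (2 *\<^sub>R y - a) \<in> K" using K_add by blast
      then show ?thesis by (simp add: algebra_simps)
    qed
    have "U \<inter> \<phi> ` C \<subseteq> \<phi> ` I"
    proof
      fix v assume "v \<in> U \<inter> \<phi> ` C"
      then obtain x where x: "x \<in> C" "v = \<phi> x" "\<phi> x \<in> U" by blast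
      have "4 *\<^sub>R x - x0 \<in> K" using gr_rev[OF x(1) x0(1), of 4] UI[OF x(3) x0(2)] by simp
      then have "(1/4) *\<^sub>R (4 *\<^sub>R x - x0) \<in> K" using K_scale by simp
      then have "x - (1/4) *\<^sub>R x0 \<in> K" by (simp add: algebra_simps)
      moreover have "4 *\<^sub>R x0 - x \<in> K" using gr_rev[OF x0(1) x(1), of 4] UI[OF x0(2) x(3)] by simp
      ultimately show "v \<in> \<phi> ` I" using x by (auto simp: I_def)
    qed
    then have "y \<in> \<phi> ` I" using cU clI closure_minimal by blast
    then show ?thesis using IC by blast
  qed
  have "openin (top_of_set C) (\<phi> ` C)" using op sub by (simp add: open_subset)
  moreover have "\<phi> ` C = C \<inter> closure (\<phi> ` C)" using cl sub closure_subset by blast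
  then have "closedin (top_of_set C) (\<phi> ` C)" using closedin_closed by blast
  ultimately show ?thesis
    using convex_connected[OF C_convex] C_nonempty unfolding connected_clopen by blast
qed

end

lemma gr_inverse:
  assumes "gauge_reversing C \<phi>"
  shows "gauge_reversing C (inv_into C \<phi>)" "\<And>x. x \<in> C \<Longrightarrow> inv_into C \<phi> (\<phi> x) = x"
    "\<And>x. x \<in> C \<Longrightarrow> \<phi> (inv_into C \<phi> x) = x"
proof -
  note s = gr_surj[OF assms]
  show i: "\<And>x. x \<in> C \<Longrightarrow> inv_into C \<phi> (\<phi> x) = x" using gr_inj[OF assms] by simp
  show j: "\<And>x. x \<in> C \<Longrightarrow> \<phi> (inv_into C \<phi> x) = x" using s by (simp add: f_inv_into_f)
  have in_C: "x \<in> C \<Longrightarrow> inv_into C \<phi> x \<in> C" for x using s inv_into_into by metis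
  then show "gauge_reversing C (inv_into C \<phi>)"
    unfolding gauge_reversing_iff using gr_rev[OF assms in_C in_C] j by simp
qed

end

section \<open>Inverse pairs and the representation of functionals by gauges\<close>

locale gauge_pair = proper_cone +
  fixes \<phi> \<psi> :: "'a \<Rightarrow> 'a"
  assumes phi: "gauge_reversing C \<phi>" and psi: "gauge_reversing C \<psi>"
    and psi_phi: "\<And>x. x \<in> C \<Longrightarrow> \<psi> (\<phi> x) = x" and phi_psi: "\<And>x. x \<in> C \<Longrightarrow> \<phi> (\<psi> x) = x"

context proper_cone
begin

text \<open>\<open>represents \<phi> f q\<close> says \<open>f \<bullet> y = M(q, \<phi> y)\<close> for the gauge extended to \<open>q \<in> K\<close>.\<close>

definition represents :: "('a \<Rightarrow> 'a) \<Rightarrow> 'a \<Rightarrow> 'a \<Rightarrow> bool" where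
  "represents \<phi> f q \<longleftrightarrow> q \<in> K \<and> (\<forall>y\<in>C. \<phi> y - q \<in> K \<longleftrightarrow> f \<bullet> y \<le> 1)"

lemma representsD:
  assumes "gauge_reversing C \<phi>" "represents \<phi> f q" "y \<in> C" "l > 0"
  shows "l *\<^sub>R \<phi> y - q \<in> K \<longleftrightarrow> f \<bullet> y \<le> l"
proof -
  have "(1 / l) *\<^sub>R y \<in> C" using assms C_scale by simp
  then have "\<phi> ((1 / l) *\<^sub>R y) - q \<in> K \<longleftrightarrow> f \<bullet> ((1 / l) *\<^sub>R y) \<le> 1" using assms(2) represents_def by blast
  then show ?thesis using gr_scale[OF assms(1,3), of "1 / l"] assms(4) by simp
qed

text \<open>Functionals violating membership for every \<open>n\<close>, normalised and passed to a
  limit, vanish on \<open>z\<close> and are nonpositive on \<open>h\<close>. The limit is then a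
  unit vector on the ray of \<open>f\<close>, against \<open>0 < f \<bullet> h\<close>.\<close>

lemma exposing_ray_enters_cone:
  assumes f: "f \<in> Kd" and z: "\<And>g. g \<in> Kd \<Longrightarrow> 0 \<le> g \<bullet> z"
    "\<And>g. g \<in> Kd \<Longrightarrow> g \<bullet> z = 0 \<Longrightarrow> \<exists>c\<ge>0. g = c *\<^sub>R f" and h: "0 < f \<bullet> h"
  shows "\<exists>n. h + real n *\<^sub>R z \<in> K"
proof (rule ccontr)
  assume neg: "\<not> ?thesis"
  have "\<exists>g. g \<in> Kd \<inter> sphere 0 1 \<and> g \<bullet> (h + real n *\<^sub>R z) < 0" for n
  proof -
    obtain g where g: "g \<in> Kd" "g \<bullet> (h + real n *\<^sub>R z) < 0" using neg bipolar by (meson not_le)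
    have "g \<noteq> 0" using g by auto
    then have "(1 / norm g) *\<^sub>R g \<in> Kd \<inter> sphere 0 1" using g Kd_scale by auto
    moreover have "((1 / norm g) *\<^sub>R g) \<bullet> (h + real n *\<^sub>R z) < 0"
      using g \<open>g \<noteq> 0\<close> by (simp add: divide_less_0_iff)
    ultimately show ?thesis by blast
  qed
  then obtain G where G: "\<And>n. G n \<in> Kd \<inter> sphere 0 1" "\<And>n. G n \<bullet> (h + real n *\<^sub>R z) < 0" by metis
  have "compact (Kd \<inter> sphere 0 1)" using Kd_closed by (simp add: closed_Int_compact)
  then obtain g r where g: "g \<in> Kd \<inter> sphere 0 1" "strict_mono (r :: nat \<Rightarrow> nat)" "(G \<circ> r) \<longlonglongrightarrow> g"
    using G(1) unfolding compact_def by metis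
  have gz: "0 \<le> G n \<bullet> z" for n using G(1) z(1) by blast
  have gh: "G n \<bullet> h \<le> 0" for n
  proof -
    have "G n \<bullet> h + real n * (G n \<bullet> z) < 0" using G(2)[of n] by (simp add: inner_add_right)
    moreover have "0 \<le> real n * (G n \<bullet> z)" using gz by simp
    ultimately show ?thesis by linarith
  qed
  have gz2: "G n \<bullet> z \<le> norm h / real n" if "n > 0" for n
  proof -
    have "real n * (G n \<bullet> z) \<le> - (G n \<bullet> h)" using G(2)[of n] by (simp add: inner_add_right)
    also have "\<dots> \<le> norm h" using Cauchy_Schwarz_ineq2[of "G n" h] G(1)[of n] by auto
    finally show ?thesis using that by (simp add: field_simps)
  qed
  have lz: "(\<lambda>n. (G \<circ> r) n \<bullet> z) \<longlonglongrightarrow> g \<bullet> z" and lh: "(\<lambda>n. (G \<circ> r) n \<bullet> h) \<longlonglongrightarrow> g \<bullet> h"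
    using tendsto_inner[OF g(3) tendsto_const] by auto
  have ev: "\<forall>\<^sub>F n in sequentially. (G \<circ> r) n \<bullet> z \<le> norm h * (1 / real n)"
  proof (rule eventually_sequentiallyI[of 1])
    fix n :: nat assume n: "n \<ge> 1"
    have rn: "n \<le> r n" using g(2) by (rule seq_suble)
    then have "(G \<circ> r) n \<bullet> z \<le> norm h / real (r n)" using gz2[of "r n"] n by simp
    also have "\<dots> \<le> norm h / real n" using rn n by (intro divide_left_mono) auto
    finally show "(G \<circ> r) n \<bullet> z \<le> norm h * (1 / real n)" by simp
  qed
  have "(\<lambda>n. norm h * (1 / real n)) \<longlonglongrightarrow> norm h * 0" by (intro tendsto_intros lim_1_over_n)
  then have "g \<bullet> z \<le> norm h * 0" using tendsto_le[OF _ _ lz ev] by simp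
  then have "g \<bullet> z = 0" using z(1) g by force
  then obtain c where c: "c \<ge> 0" "g = c *\<^sub>R f" using z(2) g by blast
  have "g \<bullet> h \<le> 0" using LIMSEQ_le_const2[OF lh] gh by auto
  then have "c = 0" using c h by (simp add: mult_le_0_iff)
  then show False using c g by auto
qed

end

section \<open>Duality induced by a gauge-reversing map\<close>

context gauge_pair
begin

lemma phi_in: "x \<in> C \<Longrightarrow> \<phi> x \<in> C" and psi_in: "x \<in> C \<Longrightarrow> \<psi> x \<in> C"
  using gr_in_C phi psi by auto

lemma swap: "gauge_pair C \<psi> \<phi>"
  by (unfold_locales) (auto simp: phi psi psi_phi phi_psi)

text \<open>If \<open>z\<close> exposes \<open>f\<close>, then \<open>q\<close> is a multiple of the limit of \<open>\<phi> (e + n z)\<close>.\<close>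

lemma represents_exists:
  assumes "f \<in> X" shows "\<exists>q. represents \<phi> f q"
proof -
  obtain z where f: "f \<in> Kd" "f \<noteq> 0" "f \<bullet> z = 0" and z: "\<And>g. g \<in> Kd \<Longrightarrow> 0 \<le> g \<bullet> z"
    "\<And>g. g \<in> Kd \<Longrightarrow> g \<bullet> z = 0 \<Longrightarrow> \<exists>c\<ge>0. g = c *\<^sub>R f"
    using assms unfolding exposed_rays_def by blast
  have zK: "z \<in> K" using z(1) bipolar by blast
  obtain e where e: "e \<in> C" using C_nonempty by blast
  have fe: "f \<bullet> e > 0" using Kd_pos e f by blast
  define u where "u n = e + real n *\<^sub>R z" for n :: nat
  have uC: "u n \<in> C" for n unfolding u_def using C_add_K[OF e] K_scale[OF zK] by simp
  have umono: "u n - u m \<in> K" if "m \<le> n" for m n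
    using K_scale[OF zK, of "real n - real m"] that by (simp add: u_def algebra_simps)
  have dec: "\<phi> (u m) - \<phi> (u n) \<in> K" if "m \<le> n" for m n
    using gr_antitone[OF phi uC uC] umono[OF that] by blast
  have inI: "\<forall>n. \<phi> (u n) \<in> {x. x - 0 \<in> K \<and> \<phi> (u 0) - x \<in> K}"
    using dec[OF le0] phi_in[OF uC] C_sub_K by simp
  have sc: "seq_compact {x. x - 0 \<in> K \<and> \<phi> (u 0) - x \<in> K}"
    using order_interval_compact compact_eq_seq_compact_metric by blast
  obtain p r where p: "p \<in> {x. x - 0 \<in> K \<and> \<phi> (u 0) - x \<in> K}"
    "strict_mono (r :: nat \<Rightarrow> nat)" "((\<lambda>n. \<phi> (u n)) \<circ> r) \<longlonglongrightarrow> p"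
    by (rule seq_compactE[OF sc inI])
  then have pr: "strict_mono r" "(\<lambda>n. \<phi> (u (r n))) \<longlonglongrightarrow> p" "p \<in> K" by (simp_all add: o_def)
  have ple: "\<phi> (u n) - p \<in> K" for n
  proof (rule K_limit)
    show "\<phi> (u n) - \<phi> (u (r (m + n))) \<in> K" for m using dec seq_suble[OF pr(1), of "m + n"] by simp
    show "(\<lambda>m. \<phi> (u n) - \<phi> (u (r (m + n)))) \<longlonglongrightarrow> \<phi> (u n) - p"
      by (intro tendsto_intros LIMSEQ_ignore_initial_segment pr(2))
  qed
  have key: "((1 / (f \<bullet> e)) *\<^sub>R \<phi> y - p \<in> K) = (f \<bullet> y \<le> 1)" if y: "y \<in> C" for y
  proof
    assume a: "f \<bullet> y \<le> 1"
    show "(1 / (f \<bullet> e)) *\<^sub>R \<phi> y - p \<in> K"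
    proof (rule K_archimedean)
      fix d :: real assume d: "d > 0"
      define l where "l = 1 / (f \<bullet> e) + d"
      have l: "l > 0" using d fe by (simp add: l_def add_pos_pos)
      have "l * (f \<bullet> e) > 1" using d fe by (simp add: l_def field_simps)
      then have "0 < f \<bullet> (l *\<^sub>R e - y)" using a by (simp add: inner_diff_right)
      then obtain n where n: "l *\<^sub>R e - y + real n *\<^sub>R z \<in> K"
        using exposing_ray_enters_cone[OF f(1) z] by blast
      \<comment> \<open>Passing from \<open>n\<close> to a larger multiple \<open>l * real m\<close>
        does no harm because \<open>z\<close> lies in the closed cone, and it turns the sum into
        \<open>l *\<^sub>R u m - y\<close>.\<close>
      obtain m where m: "real n \<le> l * real m" using l
        by (metis mult.commute pos_divide_le_eq real_arch_simple)
      have "(l *\<^sub>R e - y + real n *\<^sub>R z) + (l * real m - real n) *\<^sub>R z \<in> K"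
        using n K_scale[OF zK] m K_add by simp
      then have "l *\<^sub>R u m - y \<in> K" by (simp add: u_def algebra_simps)
      then have "l *\<^sub>R \<phi> y - \<phi> (u m) \<in> K" using gr_rev[OF phi uC y l] by blast
      then have "l *\<^sub>R \<phi> y - p \<in> K" using ple K_trans by blast
      then show "(1 / (f \<bullet> e)) *\<^sub>R \<phi> y - p + d *\<^sub>R \<phi> y \<in> K" by (simp add: l_def algebra_simps)
    qed
  next
    assume a: "(1 / (f \<bullet> e)) *\<^sub>R \<phi> y - p \<in> K"
    obtain c where c: "c > 0" "\<And>h. (c * norm h) *\<^sub>R \<phi> y - h \<in> K" using order_unit[OF phi_in[OF y]] by blast
    have "f \<bullet> y \<le> 1 + d" if d: "d > 0" for d
    proof -
      define s where "s = d / (f \<bullet> e)"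
      have s: "s > 0" using d fe by (simp add: s_def)
      then have "s / c > 0" using c by simp
      then obtain n where n: "norm (\<phi> (u (r n)) - p) < s / c"
        using LIMSEQ_D[OF pr(2)] by blast
      have "(c * norm (\<phi> (u (r n)) - p)) *\<^sub>R \<phi> y - (\<phi> (u (r n)) - p) \<in> K" by (rule c(2))
      moreover have "(s - c * norm (\<phi> (u (r n)) - p)) *\<^sub>R \<phi> y \<in> K"
        using n c phi_in[OF y] C_sub_K by (intro K_scale) (auto simp: field_simps)
      ultimately have "((c * norm (\<phi> (u (r n)) - p)) *\<^sub>R \<phi> y - (\<phi> (u (r n)) - p))
        + (s - c * norm (\<phi> (u (r n)) - p)) *\<^sub>R \<phi> y + ((1 / (f \<bullet> e)) *\<^sub>R \<phi> y - p) \<in> K"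
        using a K_add by blast
      then have "(1 / (f \<bullet> e) + s) *\<^sub>R \<phi> y - \<phi> (u (r n)) \<in> K" by (simp add: algebra_simps)
      then have "(1 / (f \<bullet> e) + s) *\<^sub>R u (r n) - y \<in> K"
        using gr_rev[OF phi uC y] fe s by (simp add: add_pos_pos)
      then have "0 \<le> f \<bullet> ((1 / (f \<bullet> e) + s) *\<^sub>R u (r n) - y)" using f Kd_nonneg by blast
      \<comment> \<open>The exposing vector is annihilated by \<open>f\<close>, so \<open>f\<close>
        is constant along the sequence although the sequence is unbounded in other
        directions.\<close>
      moreover have "f \<bullet> u (r n) = f \<bullet> e" using f by (simp add: u_def inner_add_right)
      ultimately have "f \<bullet> y \<le> (1 / (f \<bullet> e) + s) * (f \<bullet> e)" by (simp add: inner_diff_right)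
      also have "\<dots> = 1 + d" using fe by (simp add: s_def field_simps)
      finally show ?thesis .
    qed
    then show "f \<bullet> y \<le> 1" by (rule field_le_epsilon)
  qed
  \<comment> \<open>The limit \<open>p\<close> represents \<open>f\<close> divided by
    \<open>f \<bullet> e\<close>; the factor undoes this normalisation.\<close>
  have "represents \<phi> f ((f \<bullet> e) *\<^sub>R p)"
    unfolding represents_def
  proof (intro conjI ballI)
    show "(f \<bullet> e) *\<^sub>R p \<in> K" using pr(3) fe K_scale by simp
    fix y assume y: "y \<in> C"
    have "\<phi> y - (f \<bullet> e) *\<^sub>R p \<in> K \<longleftrightarrow> (1 / (f \<bullet> e)) *\<^sub>R \<phi> y - p \<in> K"
    proof
      assume "\<phi> y - (f \<bullet> e) *\<^sub>R p \<in> K"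
      from K_scale[OF this, of "1 / (f \<bullet> e)"] show "(1 / (f \<bullet> e)) *\<^sub>R \<phi> y - p \<in> K"
        using fe by (simp add: scaleR_diff_right)
    next
      assume "(1 / (f \<bullet> e)) *\<^sub>R \<phi> y - p \<in> K"
      from K_scale[OF this, of "f \<bullet> e"] show "\<phi> y - (f \<bullet> e) *\<^sub>R p \<in> K"
        using fe by (simp add: scaleR_diff_right)
    qed
    then show "\<phi> y - (f \<bullet> e) *\<^sub>R p \<in> K \<longleftrightarrow> f \<bullet> y \<le> 1" using key[OF y] by simp
  qed
  then show ?thesis by blast
qed

text \<open>Tested at \<open>y = d *\<^sub>R e + r\<close>, just above \<open>r\<close>: since
  \<open>\<psi> (\<phi> y) = y\<close> dominates \<open>r\<close>, the value
  \<open>f \<bullet> \<phi> y\<close> is at most 1, while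
  \<open>(g \<bullet> y) *\<^sub>R \<phi> y\<close> dominates \<open>q\<close>. Hence
  \<open>f \<bullet> q \<le> g \<bullet> y\<close>, and \<open>d\<close> is arbitrarily
  small.\<close>

lemma represents_pairing_le:
  assumes q: "represents \<phi> g q" and r: "represents \<psi> f r" and "f \<in> Kd" "g \<in> Kd" "g \<noteq> 0"
  shows "f \<bullet> q \<le> g \<bullet> r"
proof -
  obtain e where e: "e \<in> C" using C_nonempty by blast
  have ge: "g \<bullet> e > 0" using Kd_pos e assms by blast
  show ?thesis
  proof (rule field_le_epsilon)
    fix t :: real assume t: "t > 0"
    define d where "d = t / (g \<bullet> e)"
    have d: "d > 0" using t ge by (simp add: d_def)
    define y where "y = d *\<^sub>R e + r"
    have y: "y \<in> C" unfolding y_def using C_add_K C_scale[OF e d] r by (simp add: represents_def)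
    have "\<psi> (\<phi> y) - r \<in> K" using psi_phi[OF y] C_sub_K[OF C_scale[OF e d]] by (simp add: y_def)
    then have fy: "f \<bullet> \<phi> y \<le> 1" using r phi_in[OF y] by (simp add: represents_def)
    have gy: "g \<bullet> y > 0" using Kd_pos y assms by blast
    then have "(g \<bullet> y) *\<^sub>R \<phi> y - q \<in> K" using representsD[OF phi q y] by simp
    then have "f \<bullet> q \<le> (g \<bullet> y) * (f \<bullet> \<phi> y)" using Kd_nonneg[OF assms(3)] by (force simp: inner_diff_right)
    also have "\<dots> \<le> g \<bullet> y" using fy gy by (simp add: mult_le_cancel_left1)
    also have "\<dots> = g \<bullet> r + t" using ge by (simp add: y_def d_def inner_add_right)
    finally show "f \<bullet> q \<le> g \<bullet> r + t" .
  qed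
qed

lemma represents_pairing:
  assumes "represents \<phi> g q" "represents \<psi> f r" "f \<in> X" "g \<in> X"
  shows "f \<bullet> q = g \<bullet> r"
proof -
  interpret s: gauge_pair C \<psi> \<phi> by (rule swap)
  have "f \<in> Kd" "g \<in> Kd" "f \<noteq> 0" "g \<noteq> 0" using assms by (auto simp: exposed_rays_def)
  then show ?thesis using represents_pairing_le s.represents_pairing_le assms by (meson order_antisym)
qed

text \<open>By the pairing identity, the linear extensions of the two assignments from a basis of
  exposed functionals are adjoint to each other and agree with the assignments on all exposed
  functionals: each equation can be tested on the basis.\<close>

lemma represents_linear:
  "\<exists>L. linear L \<and> (\<forall>f\<in>X. represents \<phi> f (L f) \<and> represents \<psi> f (adjoint L f))"
proof -
  interpret s: gauge_pair C \<psi> \<phi> by (rule swap)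
  obtain q r where q: "\<And>f. f \<in> X \<Longrightarrow> represents \<phi> f (q f)" and r: "\<And>f. f \<in> X \<Longrightarrow> represents \<psi> f (r f)"
    using represents_exists s.represents_exists by metis
  obtain B where B: "B \<subseteq> X" "independent B" and sB: "span B = UNIV"
    by (rule spanning_set_basis[OF span_X])
  have test: "x = y" if "\<And>f. f \<in> B \<Longrightarrow> f \<bullet> x = f \<bullet> y" for x y
  proof -
    have "orthogonal (x - y) v" if "v \<in> span B" for v
      by (rule orthogonal_to_span[OF that]) (use \<open>\<And>f. f \<in> B \<Longrightarrow> f \<bullet> x = f \<bullet> y\<close> in \<open>auto simp: orthogonal_def inner_diff_left inner_diff_right inner_commute\<close>)
    then have "orthogonal (x - y) (x - y)" using sB by blast
    then show ?thesis by (simp add: orthogonal_def)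
  qed
  obtain L M where L: "linear L" "\<And>f. f \<in> B \<Longrightarrow> L f = q f" and M: "linear M" "\<And>f. f \<in> B \<Longrightarrow> M f = r f"
    using linear_independent_extend[OF B(2)] by metis
  have "M f = adjoint L f" if f: "f \<in> B" for f
  proof (rule test)
    fix g assume g: "g \<in> B"
    have "g \<bullet> M f = f \<bullet> L g" using represents_pairing[OF q r, of g f, symmetric] L(2)[OF g] M(2)[OF f] f g B(1) by auto
    then show "g \<bullet> M f = g \<bullet> adjoint L f" using adjoint_works[OF L(1)] by (metis inner_commute)
  qed
  then have MA: "M = adjoint L" using linear_eq_on_span[OF M(1) adjoint_linear[OF L(1)]] sB by blast
  have qL: "q g = L g" if g: "g \<in> X" for g
  proof (rule test)
    fix f assume f: "f \<in> B"
    have "f \<bullet> q g = g \<bullet> M f" using represents_pairing[OF q r, of g f] M(2)[OF f] f g B(1) by auto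
    then show "f \<bullet> q g = f \<bullet> L g" using adjoint_works[OF L(1), of g f] MA by (metis inner_commute)
  qed
  have "r f = adjoint L f" if f: "f \<in> X" for f
  proof (rule test)
    fix g assume g: "g \<in> B"
    have "g \<bullet> r f = f \<bullet> L g" using represents_pairing[OF q r, of g f, symmetric] L(2)[OF g] f g B(1) by auto
    then show "g \<bullet> r f = g \<bullet> adjoint L f" using adjoint_works[OF L(1)] by (metis inner_commute)
  qed
  then show ?thesis using L(1) q r qL by metis
qed

end

text \<open>A sequence of difference quotients, rather than the Frechet remainder, is what
  closedness of the cone can act on: order relations pass to its limit.\<close>

lemma has_derivative_directional_sequence:
  fixes f :: "'a::real_normed_vector \<Rightarrow> 'b::real_normed_vector"
  assumes "(f has_derivative f') (at x)"
  shows "(\<lambda>n. real (Suc n) *\<^sub>R (f (x + (1 / real (Suc n)) *\<^sub>R h) - f x)) \<longlonglongrightarrow> f' h"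
proof (cases "h = 0")
  case True
  then show ?thesis using assms by (simp add: linear_0 has_derivative_linear)
next
  case False
  interpret f': bounded_linear f' using assms by (rule has_derivative_bounded_linear)
  define k where "k n = (1 / real (Suc n)) *\<^sub>R h" for n
  have lim: "(\<lambda>h. norm (f (x + h) - f x - f' h) / norm h) \<midarrow>0\<rightarrow> 0" using assms has_derivative_at by blast
  have "k \<longlonglongrightarrow> 0 *\<^sub>R h" unfolding k_def by (intro tendsto_intros LIMSEQ_Suc lim_1_over_n)
  then have "filterlim k (at 0) sequentially" using False by (simp add: filterlim_at k_def)
  then have "(\<lambda>n. norm (f (x + k n) - f x - f' (k n)) / norm (k n)) \<longlonglongrightarrow> 0"
    using filterlim_compose[OF lim] by blast
  then have l: "(\<lambda>n. norm (f (x + k n) - f x - f' (k n)) / norm (k n) * norm h) \<longlonglongrightarrow> 0 * norm h"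
    by (rule tendsto_mult_right)
  have "norm (f (x + k n) - f x - f' (k n)) / norm (k n) * norm h
      = norm (real (Suc n) *\<^sub>R (f (x + k n) - f x) - f' h)" for n
  proof -
    have "real (Suc n) *\<^sub>R (f (x + k n) - f x) - f' h = real (Suc n) *\<^sub>R (f (x + k n) - f x - f' (k n))"
      by (simp add: k_def f'.scaleR scaleR_diff_right)
    then have "norm (real (Suc n) *\<^sub>R (f (x + k n) - f x) - f' h)
        = real (Suc n) * norm (f (x + k n) - f x - f' (k n))" by simp
    moreover have "norm h = real (Suc n) * norm (k n)" "norm (k n) \<noteq> 0" using False by (simp_all add: k_def)
    ultimately show ?thesis by (simp del: of_nat_Suc)
  qed
  then have "(\<lambda>n. norm (real (Suc n) *\<^sub>R (f (x + k n) - f x) - f' h)) \<longlonglongrightarrow> 0" using l by simp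
  then have "(\<lambda>n. real (Suc n) *\<^sub>R (f (x + k n) - f x) - f' h) \<longlonglongrightarrow> 0" by (rule tendsto_norm_zero_cancel)
  then show ?thesis unfolding k_def by (rule LIM_zero_cancel)
qed

text \<open>The difference of the bounds is minimal at \<open>m\<close>, so both have the same
  derivative there and the remainder of \<open>v\<close> is caught between theirs.\<close>

lemma has_derivative_sandwich:
  fixes a v b :: "'a::euclidean_space \<Rightarrow> real"
  assumes a: "(a has_derivative a') (at m)" and b: "(b has_derivative b') (at m)"
    and S: "open S" "m \<in> S" and le: "\<And>y. y \<in> S \<Longrightarrow> a y \<le> v y" "\<And>y. y \<in> S \<Longrightarrow> v y \<le> b y"
    and eq: "a m = v m" "v m = b m"
  shows "(v has_derivative a') (at m)"
proof -
  have "((\<lambda>y. b y - a y) has_derivative (\<lambda>h. b' h - a' h)) (at m)" by (intro derivative_intros a b)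
  then have "(\<lambda>h. b' h - a' h) = (\<lambda>h. 0)"
    by (rule differential_zero_maxmin[OF S(2,1)]) (use le eq order_trans in force)
  then have ba: "b' = a'" by (simp add: fun_eq_iff)
  have la: "(\<lambda>h. norm (a (m + h) - a m - a' h) / norm h) \<midarrow>0\<rightarrow> 0" using a has_derivative_at by blast
  have lb: "(\<lambda>h. norm (b (m + h) - b m - a' h) / norm h) \<midarrow>0\<rightarrow> 0" using b ba has_derivative_at by blast
  obtain d where d: "d > 0" "ball m d \<subseteq> S" using S openE by blast
  have "\<forall>\<^sub>F h in at 0. norm (norm (v (m + h) - v m - a' h) / norm h)
     \<le> norm (a (m + h) - a m - a' h) / norm h + norm (b (m + h) - b m - a' h) / norm h"
    unfolding eventually_at
  proof (intro exI[of _ d] conjI ballI impI)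
    fix h :: 'a assume h: "h \<noteq> 0 \<and> dist h 0 < d"
    then have "m + h \<in> S" using d by (auto simp: dist_norm)
    then have "a (m + h) \<le> v (m + h)" "v (m + h) \<le> b (m + h)" using le by auto
    then have "\<bar>v (m + h) - v m - a' h\<bar> \<le> \<bar>a (m + h) - a m - a' h\<bar> + \<bar>b (m + h) - b m - a' h\<bar>" using eq by linarith
    then show "norm (norm (v (m + h) - v m - a' h) / norm h)
     \<le> norm (a (m + h) - a m - a' h) / norm h + norm (b (m + h) - b m - a' h) / norm h"
      by (simp add: divide_right_mono flip: add_divide_distrib)
  qed (use d in auto)
  then have "(\<lambda>h. norm (v (m + h) - v m - a' h) / norm h) \<midarrow>0\<rightarrow> 0"
    by (rule Lim_null_comparison) (use tendsto_add[OF la lb] in simp)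
  then show ?thesis using a has_derivative_at by blast
qed

text \<open>If \<open>z\<close> exposes \<open>f\<close>, then \<open>adjoint (inv M) z\<close>
  exposes \<open>M f\<close>.\<close>

lemma exposed_rays_linear_image:
  fixes M :: "'a::euclidean_space \<Rightarrow> 'a"
  assumes M: "linear M" "bij M" "M ` P = P" and f: "f \<in> exposed_rays P"
  shows "M f \<in> exposed_rays P"
proof -
  obtain z where z: "f \<in> P" "f \<noteq> 0" "f \<bullet> z = 0"
    "\<And>g. g \<in> P \<Longrightarrow> 0 \<le> g \<bullet> z" "\<And>g. g \<in> P \<Longrightarrow> g \<bullet> z = 0 \<Longrightarrow> \<exists>c\<ge>0. g = c *\<^sub>R f"
    using f unfolding exposed_rays_def by blast
  have inv: "inv M (M x) = x" for x using M(2) by (simp add: bij_is_inj)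
  have linv: "linear (inv M)" using M by (simp add: linear_injective_left_inverse bij_is_inj inj_linear_imp_inv_linear)
  define w where "w = adjoint (inv M) z"
  have w: "M g \<bullet> w = g \<bullet> z" for g
    using adjoint_works[OF linv, of "M g" z] inv by (simp add: w_def)
  have "M f \<noteq> 0" using z(2) M inv linear_0[OF linv] by metis
  moreover have "0 \<le> g \<bullet> w \<and> (g \<bullet> w = 0 \<longrightarrow> (\<exists>c\<ge>0. g = c *\<^sub>R M f))" if "g \<in> P" for g
  proof -
    have "g \<in> M ` P" using that M(3) by simp
    then obtain g' where g': "g' \<in> P" "g = M g'" by blast
    have gw: "g \<bullet> w = g' \<bullet> z" using w g' by simp
    have "\<exists>c\<ge>0. g = c *\<^sub>R M f" if g0: "g \<bullet> w = 0"
    proof -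
      obtain c where "c \<ge> 0" "g' = c *\<^sub>R f" using z(5)[OF g'(1)] gw g0 by auto
      then show ?thesis using g' linear_scale[OF M(1)] by auto
    qed
    then show ?thesis using z(4)[OF g'(1)] gw by simp
  qed
  moreover have "M f \<in> P" using imageI[OF z(1), of M] M(3) by simp
  moreover have "M f \<bullet> w = 0" using z w by simp
  ultimately show ?thesis unfolding exposed_rays_def by blast
qed

section \<open>The duality map and its image\<close>

context proper_cone
begin

definition duality :: "('a \<Rightarrow> 'a) \<Rightarrow> ('a \<Rightarrow> 'a) \<Rightarrow> ('a \<Rightarrow> 'a) \<Rightarrow> bool" where
  "duality \<phi> \<psi> L \<longleftrightarrow> linear L \<and> (\<forall>f\<in>X. represents \<phi> f (L f) \<and> represents \<psi> f (adjoint L f))"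

lemma duality_swap: "duality \<phi> \<psi> L \<Longrightarrow> duality \<psi> \<phi> (adjoint L)"
  unfolding duality_def by (simp add: adjoint_linear adjoint_adjoint)

lemma X_D: "f \<in> X \<Longrightarrow> f \<in> Kd" "f \<in> X \<Longrightarrow> f \<noteq> 0"
  by (auto simp: exposed_rays_def)

lemma X_scale:
  assumes "f \<in> X" "t > 0" shows "t *\<^sub>R f \<in> X"
proof (rule exposed_rays_linear_image[where M = "\<lambda>f. t *\<^sub>R f"])
  have "(\<lambda>f. t *\<^sub>R f) ` Kd \<subseteq> Kd" using assms Kd_scale by auto
  moreover have "Kd \<subseteq> (\<lambda>f. t *\<^sub>R f) ` Kd"
  proof
    fix f assume "f \<in> Kd"
    then have "(1 / t) *\<^sub>R f \<in> Kd" "f = t *\<^sub>R ((1 / t) *\<^sub>R f)" using assms Kd_scale by auto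
    then show "f \<in> (\<lambda>f. t *\<^sub>R f) ` Kd" by blast
  qed
  ultimately show "(\<lambda>f. t *\<^sub>R f) ` Kd = Kd" by blast
  show "linear (\<lambda>f::'a. t *\<^sub>R f)" by (simp add: linear_scale_self)
  show "bij (\<lambda>f::'a. t *\<^sub>R f)"
    by (rule o_bij[of "\<lambda>f. (1 / t) *\<^sub>R f"]) (use assms in \<open>auto simp: o_def\<close>)
qed (use assms in auto)

definition aut :: "('a \<Rightarrow> 'a) \<Rightarrow> bool" where
  "aut A \<longleftrightarrow> linear A \<and> bij A \<and> A ` C = C"

lemma autI_closure: "linear A \<Longrightarrow> bij A \<Longrightarrow> A ` K = K \<Longrightarrow> aut A"
  unfolding aut_def using interior_bijective_linear_image[of A K] interior_K by metis

end

context gauge_pair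
begin

lemma duality_exists: "\<exists>L. duality \<phi> \<psi> L"
  using represents_linear unfolding duality_def .

context
  fixes L assumes L: "duality \<phi> \<psi> L"
begin

lemma L_linear: "linear L" and L_rep: "f \<in> X \<Longrightarrow> represents \<phi> f (L f)"
  and L_rep': "f \<in> X \<Longrightarrow> represents \<psi> f (adjoint L f)"
  using L by (auto simp: duality_def)

lemma L_adj: "L f \<bullet> g = f \<bullet> adjoint L g"
  using adjoint_works[OF L_linear] by metis

lemma L_Kd: "f \<in> Kd \<Longrightarrow> L f \<in> K"
  unfolding K_X[of "L f"] by (metis L_adj L_rep' Kd_nonneg inner_commute represents_def)

text \<open>Approximate \<open>p\<close> from inside the cone by \<open>w n\<close>. Some multiple
  of \<open>\<phi> e\<close> fails to dominate \<open>p\<close>, hence fails to dominate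
  \<open>w n\<close>; reversing, some unit exposed functional is at most \<open>c\<close> on
  \<open>\<psi> (w n)\<close>, which says that its image under \<open>L\<close> lies below
  \<open>c *\<^sub>R w n\<close>. A limit of these functionals is the required
  \<open>f\<close>.\<close>

lemma representing_below:
  assumes p: "p \<in> K" "p \<noteq> 0"
  shows "\<exists>f\<in>Kd. L f \<noteq> 0 \<and> (\<exists>c>0. c *\<^sub>R p - L f \<in> K)"
proof -
  obtain e where e: "e \<in> C" using C_nonempty by blast
  obtain \<mu> where mu: "\<mu> > 0" "\<mu> *\<^sub>R \<phi> e - p \<notin> K"
  proof (rule ccontr)
    assume "\<not> thesis"
    then have "- p + d *\<^sub>R \<phi> e \<in> K" if "d > 0" for d using that \<open>\<And>\<mu>. \<lbrakk>0 < \<mu>; \<mu> *\<^sub>R \<phi> e - p \<notin> K\<rbrakk> \<Longrightarrow> thesis\<close> by force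
    then have "- p \<in> K" by (rule K_archimedean)
    then show False using K_pointed p by blast
  qed
  define w where "w n = (1 / real (Suc n)) *\<^sub>R e + p" for n
  have wC: "w n \<in> C" for n unfolding w_def by (rule C_add_K[OF C_scale[OF e] p(1)]) simp
  define c where "c = (norm e + 1) / \<mu>"
  have c: "c > 0" using mu by (simp add: c_def add_nonneg_pos)
  have "\<exists>f. f \<in> X \<and> norm f = 1 \<and> f \<bullet> \<psi> (w n) \<le> c" for n
  proof -
    have "\<mu> *\<^sub>R \<phi> e - w n \<notin> K"
    proof
      assume "\<mu> *\<^sub>R \<phi> e - w n \<in> K"
      moreover have "w n - p \<in> K" unfolding w_def using C_scale[OF e] C_sub_K by simp
      ultimately show False using mu K_trans by blast
    qed
    then have "\<mu> *\<^sub>R \<psi> (w n) - e \<notin> K"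
      using gr_rev[OF phi psi_in[OF wC] e mu(1), of n] phi_psi[OF wC, of n] by simp
    then obtain f where f: "f \<in> X" "f \<bullet> (\<mu> *\<^sub>R \<psi> (w n) - e) < 0" using K_X by (meson not_le)
    have f0: "f \<noteq> 0" using f X_D by blast
    define f1 where "f1 = (1 / norm f) *\<^sub>R f"
    have "f1 \<bullet> (\<mu> *\<^sub>R \<psi> (w n) - e) < 0" using f f0 by (simp add: f1_def divide_less_0_iff)
    moreover have n1: "norm f1 = 1" using f0 by (simp add: f1_def)
    moreover have "f1 \<bullet> e \<le> norm e" using Cauchy_Schwarz_ineq2[of f1 e] n1 by simp
    ultimately have "f1 \<bullet> \<psi> (w n) \<le> c" using mu(1) by (simp add: inner_diff_right c_def field_simps)
    then show ?thesis using n1 X_scale[OF f(1), of "1 / norm f"] f0 f1_def by auto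
  qed
  then obtain F where F: "\<And>n. F n \<in> X" "\<And>n. norm (F n) = 1" "\<And>n. F n \<bullet> \<psi> (w n) \<le> c" by metis
  have FK: "\<forall>n. F n \<in> Kd \<inter> sphere 0 1" using F X_D by simp
  have "compact (Kd \<inter> sphere 0 1)" using Kd_closed by (simp add: closed_Int_compact)
  then have sc: "seq_compact (Kd \<inter> sphere 0 1)" using compact_eq_seq_compact_metric by blast
  obtain f r where f: "f \<in> Kd \<inter> sphere 0 1" and r: "strict_mono (r :: nat \<Rightarrow> nat)" and lim: "(F \<circ> r) \<longlonglongrightarrow> f"
    by (rule seq_compactE[OF sc FK])
  have blL: "bounded_linear L" using L_linear linear_conv_bounded_linear by blast
  have limL: "(\<lambda>n. L (F (r n))) \<longlonglongrightarrow> L f"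
    using bounded_linear.tendsto[OF blL lim] by (simp add: o_def)
  have bnd: "c *\<^sub>R w n - L (F n) \<in> K" for n
    using representsD[OF phi L_rep[OF F(1)] psi_in[OF wC] c, of n n] F(3)[of n] phi_psi[OF wC, of n] by simp
  have "(\<lambda>n. (1 / real (Suc n)) *\<^sub>R e + p) \<longlonglongrightarrow> 0 *\<^sub>R e + p"
    by (intro tendsto_intros LIMSEQ_Suc lim_1_over_n)
  then have "w \<longlonglongrightarrow> p" by (simp add: w_def[abs_def])
  then have "(\<lambda>n. c *\<^sub>R w (r n) - L (F (r n))) \<longlonglongrightarrow> c *\<^sub>R p - L f"
    by (intro tendsto_intros limL) (use LIMSEQ_subseq_LIMSEQ[OF _ r] in \<open>force simp: o_def\<close>)
  then have "c *\<^sub>R p - L f \<in> K" by (rule K_limit[rotated]) (rule bnd)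
  moreover have "L f \<noteq> 0"
  proof
    assume z: "L f = 0"
    \<comment> \<open>Were the images to tend to 0, they would fall below
      \<open>(m / 2) *\<^sub>R \<phi> e\<close>, so the represented functionals would be at most
      \<open>m / 2\<close> at \<open>e\<close>, against the lower bound \<open>m\<close> for unit
      functionals.\<close>
    obtain m where m: "m > 0" "\<And>f. f \<in> Kd \<Longrightarrow> m * norm f \<le> f \<bullet> e" using Kd_lower_bound[OF e] by blast
    obtain b where b: "b > 0" "\<And>h. (b * norm h) *\<^sub>R \<phi> e - h \<in> K" using order_unit[OF phi_in[OF e]] by blast
    have "m / 2 / b > 0" using m b by simp
    then obtain n where n: "norm (L (F (r n))) < m / 2 / b" using LIMSEQ_D[OF limL] z by fastforce
    have "(b * norm (L (F (r n)))) *\<^sub>R \<phi> e - L (F (r n)) \<in> K" by (rule b(2))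
    moreover have "(m / 2 - b * norm (L (F (r n)))) *\<^sub>R \<phi> e \<in> K"
      using n b phi_in[OF e] C_sub_K by (intro K_scale) (auto simp: field_simps)
    ultimately have "((b * norm (L (F (r n)))) *\<^sub>R \<phi> e - L (F (r n))) + (m / 2 - b * norm (L (F (r n)))) *\<^sub>R \<phi> e \<in> K"
      by (rule K_add)
    then have "(m / 2) *\<^sub>R \<phi> e - L (F (r n)) \<in> K" by (simp add: algebra_simps)
    then have "F (r n) \<bullet> e \<le> m / 2" using representsD[OF phi L_rep[OF F(1)] e] m by simp
    moreover have "m \<le> F (r n) \<bullet> e" using m(2)[of "F (r n)"] F(2)[of "r n"] X_D F(1) by simp
    ultimately show False using m by simp
  qed
  ultimately show ?thesis using f c by blast
qed

text \<open>Below a multiple of an exposed point the cone contains only multiples of that point, and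
  \<open>representing_below\<close> puts a nonzero image there.\<close>

lemma exposed_in_image:
  assumes "p \<in> exposed_rays K" shows "\<exists>f\<in>Kd. L f = p"
proof -
  obtain z where p: "p \<in> K" "p \<noteq> 0" "p \<bullet> z = 0" and z: "\<And>x. x \<in> K \<Longrightarrow> 0 \<le> x \<bullet> z"
    "\<And>x. x \<in> K \<Longrightarrow> x \<bullet> z = 0 \<Longrightarrow> \<exists>c\<ge>0. x = c *\<^sub>R p"
    using assms unfolding exposed_rays_def by blast
  obtain f c where f: "f \<in> Kd" "L f \<noteq> 0" "c > 0" "c *\<^sub>R p - L f \<in> K" using representing_below p by blast
  have LK: "L f \<in> K" using L_Kd f by blast
  have "L f \<bullet> z = 0" using z(1)[OF f(4)] z(1)[OF LK] p(3) by (simp add: inner_diff_left)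
  then obtain b where b: "b \<ge> 0" "L f = b *\<^sub>R p" using z(2)[OF LK] by blast
  then have "b > 0" using f by (cases "b = 0") auto
  then have "L ((1 / b) *\<^sub>R f) = p" using b linear_scale[OF L_linear] by simp
  then show ?thesis using Kd_scale[OF f(1), of "1 / b"] \<open>b > 0\<close> by auto
qed

lemma L_surj: "surj L"
proof -
  have "exposed_rays K \<subseteq> range L" using exposed_in_image by blast
  then have "span (exposed_rays K) \<subseteq> range L"
    by (rule span_minimal) (rule linear_subspace_image[OF L_linear subspace_UNIV])
  then show ?thesis using span_Y by blast
qed

lemma L_bij: "bij L"
  using L_surj linear_surjective_imp_injective[OF L_linear] by (simp add: bij_def)

text \<open>Read through the inverse, \<open>f \<bullet> \<phi> y\<close> is the gauge of a fixed
  point of the closed cone over \<open>y\<close> itself instead of over \<open>\<phi> y\<close>.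
  Convexity and the smooth lower bounds rest on this form.\<close>

lemma duality_gauge:
  assumes "f \<in> X" "y \<in> C" "l > 0" shows "l *\<^sub>R y - adjoint L f \<in> K \<longleftrightarrow> f \<bullet> \<phi> y \<le> l"
  using representsD[OF psi L_rep'[OF assms(1)] phi_in[OF assms(2)] assms(3)] psi_phi[OF assms(2)] by simp

end

text \<open>If \<open>L f\<close> lies in the closed cone, then \<open>f\<close> is nonnegative at
  every exposed point of it, because such a point has the form \<open>adjoint L g\<close> with
  \<open>g\<close> in the dual cone and the adjoint moves \<open>L\<close> onto
  \<open>f\<close>.\<close>

lemma L_image:
  assumes L: "duality \<phi> \<psi> L" shows "L ` Kd = K"
proof
  show "L ` Kd \<subseteq> K" using L_Kd[OF L] by blast
  show "K \<subseteq> L ` Kd"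
  proof
    fix x assume x: "x \<in> K"
    obtain f where f: "x = L f" using L_surj[OF L] by (meson surjD)
    interpret s: gauge_pair C \<psi> \<phi> by (rule swap)
    have "0 \<le> p \<bullet> f" if p: "p \<in> exposed_rays K" for p
    proof -
      obtain g where "g \<in> Kd" "adjoint L g = p" using s.exposed_in_image[OF duality_swap[OF L] p] by blast
      then show ?thesis using L_adj[OF L, of f g] f Kd_nonneg[OF _ x] by (metis inner_commute)
    qed
    then have "f \<in> Kd" using Kd_Y by blast
    then show "x \<in> L ` Kd" using f by blast
  qed
qed

end

section \<open>Convexity and differentiability\<close>

context gauge_pair
begin

text \<open>\<open>f \<bullet> \<phi> y\<close> is the least multiplier lifting \<open>y\<close>
  above \<open>adjoint L f\<close>. Reciprocals of such multipliers are concave in \<open>y\<close>,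
  so the value at a convex combination is at most a weighted harmonic mean, hence at most the
  arithmetic mean.\<close>

lemma gr_convex:
  assumes y: "y \<in> C" "y' \<in> C" and st: "s > 0" "t > 0" "s + t = 1"
  shows "s *\<^sub>R \<phi> y + t *\<^sub>R \<phi> y' - \<phi> (s *\<^sub>R y + t *\<^sub>R y') \<in> K"
proof -
  obtain L where L: "duality \<phi> \<psi> L" using duality_exists by blast
  have w: "s *\<^sub>R y + t *\<^sub>R y' \<in> C" using convexD[OF C_convex y] st by simp
  show ?thesis unfolding K_X
  proof
    fix f assume f: "f \<in> X"
    define r where "r = adjoint L f"
    define a where "a = f \<bullet> \<phi> y"
    define b where "b = f \<bullet> \<phi> y'"
    have a: "a > 0" and b: "b > 0" using Kd_pos phi_in y X_D[OF f] by (auto simp: a_def b_def)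
    have A: "a *\<^sub>R y - r \<in> K" using duality_gauge[OF L f y(1) a] by (simp add: a_def r_def)
    have B: "b *\<^sub>R y' - r \<in> K" using duality_gauge[OF L f y(2) b] by (simp add: b_def r_def)
    define l where "l = s / a + t / b"
    have l: "l > 0" using a b st by (simp add: l_def add_pos_pos)
    have "(s / a) *\<^sub>R (a *\<^sub>R y - r) + (t / b) *\<^sub>R (b *\<^sub>R y' - r) \<in> K"
      using A B a b st by (intro K_add K_scale) auto
    then have "s *\<^sub>R y + t *\<^sub>R y' - l *\<^sub>R r \<in> K" using a b by (simp add: l_def algebra_simps)
    from K_scale[OF this, of "1 / l"] have "(1 / l) *\<^sub>R (s *\<^sub>R y + t *\<^sub>R y') - r \<in> K"
      using l by (simp add: scaleR_diff_right)
    then have "f \<bullet> \<phi> (s *\<^sub>R y + t *\<^sub>R y') \<le> 1 / l" using duality_gauge[OF L f w, of "1 / l"] l by (simp add: r_def)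
    also have "1 / l \<le> s * a + t * b"
    proof -
      have "0 \<le> s * t * (a - b)\<^sup>2 / (a * b)" using st a b by simp
      also have "\<dots> = (s * a + t * b) * l - (s + t)\<^sup>2"
        using a b by (simp add: l_def field_simps power2_eq_square)
      finally show ?thesis using st l by (simp add: divide_le_eq)
    qed
    finally show "0 \<le> f \<bullet> (s *\<^sub>R \<phi> y + t *\<^sub>R \<phi> y' - \<phi> (s *\<^sub>R y + t *\<^sub>R y'))"
      by (simp add: inner_diff_right inner_add_right a_def b_def)
  qed
qed

text \<open>By convexity the difference quotients along the segment lie below the full increment,
  and closedness of the cone passes this to their limit.\<close>

lemma gr_subgradient:
  assumes d: "(\<phi> has_derivative D) (at m)" and m: "m \<in> C" "y \<in> C"
  shows "\<phi> y - \<phi> m - D (y - m) \<in> K"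
proof -
  define q where "q n = real (Suc n) *\<^sub>R (\<phi> (m + (1 / real (Suc n)) *\<^sub>R (y - m)) - \<phi> m)" for n
  have "q \<longlonglongrightarrow> D (y - m)" using has_derivative_directional_sequence[OF d] by (simp add: q_def[abs_def])
  then have "(\<lambda>n. \<phi> y - \<phi> m - q (Suc n)) \<longlonglongrightarrow> \<phi> y - \<phi> m - D (y - m)"
    by (intro tendsto_intros LIMSEQ_Suc)
  moreover have "\<phi> y - \<phi> m - q (Suc n) \<in> K" for n
  proof -
    \<comment> \<open>The index is shifted by one so that \<open>t < 1\<close> and both convex
      weights are positive.\<close>
    define t where "t = 1 / real (Suc (Suc n))"
    have t: "t > 0" "1 - t > 0" "real (Suc (Suc n)) = 1 / t" by (auto simp: t_def)
    have "(1 - t) *\<^sub>R \<phi> m + t *\<^sub>R \<phi> y - \<phi> ((1 - t) *\<^sub>R m + t *\<^sub>R y) \<in> K"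
      using gr_convex[OF m t(2,1)] by simp
    moreover have "(1 - t) *\<^sub>R m + t *\<^sub>R y = m + t *\<^sub>R (y - m)" by (simp add: algebra_simps)
    ultimately have k: "(1 - t) *\<^sub>R \<phi> m + t *\<^sub>R \<phi> y - \<phi> (m + t *\<^sub>R (y - m)) \<in> K" by simp
    have "\<phi> y - \<phi> m - q (Suc n) = (1 / t) *\<^sub>R ((1 - t) *\<^sub>R \<phi> m + t *\<^sub>R \<phi> y - \<phi> (m + t *\<^sub>R (y - m)))"
      unfolding q_def t(3) using t by (simp add: scaleR_diff_right scaleR_add_right scaleR_diff_left field_simps)
    then show ?thesis using K_scale[OF k, of "1 / t"] t by simp
  qed
  ultimately show ?thesis by (rule K_limit[rotated])
qed

lemma gr_derivative_antitone:
  assumes d: "(\<phi> has_derivative D) (at m)" and m: "m \<in> C" and h: "h \<in> K"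
  shows "- D h \<in> K"
proof (rule K_limit)
  show "(\<lambda>n. - (real (Suc n) *\<^sub>R (\<phi> (m + (1 / real (Suc n)) *\<^sub>R h) - \<phi> m))) \<longlonglongrightarrow> - D h"
    by (intro tendsto_minus has_derivative_directional_sequence d)
  fix n
  have mh: "m + (1 / real (Suc n)) *\<^sub>R h \<in> C" using C_add_K[OF m K_scale[OF h]] by simp
  have "\<phi> m - \<phi> (m + (1 / real (Suc n)) *\<^sub>R h) \<in> K"
    using gr_antitone[OF phi mh m] K_scale[OF h, of "1 / real (Suc n)"] by simp
  from K_scale[OF this, of "real (Suc n)"]
  show "- (real (Suc n) *\<^sub>R (\<phi> (m + (1 / real (Suc n)) *\<^sub>R h) - \<phi> m)) \<in> K"
    by (simp only: of_nat_0_le_iff simp_thms minus_diff_eq flip: scaleR_minus_right)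
qed

text \<open>Euler's relation for a map homogeneous of degree -1, differentiated along the ray
  through \<open>m\<close>.\<close>

lemma gr_derivative_euler:
  assumes d: "(\<phi> has_derivative D) (at m)" and m: "m \<in> C"
  shows "D m = - \<phi> m"
proof -
  have "real (Suc n) *\<^sub>R (\<phi> (m + (1 / real (Suc n)) *\<^sub>R m) - \<phi> m) = (- 1 / (1 + 1 / real (Suc n))) *\<^sub>R \<phi> m" for n
  proof -
    define t where "t = 1 / real (Suc n)"
    have t: "t > 0" "real (Suc n) = 1 / t" by (auto simp: t_def)
    have "m + t *\<^sub>R m = (1 + t) *\<^sub>R m" by (simp add: algebra_simps)
    then have "\<phi> (m + t *\<^sub>R m) = (1 / (1 + t)) *\<^sub>R \<phi> m" using gr_scale[OF phi m, of "1 + t"] t by simp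
    then have "(1 / t) *\<^sub>R (\<phi> (m + t *\<^sub>R m) - \<phi> m) = ((1 / t) * (1 / (1 + t) - 1)) *\<^sub>R \<phi> m"
      by (simp add: scaleR_diff_left scaleR_diff_right algebra_simps)
    also have "(1 / t) * (1 / (1 + t) - 1) = - 1 / (1 + t)" using t by (simp add: field_simps)
    finally show ?thesis unfolding t(2) by simp
  qed
  moreover have "(\<lambda>n. (- 1 / (1 + 1 / real (Suc n))) *\<^sub>R \<phi> m) \<longlonglongrightarrow> (- 1 / (1 + 0)) *\<^sub>R \<phi> m"
    by (intro tendsto_intros LIMSEQ_Suc lim_1_over_n) simp
  ultimately show ?thesis
    using LIMSEQ_unique[OF has_derivative_directional_sequence[OF d, of m]] by simp
qed

text \<open>The local Lipschitz bound of \<open>\<psi>\<close> keeps \<open>\<phi>\<close> from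
  contracting any direction to first order, so \<open>D\<close> has no kernel; continuity of
  \<open>\<psi>\<close> then gives the derivative of the inverse.\<close>

lemma gr_derivative_inverse:
  assumes d: "(\<phi> has_derivative D) (at m)" and m: "m \<in> C"
  shows "bij D" "(\<psi> has_derivative inv D) (at (\<phi> m))"
proof -
  have lin: "linear D" using d by (rule has_derivative_linear)
  obtain B r where B: "B > 0" "r > 0" and lip: "\<And>k. norm k < r \<Longrightarrow> norm (\<psi> (\<phi> m + k) - \<psi> (\<phi> m)) \<le> B * norm k"
    using gr_locally_lipschitz[OF psi phi_in[OF m]] by blast
  have "inj D"
  proof (rule linear_injective_0[THEN iffD2, OF lin], clarify)
    fix h assume h: "D h = 0"
    define q where "q n = real (Suc n) *\<^sub>R (\<phi> (m + (1 / real (Suc n)) *\<^sub>R h) - \<phi> m)" for n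
    have q: "q \<longlonglongrightarrow> 0" using has_derivative_directional_sequence[OF d, of h] h by (simp add: q_def[abs_def])
    have "(\<lambda>n. m + (1 / real (Suc n)) *\<^sub>R h) \<longlonglongrightarrow> m + 0 *\<^sub>R h"
      by (intro tendsto_intros LIMSEQ_Suc lim_1_over_n)
    then have mC: "\<forall>\<^sub>F n in sequentially. m + (1 / real (Suc n)) *\<^sub>R h \<in> C"
      using topological_tendstoD[OF _ C_open] m by auto
    have "\<forall>\<^sub>F n in sequentially. norm (q n) < r" using tendstoD[OF q B(2)] by simp
    then have "\<forall>\<^sub>F n in sequentially. norm h \<le> B * norm (q n)" using mC
    proof eventually_elim
      case (elim n)
      have qn: "(1 / real (Suc n)) *\<^sub>R q n = \<phi> (m + (1 / real (Suc n)) *\<^sub>R h) - \<phi> m" by (simp add: q_def)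
      have "norm ((1 / real (Suc n)) *\<^sub>R q n) \<le> norm (q n)" by (simp add: divide_le_eq mult_le_cancel_left1)
      then have "norm ((1 / real (Suc n)) *\<^sub>R q n) < r" using elim by simp
      from lip[OF this] have "norm ((1 / real (Suc n)) *\<^sub>R h) \<le> B * norm ((1 / real (Suc n)) *\<^sub>R q n)"
        unfolding qn using psi_phi m elim by simp
      then have "(1 / real (Suc n)) * norm h \<le> (1 / real (Suc n)) * (B * norm (q n))"
        by (simp add: mult.left_commute)
      then show ?case by (subst (asm) mult_le_cancel_left_pos) simp_all
    qed
    moreover have "(\<lambda>n. B * norm (q n)) \<longlonglongrightarrow> B * norm (0::'a)" by (intro tendsto_intros q)
    ultimately have "norm h \<le> B * norm (0::'a)"
      using tendsto_lowerbound trivial_limit_sequentially by blast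
    then show "h = 0" by simp
  qed
  then show b: "bij D" using linear_injective_imp_surjective[OF lin] by (simp add: bij_def)
  have "linear (inv D)" using lin \<open>inj D\<close> b by (simp add: inj_linear_imp_inv_linear)
  then have "bounded_linear (inv D)" using linear_conv_bounded_linear by blast
  then show "(\<psi> has_derivative inv D) (at (\<phi> m))"
    by (rule has_derivative_inverse_basic_x[OF d])
      (use \<open>inj D\<close> gr_isCont[OF psi phi_in[OF m]] psi_phi[OF m] C_open phi_in[OF m] phi_psi in auto)
qed

text \<open>\<open>- D\<close> maps the closed cone into itself, and so does its inverse, because
  \<open>inv D\<close> is the derivative of the equally antitone \<open>\<psi>\<close>.\<close>

lemma gr_derivative_aut:
  assumes d: "(\<phi> has_derivative D) (at m)" and m: "m \<in> C"
  shows "aut (\<lambda>h. - D h)"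
proof -
  interpret s: gauge_pair C \<psi> \<phi> by (rule swap)
  note inv = gr_derivative_inverse[OF d m]
  have lin: "linear D" using d by (rule has_derivative_linear)
  have "(\<lambda>h. - D h) ` K = K"
  proof
    show "(\<lambda>h. - D h) ` K \<subseteq> K" using gr_derivative_antitone[OF d m] by blast
    show "K \<subseteq> (\<lambda>h. - D h) ` K"
    proof
      fix k assume "k \<in> K"
      then have "- inv D k \<in> K" using s.gr_derivative_antitone[OF inv(2) phi_in[OF m]] by blast
      moreover have "k = - D (- inv D k)" using inv(1) linear_neg[OF lin] by (simp add: bij_is_surj surj_f_inv_f)
      ultimately show "k \<in> (\<lambda>h. - D h) ` K" by blast
    qed
  qed
  moreover have "linear (\<lambda>h. - D h)" using lin by (simp add: linear_compose_neg)
  moreover have "bij (\<lambda>h. - D h)"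
    using bij_comp[OF inv(1) bij_uminus] by (simp add: o_def)
  ultimately show ?thesis by (rule autI_closure[rotated 2])
qed

text \<open>The representation of \<open>f \<bullet> \<phi> y\<close> as a gauge supplies a smooth lower bound touching at
  \<open>m\<close>.\<close>

lemma lower_touching:
  assumes f: "f \<in> X" and m: "m \<in> C"
  shows "\<exists>a a'. (a has_derivative a') (at m) \<and> a m = f \<bullet> \<phi> m \<and> (\<forall>y\<in>C. a y \<le> f \<bullet> \<phi> y)"
proof -
  obtain L where L: "duality \<phi> \<psi> L" using duality_exists by blast
  define r where "r = adjoint L f"
  define l where "l = f \<bullet> \<phi> m"
  have l: "l > 0" unfolding l_def using Kd_pos phi_in m X_D[OF f] by blast
  have k: "l *\<^sub>R m - r \<in> K" using duality_gauge[OF L f m l] by (simp add: l_def r_def)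
  \<comment> \<open>At the optimal multiplier \<open>l\<close> the difference lies on the boundary:
    inside the open cone a smaller multiplier \<open>l - t\<close> would still work.\<close>
  have "l *\<^sub>R m - r \<notin> C"
  proof
    assume c: "l *\<^sub>R m - r \<in> C"
    obtain s where s: "s > 0" "ball (l *\<^sub>R m - r) s \<subseteq> C" using C_open c openE by blast
    define t where "t = min (l / 2) (s / (2 * (norm m + 1)))"
    have n: "norm m + 1 > 0" by (simp add: add_nonneg_pos)
    have t: "t > 0" "t < l" "t * norm m < s"
    proof -
      show "t > 0" using l s n by (simp add: t_def)
      have "t \<le> l / 2" unfolding t_def by (rule min.cobounded1)
      then show "t < l" using l by linarith
      have "t * (norm m + 1) \<le> s / (2 * (norm m + 1)) * (norm m + 1)" using n by (intro mult_right_mono) (auto simp: t_def)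
      also have "\<dots> = s / 2"
      proof -
        have "s / (2 * q) * q = s / 2" if "q > 0" for q :: real using that by simp
        then show ?thesis using n by blast
      qed
      finally show "t * norm m < s" using s \<open>t > 0\<close> by (simp add: distrib_left)
    qed
    have "(l - t) *\<^sub>R m - r \<in> C" using t by (intro subsetD[OF s(2)]) (simp add: dist_norm algebra_simps)
    then have "f \<bullet> \<phi> m \<le> l - t" using duality_gauge[OF L f m, of "l - t"] t C_sub_K by (simp add: r_def)
    then show False using t by (simp add: l_def)
  qed
  \<comment> \<open>A functional supporting the cone at this boundary point yields the lower bound
    \<open>(g \<bullet> r) / (g \<bullet> y)\<close>, with equality at \<open>m\<close>.\<close>
  then obtain g where g: "g \<in> Kd" "g \<noteq> 0" "g \<bullet> (l *\<^sub>R m - r) = 0" using K_boundary_support[OF k] by blast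
  have gr: "g \<bullet> r = l * (g \<bullet> m)" using g by (simp add: inner_diff_right)
  have gm: "g \<bullet> m > 0" using Kd_pos m g by blast
  have "(\<lambda>y. (g \<bullet> r) / (g \<bullet> y)) differentiable (at m)"
    using gm by (intro differentiable_divide differentiable_inner differentiable_const differentiable_ident) simp
  then obtain a' where "((\<lambda>y. (g \<bullet> r) / (g \<bullet> y)) has_derivative a') (at m)" by (auto simp: differentiable_def)
  moreover have "(g \<bullet> r) / (g \<bullet> m) = f \<bullet> \<phi> m" using gr gm by (simp add: l_def)
  moreover have "(g \<bullet> r) / (g \<bullet> y) \<le> f \<bullet> \<phi> y" if y: "y \<in> C" for y
  proof -
    have "f \<bullet> \<phi> y > 0" using Kd_pos phi_in y X_D[OF f] by blast
    then have "(f \<bullet> \<phi> y) *\<^sub>R y - r \<in> K" using duality_gauge[OF L f y] by (simp add: r_def)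
    then have "0 \<le> g \<bullet> ((f \<bullet> \<phi> y) *\<^sub>R y - r)" using g Kd_nonneg by blast
    then show ?thesis using Kd_pos[OF y g(1,2)] by (simp add: inner_diff_right divide_le_eq)
  qed
  ultimately show ?thesis by blast
qed

text \<open>Where a sum of coordinates of \<open>\<phi>\<close> is touched from above by a paraboloid, each of
  them is squeezed between smooth functions.\<close>

lemma differentiable_dense:
  assumes c: "c \<in> C" and r: "r > 0"
  shows "\<exists>m\<in>C. dist m c < r \<and> \<phi> differentiable (at m)"
proof -
  obtain B where B: "B \<subseteq> X" "independent B" and fin: "finite B" and sB: "span B = UNIV"
    by (rule spanning_set_basis[OF span_X])
  obtain r1 where r1: "r1 > 0" "cball c r1 \<subseteq> C" using open_contains_cball C_open c by blast
  define s where "s = min r1 (r / 2)"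
  have s: "s > 0" "s < r" "cball c s \<subseteq> C" using r r1 by (auto simp: s_def)
  define u where "u y = (\<Sum>f\<in>B. f \<bullet> \<phi> y)" for y
  have cont: "continuous_on (cball c s) u" unfolding u_def
    by (intro continuous_intros continuous_on_subset[OF gr_continuous[OF phi] s(3)])
  obtain b where b: "b \<in> cball c s" "\<And>y. y \<in> cball c s \<Longrightarrow> u y \<le> u b"
    using continuous_attains_sup[OF compact_cball _ cont] s by force
  \<comment> \<open>On the bounding sphere the penalty equals \<open>u b - u c + 1\<close>, which
    pushes \<open>v\<close> there below \<open>v c = u c\<close>; the maximum of \<open>v\<close> is
    therefore interior.\<close>
  define k where "k = (u b - u c + 1) / s\<^sup>2"
  have ks: "k * s\<^sup>2 = u b - u c + 1" using s by (simp add: k_def)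
  define v where "v y = u y - k * (norm (y - c))\<^sup>2" for y
  have "continuous_on (cball c s) v" unfolding v_def by (intro continuous_intros cont)
  then obtain m where m: "m \<in> cball c s" "\<And>y. y \<in> cball c s \<Longrightarrow> v y \<le> v m"
    using continuous_attains_sup[OF compact_cball, of c s v] s by force
  have "v c \<le> v m" using m s by simp
  then have vm: "u c \<le> v m" by (simp add: v_def)
  have "dist c m \<noteq> s"
  proof
    assume "dist c m = s"
    then have "v m = u m - (u b - u c + 1)" using ks by (simp add: v_def dist_norm norm_minus_commute)
    then show False using vm b(2)[OF m(1)] by simp
  qed
  then have mb: "m \<in> ball c s" using m by simp
  have mC: "m \<in> C" using m s by blast
  define Q where "Q y = u m - k * (norm (m - c))\<^sup>2 + k * (norm (y - c))\<^sup>2" for y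
  have Q: "u y \<le> Q y" if "y \<in> ball c s" for y using m(2)[of y] that by (simp add: Q_def v_def)
  have Qd: "Q differentiable (at m)"
    unfolding Q_def power2_norm_eq_inner
    by (intro differentiable_add differentiable_mult differentiable_inner differentiable_diff
        differentiable_const differentiable_ident)
  have "\<forall>f\<in>B. \<exists>a a'. (a has_derivative a') (at m) \<and> a m = f \<bullet> \<phi> m \<and> (\<forall>y\<in>C. a y \<le> f \<bullet> \<phi> y)"
    using lower_touching B(1) mC by blast
  then obtain a a' where a: "\<And>f. f \<in> B \<Longrightarrow> (a f has_derivative a' f) (at m)"
    "\<And>f. f \<in> B \<Longrightarrow> a f m = f \<bullet> \<phi> m" "\<And>f y. f \<in> B \<Longrightarrow> y \<in> C \<Longrightarrow> a f y \<le> f \<bullet> \<phi> y" by metis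
  have fd: "(\<lambda>y. \<phi> y \<bullet> f) differentiable (at m)" if f: "f \<in> B" for f
  proof -
    \<comment> \<open>Subtracting the lower bounds of the other coordinates from the paraboloid
      above the sum leaves an upper bound for the single coordinate \<open>f\<close>, touching at
      \<open>m\<close>.\<close>
    have "(\<lambda>y. Q y - (\<Sum>g\<in>B - {f}. a g y)) differentiable (at m)"
      using a(1) fin by (intro differentiable_diff Qd differentiable_sum) (auto simp: differentiable_def)
    then obtain b' where b': "((\<lambda>y. Q y - (\<Sum>g\<in>B - {f}. a g y)) has_derivative b') (at m)"
      by (auto simp: differentiable_def)
    have split: "u y = f \<bullet> \<phi> y + (\<Sum>g\<in>B - {f}. g \<bullet> \<phi> y)" for y
      unfolding u_def using fin f by (simp add: sum.remove)
    have "((\<lambda>y. f \<bullet> \<phi> y) has_derivative a' f) (at m)"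
    proof (rule has_derivative_sandwich[OF a(1)[OF f] b' open_ball mb])
      fix y assume y: "y \<in> ball c s"
      then have yC: "y \<in> C" using s by auto
      show "a f y \<le> f \<bullet> \<phi> y" using a f yC by blast
      have "(\<Sum>g\<in>B - {f}. a g y) \<le> (\<Sum>g\<in>B - {f}. g \<bullet> \<phi> y)" using a(3) yC by (intro sum_mono) auto
      then show "f \<bullet> \<phi> y \<le> Q y - (\<Sum>g\<in>B - {f}. a g y)" using Q[OF y] split[of y] by linarith
    next
      show "a f m = f \<bullet> \<phi> m" using a f by blast
      have "(\<Sum>g\<in>B - {f}. a g m) = (\<Sum>g\<in>B - {f}. g \<bullet> \<phi> m)" using a(2) by (intro sum.cong) auto
      then show "f \<bullet> \<phi> m = Q m - (\<Sum>g\<in>B - {f}. a g m)" using split[of m] by (simp add: Q_def)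
    qed
    then show ?thesis by (auto simp: differentiable_def inner_commute)
  qed
  have "(\<lambda>y. \<phi> y \<bullet> v) differentiable (at m)" for v
  proof -
    have "v \<in> span B" using sB by blast
    then show ?thesis
    proof (induction rule: span_induct_alt)
      case base then show ?case by simp
    next
      case (step c x y)
      then show ?case using fd[of x]
        by (simp add: inner_add_right)
    qed
  qed
  then have "\<phi> differentiable (at m)" using differentiable_componentwise_within[of \<phi> m UNIV] by blast
  moreover have "dist m c < r" using mb s by (simp add: dist_commute)
  ultimately show ?thesis using mC by blast
qed

end

section \<open>Symmetries of the cone\<close>

context proper_cone
begin

lemma aut_linear: "aut A \<Longrightarrow> linear A" and aut_bij: "aut A \<Longrightarrow> bij A"
  and aut_in: "aut A \<Longrightarrow> x \<in> C \<Longrightarrow> A x \<in> C"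
  by (auto simp: aut_def)

lemma aut_inv_linear: "aut A \<Longrightarrow> linear (inv A)"
  by (simp add: aut_def bij_is_inj inj_linear_imp_inv_linear)

lemma aut_inv_left: "aut A \<Longrightarrow> inv A (A x) = x" and aut_inv_right: "aut A \<Longrightarrow> A (inv A x) = x"
  by (simp_all add: aut_def bij_is_inj bij_is_surj surj_f_inv_f)

lemma aut_inv: assumes "aut A" shows "aut (inv A)"
proof -
  have "inv A ` C = inv A ` (A ` C)" using assms by (simp add: aut_def)
  also have "\<dots> = C" using aut_inv_left[OF assms] by (simp add: image_image)
  finally show ?thesis using assms aut_inv_linear by (simp add: aut_def bij_imp_bij_inv)
qed

lemma aut_comp: "aut A \<Longrightarrow> aut B \<Longrightarrow> aut (A \<circ> B)"
  unfolding aut_def using image_comp[of A B C] by (auto intro: linear_compose bij_comp)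

lemma aut_closure_image: "aut A \<Longrightarrow> A ` K = K"
  unfolding aut_def by (metis bij_is_inj closure_injective_linear_image)

lemma aut_K: assumes "aut A" shows "A x \<in> K \<longleftrightarrow> x \<in> K"
  using aut_closure_image[OF assms] aut_bij[OF assms] by (metis bij_is_inj inj_image_mem_iff)

lemma aut_id: "aut id"
  by (simp add: aut_def module_hom_id linear_id)

lemma aut_adjoint_image: assumes "aut A" shows "bij (adjoint A)" "adjoint A ` Kd = Kd"
proof -
  note lin = aut_linear[OF assms] and ilin = aut_inv_linear[OF assms]
  have i: "adjoint A (adjoint (inv A) f) = f" "adjoint (inv A) (adjoint A f) = f" for f
    by (rule vector_eq_ldot[THEN iffD1], simp add: adjoint_works[OF lin] adjoint_works[OF ilin]
        aut_inv_left[OF assms] aut_inv_right[OF assms])+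
  show "bij (adjoint A)" by (rule o_bij[of "adjoint (inv A)"]) (auto simp: i)
  have sub: "adjoint B f \<in> Kd" if "aut B" "f \<in> Kd" for B f
    unfolding dual_cone_def
    using that Kd_nonneg aut_K[OF that(1)] by (simp add: adjoint_works[OF aut_linear[OF that(1)]] inner_commute)
  show "adjoint A ` Kd = Kd"
  proof
    show "adjoint A ` Kd \<subseteq> Kd" using sub assms by blast
    show "Kd \<subseteq> adjoint A ` Kd" using sub[OF aut_inv[OF assms]] i(1) by (metis imageI subsetI)
  qed
qed

lemma aut_adjoint_X: "aut A \<Longrightarrow> f \<in> X \<Longrightarrow> adjoint A f \<in> X"
  using exposed_rays_linear_image[OF adjoint_linear] aut_adjoint_image aut_linear by blast

lemma gauge_pair_aut:
  assumes "gauge_pair C \<phi> \<psi>" and A: "aut A" shows "gauge_pair C (A \<circ> \<phi>) (\<psi> \<circ> inv A)"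
proof -
  interpret gauge_pair C \<phi> \<psi> by (rule assms)
  note iA = aut_inv[OF A]
  have "l *\<^sub>R A (\<phi> y) - A (\<phi> x) \<in> K \<longleftrightarrow> l *\<^sub>R \<phi> y - \<phi> x \<in> K" for l x y
    using aut_K[OF A, of "l *\<^sub>R \<phi> y - \<phi> x"] aut_linear[OF A] by (simp add: linear_diff linear_scale)
  then have 1: "gauge_reversing C (A \<circ> \<phi>)"
    unfolding gauge_reversing_iff using gr_rev[OF phi] phi_in aut_in[OF A] by simp
  have "l *\<^sub>R inv A x - inv A y \<in> K \<longleftrightarrow> l *\<^sub>R x - y \<in> K" for l x y
    using aut_K[OF iA, of "l *\<^sub>R x - y"] aut_linear[OF iA] by (simp add: linear_diff linear_scale)
  then have 2: "gauge_reversing C (\<psi> \<circ> inv A)"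
    unfolding gauge_reversing_iff using gr_rev[OF psi] psi_in aut_in[OF iA] by simp
  show ?thesis
    by unfold_locales (use 1 2 psi_phi phi_psi aut_in[OF iA] aut_inv_left[OF A] aut_inv_right[OF A] in auto)
qed

text \<open>Composition with \<open>A\<close> moves representing points by \<open>A\<close>; on the
  inverse side the functional is pulled back by \<open>adjoint A\<close>, which preserves exposed
  rays, so the one linear map \<open>A \<circ> L\<close> still serves both sides.\<close>

lemma duality_aut:
  assumes "gauge_pair C \<phi> \<psi>" and A: "aut A" and L: "duality \<phi> \<psi> L"
  shows "duality (A \<circ> \<phi>) (\<psi> \<circ> inv A) (A \<circ> L)"
  unfolding duality_def
proof (intro conjI ballI)
  interpret gauge_pair C \<phi> \<psi> by (rule assms)
  note lA = aut_linear[OF A] and lL = L_linear[OF L]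
  show "linear (A \<circ> L)" by (rule linear_compose[OF lL lA])
  fix f assume f: "f \<in> X"
  have "A (\<phi> y) - A (L f) \<in> K \<longleftrightarrow> \<phi> y - L f \<in> K" for y
    using aut_K[OF A, of "\<phi> y - L f"] lA by (simp add: linear_diff)
  then show "represents (A \<circ> \<phi>) f ((A \<circ> L) f)"
    using L_rep[OF L f] aut_K[OF A] by (simp add: represents_def)
  have adj: "adjoint (A \<circ> L) f = adjoint L (adjoint A f)"
    by (rule vector_eq_ldot[THEN iffD1])
      (simp add: adjoint_works[OF lA] adjoint_works[OF lL] adjoint_works[OF linear_compose[OF lL lA]])
  have r: "represents \<psi> (adjoint A f) (adjoint L (adjoint A f))"
    by (rule L_rep'[OF L aut_adjoint_X[OF A f]])
  have "adjoint A f \<bullet> inv A y = f \<bullet> y" for y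
    using adjoint_works[OF lA, of "inv A y" f] aut_inv_right[OF A] by (simp add: inner_commute)
  then show "represents (\<psi> \<circ> inv A) f (adjoint (A \<circ> L) f)"
    using r aut_in[OF aut_inv[OF A]] unfolding adj represents_def by simp
qed

end

context gauge_pair
begin

text \<open>Comparing the representations of \<open>\<phi>\<close> and its inverse shows that \<open>\<phi> \<circ> \<phi>\<close> is linear; its
  derivative at \<open>e\<close> is the identity.\<close>

lemma symmetry_involutive:
  assumes L: "duality \<phi> \<psi> L" and e: "e \<in> C" "\<phi> e = e" and d: "(\<phi> has_derivative uminus) (at e)"
  shows "adjoint L = L" "\<And>x. x \<in> C \<Longrightarrow> \<phi> (\<phi> x) = x"
proof -
  interpret s: gauge_pair C \<psi> \<phi> by (rule swap)
  note lL = L_linear[OF L] and bL = L_bij[OF L]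
  have bA: "bij (adjoint L)" by (rule s.L_bij[OF duality_swap[OF L]])
  have liL: "linear (inv L)" using lL bL by (simp add: bij_is_inj inj_linear_imp_inv_linear)
  \<comment> \<open>\<open>L (M f) = adjoint L f\<close>, so \<open>f\<close> at
    \<open>\<phi> (\<phi> w)\<close> and \<open>M f\<close> at \<open>w\<close> are gauges of the
    same point over \<open>\<phi> w\<close>. This identifies \<open>\<phi> \<circ> \<phi>\<close>
    with \<open>adjoint M\<close> on \<open>C\<close>.\<close>
  define M where "M = inv L \<circ> adjoint L"
  have lM: "linear M" unfolding M_def by (rule linear_compose[OF adjoint_linear[OF lL] liL])
  have bM: "bij M" unfolding M_def using bA bL by (simp add: bij_comp bij_imp_bij_inv)
  have "adjoint L ` Kd = K" by (rule s.L_image[OF duality_swap[OF L]])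
  moreover have "inv L ` K = Kd"
    using L_image[OF L] bL by (metis bij_is_inj image_inv_f_f)
  ultimately have MK: "M ` Kd = Kd" unfolding M_def by (metis image_comp)
  have LM: "L (M f) = adjoint L f" for f using bL by (simp add: M_def bij_is_surj surj_f_inv_f)
  have sq: "\<phi> (\<phi> w) = adjoint M w" if w: "w \<in> C" for w
  proof (rule eq_on_X)
    fix f assume f: "f \<in> X"
    have h: "M f \<in> X" by (rule exposed_rays_linear_image[OF lM bM MK f])
    have eq: "f \<bullet> \<phi> (\<phi> w) \<le> l \<longleftrightarrow> M f \<bullet> w \<le> l" if "l > 0" for l
      using duality_gauge[OF L f phi_in[OF w] that] representsD[OF phi L_rep[OF L h] w that] LM by simp
    have "f \<bullet> \<phi> (\<phi> w) > 0" "M f \<bullet> w > 0" using Kd_pos phi_in w X_D f h by blast+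
    then have "f \<bullet> \<phi> (\<phi> w) = M f \<bullet> w" using eq by (meson order_antisym order_refl)
    then show "f \<bullet> \<phi> (\<phi> w) = f \<bullet> adjoint M w" by (simp add: adjoint_works[OF lM])
  qed
  have "((\<lambda>x. \<phi> (\<phi> x)) has_derivative (\<lambda>h. - (- h))) (at e)"
    using has_derivative_compose[OF d, of \<phi> uminus] d e by simp
  then have 1: "((\<lambda>x. \<phi> (\<phi> x)) has_derivative (\<lambda>h. h)) (at e)" by simp
  have "(adjoint M has_derivative adjoint M) (at e)"
    using adjoint_linear[OF lM] linear_conv_bounded_linear bounded_linear_imp_has_derivative by blast
  then have "((\<lambda>x. \<phi> (\<phi> x)) has_derivative adjoint M) (at e)"
    by (rule has_derivative_transform_within_open[OF _ C_open e(1)]) (use sq in simp)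
  then have id: "adjoint M = (\<lambda>h. h)" using 1 has_derivative_unique by blast
  show "\<phi> (\<phi> x) = x" if "x \<in> C" for x using sq[OF that] id by simp
  have "M = adjoint (adjoint M)" using adjoint_adjoint[OF lM] by simp
  also have "\<dots> = (\<lambda>h. h)" unfolding id by (rule adjoint_unique) simp
  finally show "adjoint L = L" using LM by auto
qed

text \<open>Euler's relation gives \<open>\<phi> m = T m\<close>, so cancelling the derivative also
  makes \<open>m\<close> a fixed point, and the normalised map meets the hypotheses of
  \<open>symmetry_involutive\<close>.\<close>

lemma normalize_at:
  assumes L: "duality \<phi> \<psi> L" and m: "m \<in> C" and d: "(\<phi> has_derivative D) (at m)"
  defines "T \<equiv> (\<lambda>h. - D h)"
  shows "aut T" "gauge_pair C (inv T \<circ> \<phi>) (\<psi> \<circ> T)" "duality (inv T \<circ> \<phi>) (\<psi> \<circ> T) (inv T \<circ> L)"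
    "(inv T \<circ> \<phi>) m = m" "((inv T \<circ> \<phi>) has_derivative uminus) (at m)"
proof -
  show T: "aut T" unfolding T_def by (rule gr_derivative_aut[OF d m])
  have ii: "inv (inv T) = T" using T by (simp add: aut_def inv_inv_eq)
  show "gauge_pair C (inv T \<circ> \<phi>) (\<psi> \<circ> T)"
    using gauge_pair_aut[OF gauge_pair_axioms aut_inv[OF T]] ii by simp
  show "duality (inv T \<circ> \<phi>) (\<psi> \<circ> T) (inv T \<circ> L)"
    using duality_aut[OF gauge_pair_axioms aut_inv[OF T] L] ii by simp
  have "\<phi> m = T m" using gr_derivative_euler[OF d m] by (simp add: T_def)
  then show "(inv T \<circ> \<phi>) m = m" using aut_inv_left[OF T] by simp
  have "bounded_linear (inv T)" using aut_inv_linear[OF T] linear_conv_bounded_linear by blast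
  then have "((\<lambda>x. inv T (\<phi> x)) has_derivative (\<lambda>h. inv T (D h))) (at m)"
    by (rule bounded_linear.has_derivative[OF _ d])
  moreover have "inv T (D h) = - h" for h
  proof -
    have "D h = T (- h)" using linear_neg[OF has_derivative_linear[OF d]] by (simp add: T_def)
    then show ?thesis using aut_inv_left[OF T] by simp
  qed
  ultimately show "((inv T \<circ> \<phi>) has_derivative uminus) (at m)" by (simp add: o_def)
qed

end

locale cone_symmetry = gauge_pair C \<phi> \<phi> for C :: "'a::euclidean_space set" and \<phi> +
  fixes e L
  assumes e: "e \<in> C" "\<phi> e = e" and deriv_e: "(\<phi> has_derivative uminus) (at e)"
    and L: "duality \<phi> \<phi> L" and L_sym: "adjoint L = L"

lemma (in proper_cone) cone_symmetry_exists:
  assumes "gauge_reversing C \<phi>" shows "\<exists>\<sigma> e L. cone_symmetry C \<sigma> e L"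
proof -
  interpret gauge_pair C \<phi> "inv_into C \<phi>"
    by unfold_locales (use assms gr_inverse in auto)
  obtain c where "c \<in> C" using C_nonempty by blast
  then obtain m D where m: "m \<in> C" and d: "(\<phi> has_derivative D) (at m)"
    using differentiable_dense[of c 1] unfolding differentiable_def by auto
  obtain L where L: "duality \<phi> (inv_into C \<phi>) L" using duality_exists by blast
  define T where "T = (\<lambda>h. - D h)"
  note n = normalize_at[OF L m d, folded T_def]
  define \<sigma> where "\<sigma> = inv T \<circ> \<phi>"
  note n = n[folded \<sigma>_def]
  interpret g: gauge_pair C \<sigma> "inv_into C \<phi> \<circ> T" by (rule n(2))
  have inv: "\<sigma> (\<sigma> x) = x" if "x \<in> C" for x using g.symmetry_involutive(2)[OF n(3) m n(4,5)] that by blast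
  interpret s: gauge_pair C \<sigma> \<sigma> by unfold_locales (use g.phi inv in auto)
  obtain M where M: "duality \<sigma> \<sigma> M" using s.duality_exists by blast
  have "adjoint M = M" using s.symmetry_involutive(1)[OF M m n(4,5)] .
  then have "cone_symmetry C \<sigma> m M" by unfold_locales (use m n M in auto)
  then show ?thesis by blast
qed

context cone_symmetry
begin

text \<open>Cancelling the derivative at \<open>m\<close> gives a second normal form, with map
  \<open>S = inv T \<circ> L\<close>. Symmetry of both \<open>S\<close> and \<open>L\<close> forces
  \<open>L \<circ> adjoint T = T \<circ> L\<close>, so \<open>T\<close> is self-adjoint for the form
  of \<open>inv L\<close>.\<close>

lemma derivative_L:
  assumes m: "m \<in> C" and d: "(\<phi> has_derivative D) (at m)"
  shows "L (adjoint (\<lambda>h. - D h) f) = - D (L f)"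
proof -
  define T where "T = (\<lambda>h. - D h)"
  note n = normalize_at[OF L m d, folded T_def]
  interpret g: gauge_pair C "inv T \<circ> \<phi>" "\<phi> \<circ> T" by (rule n(2))
  define S where "S = inv T \<circ> L"
  have S: "adjoint S = S" unfolding S_def using g.symmetry_involutive(1)[OF n(3) m n(4,5)] .
  have lT: "linear T" using aut_linear n(1) by blast
  have lS: "linear S" using g.L_linear[OF n(3)] by (simp add: S_def)
  have TS: "T (S g) = L g" for g using aut_inv_right[OF n(1)] by (simp add: S_def)
  have comm: "S (adjoint T f) = L f" for f
  proof (rule vector_eq_ldot[THEN iffD1], rule allI)
    fix g
    have "g \<bullet> S (adjoint T f) = T (S g) \<bullet> f"
      using adjoint_works[OF lS, of g] adjoint_works[OF lT, of "S g" f] S by simp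
    also have "\<dots> = g \<bullet> L f" using TS adjoint_works[OF L_linear[OF L], of g f] L_sym by simp
    finally show "g \<bullet> S (adjoint T f) = g \<bullet> L f" .
  qed
  have "L (adjoint T f) = T (L f)" using TS comm by metis
  then show ?thesis by (simp add: T_def)
qed

text \<open>Convexity traps \<open>D k\<close> between two difference quotients of \<open>\<phi>\<close>, for \<open>k = m - e\<close>.\<close>

lemma derivative_at_e_estimate:
  assumes "\<eta> > 0"
  shows "\<exists>\<delta>>0. \<forall>m D. m \<in> C \<longrightarrow> norm (m - e) < \<delta> \<longrightarrow> (\<phi> has_derivative D) (at m) \<longrightarrow>
    norm (- D e - (e - 2 *\<^sub>R (m - e))) \<le> \<eta> * norm (m - e)"
proof -
  obtain N where N: "N > 0" "\<And>x y. x \<in> K \<Longrightarrow> y - x \<in> K \<Longrightarrow> norm x \<le> N * norm y" using K_normal by blast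
  define r where "r = \<eta> / (4 * N + 4)"
  have r: "r > 0" using assms N by (simp add: r_def)
  obtain d1 where d1: "d1 > 0" "\<And>y. norm (y - e) < d1 \<Longrightarrow> norm (\<phi> y - \<phi> e - - (y - e)) \<le> r * norm (y - e)"
    using deriv_e r unfolding has_derivative_at_alt by meson
  obtain d2 where d2: "d2 > 0" "ball e d2 \<subseteq> C" using C_open e(1) openE by blast
  define d where "d = min d1 d2 / 2"
  have d: "d > 0" using d1 d2 by (simp add: d_def)
  have "norm (- D e - (e - 2 *\<^sub>R (m - e))) \<le> \<eta> * norm (m - e)"
    if m: "m \<in> C" "norm (m - e) < d" and D: "(\<phi> has_derivative D) (at m)" for m D
  proof -
    define k where "k = m - e"
    have mk: "m = e + k" by (simp add: k_def)
    have lD: "linear D" using D by (rule has_derivative_linear)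
    define T where "T h = - D h" for h
    have k: "norm k < d1" "norm (2 *\<^sub>R k) < d1" "norm (2 *\<^sub>R k) < d2" using m d by (auto simp: k_def d_def)
    \<comment> \<open>\<open>p\<close> and \<open>q\<close> are the first-order errors of
      \<open>\<phi>\<close> at \<open>e + k\<close> and \<open>e + 2 *\<^sub>R k\<close>; both are
      small against \<open>norm k\<close>.\<close>
    define p where "p = \<phi> m - (e - k)"
    define q where "q = \<phi> (e + 2 *\<^sub>R k) - (e - 2 *\<^sub>R k)"
    have p: "norm p \<le> r * norm k" using d1(2)[of m] k e by (simp add: p_def mk algebra_simps)
    have q: "norm q \<le> 2 * (r * norm k)" using d1(2)[of "e + 2 *\<^sub>R k"] k e by (simp add: q_def algebra_simps)
    have "e + 2 *\<^sub>R k \<in> C" using k by (intro subsetD[OF d2(2)]) (simp add: dist_norm)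
    then have "\<phi> (e + 2 *\<^sub>R k) - \<phi> m - D (e + 2 *\<^sub>R k - m) \<in> K" using gr_subgradient[OF D m(1)] by blast
    moreover have "e + 2 *\<^sub>R k - m = k" by (simp add: mk scaleR_2)
    ultimately have lo: "T k - (\<phi> m - \<phi> (e + 2 *\<^sub>R k)) \<in> K" by (simp add: T_def algebra_simps)
    have "\<phi> e - \<phi> m - D (e - m) \<in> K" using gr_subgradient[OF D m(1) e(1)] .
    moreover have "D (e - m) = T k" using linear_neg[OF lD, of k] by (simp add: T_def k_def)
    ultimately have "((e - \<phi> m) - (\<phi> m - \<phi> (e + 2 *\<^sub>R k))) - (T k - (\<phi> m - \<phi> (e + 2 *\<^sub>R k))) \<in> K"
      using e by (simp add: algebra_simps)
    from N(2)[OF lo this] have "norm (T k - (\<phi> m - \<phi> (e + 2 *\<^sub>R k))) \<le> N * norm ((e - \<phi> m) - (\<phi> m - \<phi> (e + 2 *\<^sub>R k)))" .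
    also have "(e - \<phi> m) - (\<phi> m - \<phi> (e + 2 *\<^sub>R k)) = q - 2 *\<^sub>R p" by (simp add: p_def q_def algebra_simps scaleR_2)
    also have "T k - (\<phi> m - \<phi> (e + 2 *\<^sub>R k)) = (T k - k) - p + q" by (simp add: p_def q_def algebra_simps scaleR_2)
    finally have u: "norm ((T k - k) - p + q) \<le> N * norm (q - 2 *\<^sub>R p)" .
    have "norm (q - 2 *\<^sub>R p) \<le> 4 * (r * norm k)" using norm_triangle_ineq4[of q "2 *\<^sub>R p"] p q by simp
    then have "N * norm (q - 2 *\<^sub>R p) \<le> N * (4 * (r * norm k))" using N by (simp add: mult_left_mono)
    then have u': "norm ((T k - k) - p + q) \<le> N * (4 * (r * norm k))" using u by linarith
    \<comment> \<open>Euler's relation converts the estimate of \<open>T k\<close> into one of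
      \<open>T e = T m - T k\<close>.\<close>
    have "T m = \<phi> m" using gr_derivative_euler[OF D m(1)] by (simp add: T_def)
    then have "T e = \<phi> m - T k" using linear_diff[OF lD, of m k] by (simp add: T_def mk)
    then have "T e - (e - 2 *\<^sub>R k) = q - ((T k - k) - p + q)" by (simp add: p_def algebra_simps scaleR_2)
    then have "norm (T e - (e - 2 *\<^sub>R k)) \<le> 2 * (r * norm k) + N * (4 * (r * norm k))"
      using norm_triangle_ineq4[of q "(T k - k) - p + q"] q u' by simp
    also have "\<dots> \<le> (4 * N + 4) * r * norm k" using r by (simp add: algebra_simps)
    also have "(4 * N + 4) * r = \<eta>" using N by (simp add: r_def)
    finally show ?thesis by (simp add: T_def k_def)
  qed
  then show ?thesis using d by blast
qed

section \<open>The orbit of \<open>e\<close> under the automorphisms\<close>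

definition orbit :: "'a set" where "orbit = {A e |A. aut A}"

lemma orbitI: "aut A \<Longrightarrow> A e \<in> orbit"
  unfolding orbit_def by (rule CollectI, rule exI[of _ A]) simp

lemma orbit_e: "e \<in> orbit"
  using orbitI[OF aut_id] by simp

lemma orbit_aut: "z \<in> orbit \<Longrightarrow> aut A \<Longrightarrow> A z \<in> orbit"
  unfolding orbit_def using orbitI[OF aut_comp[of A]] by (auto simp: orbit_def)

lemma orbit_sub: "orbit \<subseteq> C"
  unfolding orbit_def using aut_in e by blast

text \<open>The automorphism \<open>- D\<close> at a differentiability point \<open>m\<close> near
  \<open>e - (t / 2) *\<^sub>R v\<close> moves \<open>e\<close> to about
  \<open>e - 2 *\<^sub>R (m - e)\<close>, that is, to about
  \<open>e + t *\<^sub>R v\<close>.\<close>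

lemma orbit_tangent_e:
  assumes "\<eta> > 0"
  shows "\<exists>\<delta>>0. \<forall>t. 0 < t \<longrightarrow> t < \<delta> \<longrightarrow> (\<exists>q\<in>orbit. norm (q - (e + t *\<^sub>R v)) \<le> \<eta> * t)"
proof -
  \<comment> \<open>\<open>t * s\<close> bounds \<open>norm (m - e)\<close>: half of
    \<open>t * norm v\<close>, plus the distance \<open>t * \<eta> / 4\<close> within which
    \<open>m\<close> is found.\<close>
  define s where "s = norm v / 2 + \<eta> / 4"
  have s: "s > 0" using assms by (simp add: s_def add_nonneg_pos)
  obtain d1 where d1: "d1 > 0" "\<And>m D. m \<in> C \<Longrightarrow> norm (m - e) < d1 \<Longrightarrow> (\<phi> has_derivative D) (at m) \<Longrightarrow>
    norm (- D e - (e - 2 *\<^sub>R (m - e))) \<le> (\<eta> / (2 * s)) * norm (m - e)"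
    using derivative_at_e_estimate[of "\<eta> / (2 * s)"] s assms by auto
  obtain d2 where d2: "d2 > 0" "ball e d2 \<subseteq> C" using C_open e(1) openE by blast
  have "\<exists>q\<in>orbit. norm (q - (e + t *\<^sub>R v)) \<le> \<eta> * t" if t: "0 < t" "t < min d1 d2 / s" for t
  proof -
    have ts: "t * s < d1" "t * s < d2" using t s by (auto simp: field_simps)
    define c where "c = e - (t / 2) *\<^sub>R v"
    have "norm ((t / 2) *\<^sub>R v) < t * s" using t assms by (simp add: s_def distrib_left)
    then have "c \<in> C" using ts by (intro subsetD[OF d2(2)]) (simp add: c_def dist_norm)
    moreover have "t * \<eta> / 4 > 0" using t assms by simp
    ultimately obtain m D where m: "m \<in> C" "dist m c < t * \<eta> / 4" "(\<phi> has_derivative D) (at m)"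
      using differentiable_dense unfolding differentiable_def by blast
    define k where "k = m - e"
    have kc: "k + (t / 2) *\<^sub>R v = m - c" by (simp add: k_def c_def)
    have k1: "norm (k + (t / 2) *\<^sub>R v) \<le> t * \<eta> / 4" using m(2) unfolding kc by (simp add: dist_norm)
    have "norm k \<le> norm (k + (t / 2) *\<^sub>R v) + norm ((t / 2) *\<^sub>R v)"
      using norm_triangle_ineq4[of "k + (t / 2) *\<^sub>R v" "(t / 2) *\<^sub>R v"] by simp
    also have "\<dots> \<le> t * s" using k1 t by (simp add: s_def distrib_left)
    finally have k2: "norm k \<le> t * s" .
    define q where "q = - D e"
    have "q \<in> orbit" unfolding q_def using orbitI[OF gr_derivative_aut[OF m(3,1)]] by simp
    moreover have "norm (q - (e + t *\<^sub>R v)) \<le> \<eta> * t"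
    proof -
      have "norm (q - (e - 2 *\<^sub>R k)) \<le> (\<eta> / (2 * s)) * norm k"
        using d1(2)[OF m(1) _ m(3)] k2 ts by (simp add: q_def k_def)
      also have "\<dots> \<le> (\<eta> / (2 * s)) * (t * s)" using k2 s assms by (intro mult_left_mono) auto
      also have "\<dots> = \<eta> * t / 2" using s by simp
      finally have a: "norm (q - (e - 2 *\<^sub>R k)) \<le> \<eta> * t / 2" .
      have "q - (e + t *\<^sub>R v) = (q - (e - 2 *\<^sub>R k)) - 2 *\<^sub>R (k + (t / 2) *\<^sub>R v)"
        by (simp add: algebra_simps)
      then have "norm (q - (e + t *\<^sub>R v)) \<le> norm (q - (e - 2 *\<^sub>R k)) + norm (2 *\<^sub>R (k + (t / 2) *\<^sub>R v))"
        by (simp only: norm_triangle_ineq4)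
      also have "norm (2 *\<^sub>R (k + (t / 2) *\<^sub>R v)) = 2 * norm (k + (t / 2) *\<^sub>R v)" by simp
      finally show ?thesis using a k1 by (simp add: mult.commute)
    qed
    ultimately show ?thesis by blast
  qed
  moreover have "min d1 d2 / s > 0" using d1 d2 s by simp
  ultimately show ?thesis by blast
qed

lemma orbit_tangent:
  assumes "\<eta> > 0" and z: "z \<in> orbit"
  shows "\<exists>\<delta>>0. \<forall>t. 0 < t \<longrightarrow> t < \<delta> \<longrightarrow> (\<exists>q\<in>orbit. norm (q - (z + t *\<^sub>R v)) \<le> \<eta> * t)"
proof -
  obtain A where A: "aut A" "z = A e" using z unfolding orbit_def by blast
  obtain B where B: "B > 0" "\<And>x. norm (A x) \<le> B * norm x" using linear_bounded_pos[OF aut_linear[OF A(1)]] by blast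
  obtain \<delta> where d: "\<delta> > 0" "\<And>t. 0 < t \<Longrightarrow> t < \<delta> \<Longrightarrow> \<exists>q\<in>orbit. norm (q - (e + t *\<^sub>R inv A v)) \<le> \<eta> / B * t"
    using orbit_tangent_e[of "\<eta> / B" "inv A v"] assms B by auto
  have "\<exists>q\<in>orbit. norm (q - (z + t *\<^sub>R v)) \<le> \<eta> * t" if t: "0 < t" "t < \<delta>" for t
  proof -
    obtain q where q: "q \<in> orbit" "norm (q - (e + t *\<^sub>R inv A v)) \<le> \<eta> / B * t" using d(2)[OF t] by blast
    have "A q - (z + t *\<^sub>R v) = A (q - (e + t *\<^sub>R inv A v))"
      using aut_linear[OF A(1)] A(2) aut_inv_right[OF A(1)] by (simp add: linear_diff linear_add linear_scale)
    then have "norm (A q - (z + t *\<^sub>R v)) \<le> B * norm (q - (e + t *\<^sub>R inv A v))" using B by simp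
    also have "\<dots> \<le> B * (\<eta> / B * t)" using q B by (intro mult_left_mono) auto
    finally show ?thesis using orbit_aut[OF q(1) A(1)] B by (auto simp: field_simps)
  qed
  then show ?thesis using d(1) by blast
qed

end

section \<open>Homogeneity and self-duality\<close>

context proper_cone
begin

text \<open>\<open>h\<close> lies between the multiples \<open>- s\<close> and \<open>s\<close> of
  the order unit \<open>x\<close>, so \<open>A h\<close> lies between the same multiples of
  \<open>A x\<close>, and normality bounds its norm. One value at an interior point controls the
  whole automorphism.\<close>

lemma aut_norm_bound:
  assumes x: "x \<in> C"
  shows "\<exists>b>0. \<forall>A h. aut A \<longrightarrow> norm (A h) \<le> b * norm (A x) * norm h"
proof -
  obtain N where N: "N > 0" "\<And>x y. x \<in> K \<Longrightarrow> y - x \<in> K \<Longrightarrow> norm x \<le> N * norm y" using K_normal by blast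
  obtain c where c: "c > 0" "\<And>h. (c * norm h) *\<^sub>R x - h \<in> K" "\<And>h. (c * norm h) *\<^sub>R x + h \<in> K"
    using order_unit[OF x] by blast
  have "norm (A h) \<le> ((2 * N + 1) * c) * norm (A x) * norm h" if A: "aut A" for A h
  proof -
    note lin = aut_linear[OF A]
    define s where "s = c * norm h"
    have s: "s \<ge> 0" using c by (simp add: s_def)
    have "A (s *\<^sub>R x + h) \<in> K" "A (s *\<^sub>R x - h) \<in> K" using c aut_K[OF A] by (auto simp: s_def)
    then have k: "s *\<^sub>R A x + A h \<in> K" "s *\<^sub>R A x - A h \<in> K"
      using lin by (simp_all add: linear_add linear_diff linear_scale)
    have "(2 * s) *\<^sub>R A x - (s *\<^sub>R A x + A h) = s *\<^sub>R A x - A h" by (simp add: algebra_simps flip: scaleR_2)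
    then have "norm (s *\<^sub>R A x + A h) \<le> N * norm ((2 * s) *\<^sub>R A x)" using N(2)[OF k(1)] k(2) by metis
    then have "norm (s *\<^sub>R A x + A h) \<le> N * (2 * s * norm (A x))" using s by simp
    moreover have "norm (A h) \<le> norm (s *\<^sub>R A x + A h) + norm (s *\<^sub>R A x)"
      using norm_triangle_ineq4[of "s *\<^sub>R A x + A h" "s *\<^sub>R A x"] by simp
    ultimately have "norm (A h) \<le> N * (2 * s * norm (A x)) + s * norm (A x)" using s by simp
    then show ?thesis by (simp add: s_def algebra_simps)
  qed
  moreover have "(2 * N + 1) * c > 0" using N c by (simp add: add_pos_pos)
  ultimately show ?thesis by blast
qed

lemma aut_convergent_subsequence:
  assumes x: "x \<in> C" and A: "\<And>n. aut (A n)" and b: "\<And>n. norm (A n x) \<le> b"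
  obtains r B where "strict_mono (r :: nat \<Rightarrow> nat)" "bounded_linear B"
    "\<forall>u h. u \<longlonglongrightarrow> h \<longrightarrow> (\<lambda>n. A (r n) (u n)) \<longlonglongrightarrow> B h"
proof -
  obtain c where c: "c > 0" "\<And>A h. aut A \<Longrightarrow> norm (A h) \<le> c * norm (A x) * norm h"
    using aut_norm_bound[OF x] by blast
  define F where "F n = Blinfun (A n)" for n
  have F: "blinfun_apply (F n) = A n" for n
    unfolding F_def using aut_linear[OF A] linear_conv_bounded_linear bounded_linear_Blinfun_apply by blast
  have b0: "b \<ge> 0" using b norm_ge_zero order_trans by blast
  have "norm (F n) \<le> c * b" for n
  proof (rule norm_blinfun_bound)
    show "0 \<le> c * b" using c b0 by simp
    fix h
    have "norm (A n h) \<le> c * norm (A n x) * norm h" using c(2) A by blast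
    also have "\<dots> \<le> c * b * norm h" using b c by (intro mult_right_mono mult_left_mono) auto
    finally show "norm (blinfun_apply (F n) h) \<le> c * b * norm h" using F by simp
  qed
  then have "bounded (range F)" by (auto simp: bounded_iff)
  then obtain G and r :: "nat \<Rightarrow> nat" where r: "strict_mono r" and lim: "(F \<circ> r) \<longlonglongrightarrow> G"
    using bounded_imp_convergent_subsequence by blast
  have *: "(\<lambda>n. A (r n) (u n)) \<longlonglongrightarrow> blinfun_apply G h" if "u \<longlonglongrightarrow> h" for u h
    using bounded_bilinear.tendsto[OF bounded_bilinear_blinfun_apply lim that] by (simp add: F)
  show thesis by (rule that[OF r blinfun.bounded_linear_right[of G]]) (use * in blast)
qed

end

context cone_symmetry
begin

text \<open>A limit of automorphisms may be singular, so the inverses must converge along a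
  subsequence as well. They do because \<open>y\<close> is interior: eventually a fixed multiple
  \<open>s\<close> of the orbit point dominates \<open>e\<close>, so the inverses send
  \<open>e\<close> below \<open>s *\<^sub>R e\<close>.\<close>

lemma orbit_closed:
  assumes z: "\<And>n. z n \<in> orbit" and lim: "z \<longlonglongrightarrow> y" and y: "y \<in> C"
  shows "y \<in> orbit"
proof -
  obtain N where N: "N > 0" "\<And>x y. x \<in> K \<Longrightarrow> y - x \<in> K \<Longrightarrow> norm x \<le> N * norm y" using K_normal by blast
  have "\<forall>n. \<exists>A. aut A \<and> z n = A e" using z unfolding orbit_def by blast
  then obtain A where A: "\<And>n. aut (A n)" "\<And>n. z n = A n e" by metis
  obtain b where b: "\<And>n. norm (z n) \<le> b" using convergent_imp_Bseq[of z] lim BseqE convergentI by metis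
  have Ab: "norm (A n e) \<le> b" for n using A(2) b by metis
  obtain r B where r: "strict_mono r" "bounded_linear B"
    "\<forall>u h. u \<longlonglongrightarrow> h \<longrightarrow> (\<lambda>n. A (r n) (u n)) \<longlonglongrightarrow> B h"
    by (rule aut_convergent_subsequence[of e A b, OF e(1) A(1) Ab])
  note rc = r(3)[rule_format, OF tendsto_const]
  obtain c where c: "c > 0" "\<And>h. (c * norm h) *\<^sub>R y - h \<in> K" using order_unit[OF y] by blast
  \<comment> \<open>The extra 1 puts \<open>s *\<^sub>R y - e\<close> into the open cone, so that
    the relation persists for nearby orbit points.\<close>
  define s where "s = c * norm e + 1"
  have s: "s > 0" using c by (simp add: s_def add_nonneg_pos)
  have "s *\<^sub>R y - e = y + ((c * norm e) *\<^sub>R y - e)" by (simp add: s_def algebra_simps)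
  then have syC: "s *\<^sub>R y - e \<in> C" using C_add_K[OF y c(2)[of e]] by (simp only:)
  have lims: "(\<lambda>n. s *\<^sub>R z (r n) - e) \<longlonglongrightarrow> s *\<^sub>R y - e"
    using LIMSEQ_subseq_LIMSEQ[OF lim r(1)] by (intro tendsto_intros) (simp add: o_def)
  obtain n0 where n0: "\<And>n. n \<ge> n0 \<Longrightarrow> s *\<^sub>R z (r n) - e \<in> C"
    using topological_tendstoD[OF lims C_open syC] unfolding eventually_sequentially by blast
  define I where "I n = inv (A (r (n + n0)))" for n
  have I: "aut (I n)" for n unfolding I_def by (rule aut_inv[OF A(1)])
  have Ib: "norm (I n e) \<le> N * (s * norm e)" for n
  proof -
    have "I n (s *\<^sub>R A (r (n + n0)) e - e) \<in> K" using n0[of "n + n0"] A(2) aut_K[OF I] C_sub_K by simp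
    then have k: "s *\<^sub>R e - I n e \<in> K"
      using aut_linear[OF I, of n] aut_inv_left[OF A(1)] by (simp add: I_def linear_diff linear_scale)
    have "I n e \<in> K" using aut_in[OF I e(1)] C_sub_K by blast
    then show ?thesis using N(2)[OF _ k] s by simp
  qed
  obtain q J where q: "strict_mono q" "bounded_linear J"
    "\<forall>u h. u \<longlonglongrightarrow> h \<longrightarrow> (\<lambda>n. I (q n) (u n)) \<longlonglongrightarrow> J h"
    by (rule aut_convergent_subsequence[of e I, OF e(1) I Ib])
  note qc = q(3)[rule_format, OF tendsto_const]
  have BJ: "B (J h) = h" for h
  proof -
    have sm: "strict_mono (\<lambda>n. q n + n0)" using q(1) by (simp add: strict_mono_def)
    have "(\<lambda>n. A (r (q n + n0)) (I (q n) h)) = (\<lambda>n. h)" using aut_inv_right[OF A(1)] by (simp add: I_def)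
    moreover have "(\<lambda>n. A (r (q n + n0)) (I (q n) h)) \<longlonglongrightarrow> B (J h)"
    proof -
      have d: "(\<lambda>n. A (r (q n + n0)) (J h)) \<longlonglongrightarrow> B (J h)"
        using LIMSEQ_subseq_LIMSEQ[OF rc sm] by (simp add: o_def)
      obtain k where k: "k > 0" "\<And>A h. aut A \<Longrightarrow> norm (A h) \<le> k * norm (A e) * norm h"
        using aut_norm_bound[OF e(1)] by blast
      have bd: "norm (A (r (q n + n0)) (I (q n) h - J h)) \<le> (k * b) * norm (I (q n) h - J h)" for n
      proof -
        have "norm (A (r (q n + n0)) (I (q n) h - J h)) \<le> k * norm (z (r (q n + n0))) * norm (I (q n) h - J h)"
          using k(2)[OF A(1)] A(2) by metis
        also have "\<dots> \<le> (k * b) * norm (I (q n) h - J h)"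
          using b k by (intro mult_right_mono mult_left_mono) auto
        finally show ?thesis .
      qed
      have "(\<lambda>n. (k * b) * norm (I (q n) h - J h)) \<longlonglongrightarrow> (k * b) * norm (J h - J h)"
        by (intro tendsto_intros qc)
      then have "(\<lambda>n. (k * b) * norm (I (q n) h - J h)) \<longlonglongrightarrow> 0" by simp
      then have "(\<lambda>n. A (r (q n + n0)) (I (q n) h - J h)) \<longlonglongrightarrow> 0"
        by (rule Lim_null_comparison[rotated]) (rule always_eventually, rule allI, rule bd)
      from tendsto_add[OF this d] show ?thesis by (simp add: linear_diff[OF aut_linear[OF A(1)]])
    qed
    ultimately show ?thesis using LIMSEQ_unique tendsto_const by metis
  qed
  have lB: "linear B" using r(2) by (simp add: linear_conv_bounded_linear)
  have "surj B" using BJ by (metis surjI)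
  then have bB: "bij B" using linear_surjective_imp_injective[OF lB] by (simp add: bij_def)
  have BK: "B x \<in> K" if "x \<in> K" for x by (rule K_limit[OF _ rc]) (use aut_K[OF A(1)] that in blast)
  have JK: "J x \<in> K" if "x \<in> K" for x by (rule K_limit[OF _ qc]) (use aut_K[OF I] that in blast)
  have "x \<in> B ` K" if "x \<in> K" for x using imageI[OF JK[OF that], of B] BJ by simp
  then have "B ` K = K" using BK by blast
  then have "aut B" by (rule autI_closure[OF lB bB])
  moreover have "B e = y"
    using LIMSEQ_unique[OF rc[of e]] LIMSEQ_subseq_LIMSEQ[OF lim r(1)] A(2) by (simp add: o_def)
  ultimately show ?thesis using orbitI by metis
qed

text \<open>A point off the orbit would have a nearest point on it, from which the orbit still moves
  towards the point.\<close>

lemma orbit_nhd_e: "\<exists>\<rho>>0. ball e \<rho> \<subseteq> orbit"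
proof -
  obtain \<rho> where rho: "\<rho> > 0" "cball e \<rho> \<subseteq> C" using C_open e(1) open_contains_cball by blast
  define S where "S = orbit \<inter> cball e \<rho>"
  have "closed S" unfolding closed_sequential_limits
  proof (intro allI impI)
    fix u l assume u: "(\<forall>n. u n \<in> S) \<and> u \<longlonglongrightarrow> l"
    then have "l \<in> cball e \<rho>" using closed_sequentially[OF closed_cball] by (metis Int_iff S_def)
    moreover have "l \<in> orbit" using orbit_closed[of u l] u rho calculation by (auto simp: S_def)
    ultimately show "l \<in> S" by (simp add: S_def)
  qed
  then have cS: "compact S" unfolding S_def by (metis bounded_Int bounded_cball compact_eq_bounded_closed)
  have eS: "e \<in> S" using orbit_e rho by (simp add: S_def)
  \<comment> \<open>Half the radius keeps every competitor nearer to \<open>w\<close> than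
    \<open>z\<close> inside \<open>cball e \<rho>\<close>, so that minimality of \<open>z\<close>
    applies to it.\<close>
  have "w \<in> orbit" if w: "w \<in> ball e (\<rho> / 2)" for w
  proof -
    obtain z where z: "z \<in> S" "\<And>y. y \<in> S \<Longrightarrow> dist w z \<le> dist w y"
      using distance_attains_inf[of S w] cS eS compact_imp_closed by (metis empty_iff)
    have wz: "norm (w - z) < \<rho> / 2" using z(2)[OF eS] w by (simp add: dist_norm norm_minus_commute)
    have "w = z"
    proof (rule ccontr)
      assume "w \<noteq> z"
      define v where "v = w - z"
      have v: "norm v > 0" using \<open>w \<noteq> z\<close> by (simp add: v_def)
      obtain \<delta> where d: "\<delta> > 0" "\<And>t. 0 < t \<Longrightarrow> t < \<delta> \<Longrightarrow> \<exists>q\<in>orbit. norm (q - (z + t *\<^sub>R v)) \<le> norm v / 2 * t"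
        using orbit_tangent[of "norm v / 2" z v] v z by (auto simp: S_def)
      define t where "t = min (\<delta> / 2) (1 / 2)"
      have t: "0 < t" "t < \<delta>" "t < 1" using d(1) by (auto simp: t_def)
      obtain q where q: "q \<in> orbit" "norm (q - (z + t *\<^sub>R v)) \<le> norm v / 2 * t" using d(2)[OF t(1,2)] by blast
      have "w - q = (1 - t) *\<^sub>R v - (q - (z + t *\<^sub>R v))" by (simp add: v_def algebra_simps)
      then have "norm (w - q) \<le> norm ((1 - t) *\<^sub>R v) + norm (q - (z + t *\<^sub>R v))"
        by (simp only: norm_triangle_ineq4)
      also have "\<dots> \<le> (1 - t) * norm v + norm v / 2 * t" using q t by simp
      also have "\<dots> = norm v - norm v * t / 2" by (simp add: algebra_simps)
      also have "\<dots> < norm v" using v t by simp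
      finally have lt: "norm (w - q) < norm v" .
      have "dist e q \<le> dist e w + norm (w - q)" using dist_triangle[of e q w] by (simp add: dist_norm)
      then have "q \<in> S" using q lt wz w by (simp add: S_def v_def)
      then show False using z(2) lt by (force simp: dist_norm v_def)
    qed
    then show ?thesis using z by (simp add: S_def)
  qed
  then show ?thesis using rho by (intro exI[of _ "\<rho> / 2"]) auto
qed

lemma orbit_eq: "orbit = C"
proof -
  have "open orbit" unfolding open_subopen[of orbit]
  proof
    fix z assume "z \<in> orbit"
    then obtain A where A: "aut A" "z = A e" unfolding orbit_def by blast
    obtain \<rho> where rho: "\<rho> > 0" "ball e \<rho> \<subseteq> orbit" using orbit_nhd_e by blast
    have "open (A ` ball e \<rho>)" using A(1) open_bijective_linear_image_eq[of A] by (simp add: aut_def)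
    moreover have "A ` ball e \<rho> \<subseteq> orbit" using rho orbit_aut A by blast
    moreover have "z \<in> A ` ball e \<rho>" using A rho by simp
    ultimately show "\<exists>T. open T \<and> z \<in> T \<and> T \<subseteq> orbit" by blast
  qed
  then have "openin (top_of_set C) orbit" using orbit_sub by (simp add: open_subset)
  moreover have "orbit = C \<inter> closure orbit"
  proof
    show "orbit \<subseteq> C \<inter> closure orbit" using orbit_sub closure_subset by blast
    show "C \<inter> closure orbit \<subseteq> orbit"
    proof
      fix y assume y: "y \<in> C \<inter> closure orbit"
      then obtain z where "\<forall>n. z n \<in> orbit" "z \<longlonglongrightarrow> y" using closure_sequential[of y orbit] by blast
      then show "y \<in> orbit" using orbit_closed[of z y] y by simp
    qed
  qed
  then have "closedin (top_of_set C) orbit" using closedin_closed by blast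
  ultimately show ?thesis
    using convex_connected[OF C_convex] orbit_e unfolding connected_clopen by blast
qed

lemma homogeneous: "homogeneous_cone C"
  unfolding homogeneous_cone_def
proof (intro ballI)
  fix x y assume "x \<in> C" "y \<in> C"
  then obtain A B where A: "aut A" "x = A e" and B: "aut B" "y = B e"
    using orbit_eq unfolding orbit_def by blast
  then have "aut (B \<circ> inv A)" "(B \<circ> inv A) x = y" using aut_comp aut_inv aut_inv_left by auto
  then show "\<exists>A. linear A \<and> bij A \<and> A ` C = C \<and> A x = y" unfolding aut_def by blast
qed

section \<open>The inner product of self-duality\<close>

definition form :: "'a \<Rightarrow> 'a \<Rightarrow> real" where "form x y = inv L x \<bullet> y"

lemma inv_L: "linear (inv L)" "L (inv L x) = x" "inv L (L x) = x"
  using L_linear[OF L] L_bij[OF L]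
  by (simp_all add: bij_is_inj bij_is_surj inj_linear_imp_inv_linear surj_f_inv_f)

lemma form_sym: "form x y = form y x"
proof -
  have "inv L x \<bullet> y = inv L x \<bullet> adjoint L (inv L y)" using inv_L(2) L_sym by simp
  also have "\<dots> = x \<bullet> inv L y" by (simp add: adjoint_works[OF L_linear[OF L]] inv_L)
  finally show ?thesis by (simp add: form_def inner_commute)
qed

lemma form_bilinear: "bilinear form"
  unfolding bilinear_def form_def
  by (auto intro!: linearI simp: inner_add_left inner_add_right linear_add[OF inv_L(1)] linear_scale[OF inv_L(1)])

lemma form_derivative:
  assumes m: "m \<in> C" and d: "(\<phi> has_derivative D) (at m)"
  shows "form x (D y) = form (D x) y"
proof -
  have lT: "linear (\<lambda>h. - D h)" using has_derivative_linear[OF d] by (simp add: linear_compose_neg)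
  have "L (adjoint (\<lambda>h. - D h) (inv L x)) = - D x" using derivative_L[OF m d, of "inv L x"] inv_L by simp
  then have "adjoint (\<lambda>h. - D h) (inv L x) = inv L (- D x)" using inv_L(3) by metis
  then have "inv L (- D x) \<bullet> y = inv L x \<bullet> (- D y)"
    using adjoint_works[OF lT, of y "inv L x"] by (simp add: inner_commute)
  then show ?thesis by (simp add: form_def linear_neg[OF inv_L(1)])
qed

lemma form_bounded: "\<exists>\<beta>>0. \<forall>x y. \<bar>form x y\<bar> \<le> \<beta> * norm x * norm y"
proof -
  obtain B where B: "B > 0" "\<And>x. norm (inv L x) \<le> B * norm x" using linear_bounded_pos[OF inv_L(1)] by blast
  have "\<bar>form x y\<bar> \<le> B * norm x * norm y" for x y
    unfolding form_def using Cauchy_Schwarz_ineq2[of "inv L x" y] mult_right_mono[OF B(2)[of x], of "norm y"] by simp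
  then show ?thesis using B by blast
qed

text \<open>Here the convexity of \<open>y \<mapsto> form e (\<phi> y)\<close> is played off against the second-order
  expansion \<open>form e (\<phi> (e + k)) = form e e - form e k + form k k + o(|k|\<^sup>2)\<close>.\<close>

lemma form_nonneg: "0 \<le> form v v"
proof (rule ccontr)
  assume "\<not> 0 \<le> form v v"
  then have neg: "form v v < 0" by simp
  have "v \<noteq> 0" using neg form_def by auto
  obtain \<beta> where beta: "\<beta> > 0" "\<And>x y. \<bar>form x y\<bar> \<le> \<beta> * norm x * norm y" using form_bounded by blast
  \<comment> \<open>Half the absolute Rayleigh quotient of \<open>v\<close>: the strict inequality
    defining the open set \<open>W\<close> holds in the direction of \<open>v\<close> with room to
    pass to a nearby differentiability point.\<close>
  define c where "c = - form v v / (2 * (norm v)\<^sup>2)"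
  have c: "c > 0" unfolding c_def using neg \<open>v \<noteq> 0\<close> by (intro divide_pos_pos) auto
  have cv: "c * (norm v)\<^sup>2 = - form v v / 2" using \<open>v \<noteq> 0\<close> by (simp add: c_def)
  define W where "W = {k. form k k < - c * (norm k)\<^sup>2}"
  have lin: "bounded_linear (inv L)" using inv_L(1) linear_conv_bounded_linear by blast
  have "open W" unfolding W_def form_def
    by (intro open_Collect_less continuous_intros linear_continuous_on[OF lin])
  obtain \<delta> where delta: "\<delta> > 0" "\<And>m D. m \<in> C \<Longrightarrow> norm (m - e) < \<delta> \<Longrightarrow> (\<phi> has_derivative D) (at m) \<Longrightarrow>
    norm (- D e - (e - 2 *\<^sub>R (m - e))) \<le> (c / \<beta>) * norm (m - e)"
    using derivative_at_e_estimate[of "c / \<beta>"] c beta by auto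
  obtain d2 where d2: "d2 > 0" "ball e d2 \<subseteq> C" using C_open e(1) openE by blast
  define s where "s = min \<delta> d2 / (2 * norm v)"
  have s: "s > 0" using delta d2 \<open>v \<noteq> 0\<close> by (simp add: s_def)
  have sv: "norm (s *\<^sub>R v) = min \<delta> d2 / 2" using s \<open>v \<noteq> 0\<close> delta d2 by (simp add: s_def)
  have "form (s *\<^sub>R v) (s *\<^sub>R v) = s\<^sup>2 * form v v"
    using inv_L(1) by (simp add: form_def linear_scale power2_eq_square)
  moreover have "s\<^sup>2 * form v v < - c * (norm (s *\<^sub>R v))\<^sup>2"
  proof -
    have "- c * (norm (s *\<^sub>R v))\<^sup>2 = - (s\<^sup>2 * (c * (norm v)\<^sup>2))" by (simp add: power_mult_distrib)
    then have "- c * (norm (s *\<^sub>R v))\<^sup>2 = s\<^sup>2 * (form v v / 2)" by (simp add: cv)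
    moreover have "s\<^sup>2 * form v v < s\<^sup>2 * (form v v / 2)" using neg s by simp
    ultimately show ?thesis by (simp only:)
  qed
  ultimately have "s *\<^sub>R v \<in> W" by (simp add: W_def)
  then obtain r where r: "r > 0" "ball (s *\<^sub>R v) r \<subseteq> W" using \<open>open W\<close> openE by blast
  have "e + s *\<^sub>R v \<in> C" using sv delta d2 by (intro subsetD[OF d2(2)]) (simp add: dist_norm)
  moreover have "min r (min \<delta> d2 / 2) > 0" using r delta d2 by simp
  ultimately obtain m D where m: "m \<in> C" "dist m (e + s *\<^sub>R v) < min r (min \<delta> d2 / 2)" and D: "(\<phi> has_derivative D) (at m)"
    using differentiable_dense unfolding differentiable_def by blast
  define k where "k = m - e"
  have mk: "m = e + k" by (simp add: k_def)
  have "dist k (s *\<^sub>R v) = dist m (e + s *\<^sub>R v)" by (simp add: k_def dist_norm algebra_simps)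
  then have kd: "dist k (s *\<^sub>R v) < min r (min \<delta> d2 / 2)" using m(2) by simp
  then have kW: "k \<in> W" using r(2) by (auto simp: dist_commute)
  have "norm k \<le> norm (s *\<^sub>R v) + dist k (s *\<^sub>R v)" unfolding dist_norm by (rule norm_triangle_sub)
  then have kn: "norm k < \<delta>" using kd sv by linarith
  define \<epsilon> where "\<epsilon> = inv L e"
  have eps: "\<epsilon> \<in> Kd"
  proof -
    obtain f where "f \<in> Kd" "L f = e" using L_image[OF L] C_sub_K[OF e(1)] by (metis imageE)
    then show ?thesis using inv_L(3) by (metis \<epsilon>_def)
  qed
  have fe: "form e x = \<epsilon> \<bullet> x" for x by (simp add: form_def \<epsilon>_def)
  have "0 \<le> \<epsilon> \<bullet> (\<phi> e - \<phi> m - D (e - m))" using gr_subgradient[OF D m(1) e(1)] Kd_nonneg eps by blast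
  moreover have "D (e - m) = - D k" using linear_neg[OF has_derivative_linear[OF D], of k] by (simp add: k_def)
  moreover have "0 \<le> \<epsilon> \<bullet> (\<phi> m - \<phi> e - - (m - e))" using gr_subgradient[OF deriv_e e(1) m(1)] Kd_nonneg eps by blast
  \<comment> \<open>The subgradient inequalities at \<open>m\<close> and at \<open>e\<close>, added,
    cancel the values of \<open>\<phi>\<close>.\<close>
  ultimately have "0 \<le> \<epsilon> \<bullet> k + \<epsilon> \<bullet> D k"
    by (simp add: inner_diff_right inner_add_right k_def)
  \<comment> \<open>Self-adjointness moves \<open>D\<close> onto \<open>e\<close>, where it is known
    to first order; after substitution the terms linear in \<open>k\<close> cancel and
    \<open>2 * form k k\<close> remains up to the error \<open>form p k\<close>.\<close>
  then have 1: "0 \<le> form e k + form (D e) k" using fe form_derivative[OF m(1) D, of e k] by simp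
  define p where "p = - D e - (e - 2 *\<^sub>R k)"
  have p: "norm p \<le> (c / \<beta>) * norm k" using delta(2)[OF m(1) _ D] kn by (simp add: p_def k_def)
  have "D e = - e + 2 *\<^sub>R k - p" by (simp add: p_def)
  then have "form (D e) k = - form e k + 2 * form k k - form p k"
    unfolding form_def using inv_L(1)
    by (simp add: linear_diff linear_add linear_neg linear_scale inner_diff_left inner_add_left)
  then have "0 \<le> 2 * form k k - form p k" using 1 by simp
  moreover have "\<bar>form p k\<bar> \<le> c * (norm k)\<^sup>2"
  proof -
    have "\<bar>form p k\<bar> \<le> \<beta> * norm p * norm k" by (rule beta(2))
    also have "\<dots> \<le> \<beta> * ((c / \<beta>) * norm k) * norm k" using p beta by (intro mult_right_mono mult_left_mono) auto
    also have "\<dots> = c * (norm k)\<^sup>2" using beta by (simp add: power2_eq_square)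
    finally show ?thesis .
  qed
  moreover have "form k k < - (c * (norm k)\<^sup>2)" using kW by (simp add: W_def)
  moreover have "0 \<le> c * (norm k)\<^sup>2" using c by simp
  ultimately show False by linarith
qed

text \<open>A semidefinite form has its isotropic vectors in the radical, and injectivity of
  \<open>inv L\<close> leaves only 0 there.\<close>

lemma form_inner_product: "is_inner_product form"
  unfolding is_inner_product_def
proof (intro conjI allI impI)
  show "bilinear form" by (rule form_bilinear)
  show "form x y = form y x" for x y by (rule form_sym)
  fix x :: 'a assume x: "x \<noteq> 0"
  show "form x x > 0"
  proof (rule ccontr)
    assume "\<not> form x x > 0"
    then have xx: "form x x = 0" using form_nonneg[of x] by linarith
    have "form x w = 0" for w
    proof (rule ccontr)
      assume b: "form x w \<noteq> 0"
      \<comment> \<open>Makes the quadratic value at \<open>w + t *\<^sub>R x\<close> equal to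
        -1.\<close>
      define t where "t = - (form w w + 1) / (2 * form x w)"
      have "form (w + t *\<^sub>R x) (w + t *\<^sub>R x) = form w w + 2 * t * form x w + t * t * form x x"
        using form_sym[of w x] inv_L(1)
        by (simp add: form_def linear_add linear_scale inner_add_left inner_add_right algebra_simps)
      also have "2 * t * form x w = - (form w w + 1)" using b by (simp add: t_def)
      finally show False using form_nonneg[of "w + t *\<^sub>R x"] xx by simp
    qed
    then have "inv L x \<bullet> inv L x = 0" by (simp add: form_def)
    then have "inv L x = 0" by simp
    then have "x = 0" using inv_L(2)[of x] linear_0[OF L_linear[OF L]] by simp
    then show False using x by simp
  qed
qed

text \<open>\<open>inv L\<close> maps the closed cone onto the dual cone, so positivity of
  \<open>form y\<close> on the nonzero points of the former means that all nonzero functionals of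
  the latter are positive at \<open>y\<close>, which characterises \<open>C\<close>.\<close>

lemma self_dual: "self_dual_cone C"
  unfolding self_dual_cone_def
proof (intro exI[of _ form] conjI form_inner_product)
  have img: "inv L x \<in> Kd" "inv L x \<noteq> 0" if x: "x \<in> K" "x \<noteq> 0" for x
  proof -
    obtain f where "f \<in> Kd" "L f = x" using L_image[OF L] x(1) by (metis imageE)
    then show "inv L x \<in> Kd" using inv_L(3) by metis
    show "inv L x \<noteq> 0" using inv_L(2)[of x] linear_0[OF L_linear[OF L]] x(2) by metis
  qed
  show "C = {y. \<forall>x\<in>closure C - {0}. 0 < form y x}"
  proof (intro equalityI subsetI CollectI ballI)
    fix y x assume "y \<in> C" "x \<in> K - {0}"
    then show "0 < form y x" using Kd_pos img form_sym[of y x] by (simp add: form_def)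
  next
    fix y assume y: "y \<in> {y. \<forall>x\<in>K - {0}. 0 < form y x}"
    show "y \<in> C"
    proof (rule C_I)
      fix f assume f: "f \<in> Kd" "f \<noteq> 0"
      have "L f \<in> K" "L f \<noteq> 0" using L_Kd[OF L] f inv_L(3)[of f] linear_0[OF inv_L(1)] by metis+
      then have "0 < form y (L f)" using y by blast
      then show "0 < f \<bullet> y" using form_sym[of y "L f"] inv_L by (simp add: form_def)
    qed
  qed
qed

end

lemma (in proper_cone) gauge_reversing_imp_symmetric:
  "gauge_reversing C \<phi> \<Longrightarrow> symmetric_cone C"
  using cone_symmetry_exists cone_symmetry.homogeneous cone_symmetry.self_dual
  unfolding symmetric_cone_def by blast

section \<open>Linear images of Lebesgue measure and exponential integrals\<close>

lemma nn_integral_lborel_translate: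
  fixes f :: "'a::euclidean_space \<Rightarrow> ennreal"
  assumes [measurable]: "f \<in> borel_measurable borel"
  shows "(\<integral>\<^sup>+x. f (x + a) \<partial>lborel) = (\<integral>\<^sup>+x. f x \<partial>lborel)"
proof -
  have "(\<integral>\<^sup>+x. f x \<partial>lborel) = (\<integral>\<^sup>+x. f x \<partial>distr lborel borel ((+) a))" by (simp add: lborel_distr_plus)
  also have "\<dots> = (\<integral>\<^sup>+x. f (a + x) \<partial>lborel)" by (subst nn_integral_distr) auto
  finally show ?thesis by (simp add: add.commute)
qed

text \<open>The pullback of Lebesgue measure under a linear bijection is translation invariant, so
  the usual Fubini argument for uniqueness of Haar measure applies.\<close>

lemma distr_lborel_linear:
  fixes A :: "'a::euclidean_space \<Rightarrow> 'a"
  assumes A: "linear A" "bij A"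
  shows "\<exists>c>0. distr lborel borel A = density lborel (\<lambda>_. ennreal c)"
proof -
  have bl: "bounded_linear A" using A linear_conv_bounded_linear by blast
  have meas[measurable]: "A \<in> borel_measurable borel"
    using bl by (intro borel_measurable_continuous_onI linear_continuous_on)
  define g :: "'a \<Rightarrow> ennreal" where "g = indicator (ball 0 1)"
  have g[measurable]: "g \<in> borel_measurable borel" unfolding g_def by (rule borel_measurable_indicator) simp
  define m where "m = (\<integral>\<^sup>+y. g y \<partial>lborel)"
  define k where "k = (\<integral>\<^sup>+x. g (- A x) \<partial>lborel)"
  have "m = emeasure lborel (ball (0::'a) 1)" unfolding m_def g_def by simp
  then have m_eq: "m = ennreal (unit_ball_vol (DIM('a)))" by (simp add: emeasure_ball)
  moreover have "unit_ball_vol (real DIM('a)) > 0" by (rule unit_ball_vol_pos) simp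
  ultimately have m: "m \<noteq> 0" "m \<noteq> \<infinity>" by (metis ennreal_eq_0_iff not_le, metis ennreal_neq_top infinity_ennreal_def)
  have iA: "A (x + inv A y) = A x + y" "A (x + inv A y) - y = A x" for x y
    using A by (simp_all add: linear_add bij_is_surj surj_f_inv_f)
  have key: "(\<integral>\<^sup>+x. f (A x) \<partial>lborel) * m = k * (\<integral>\<^sup>+y. f y \<partial>lborel)"
    if [measurable]: "f \<in> borel_measurable borel" for f :: "'a \<Rightarrow> ennreal"
  proof -
    have "(\<integral>\<^sup>+x. f (A x) \<partial>lborel) * m = (\<integral>\<^sup>+y. (\<integral>\<^sup>+x. f (A x) \<partial>lborel) * g y \<partial>lborel)"
      unfolding m_def by (simp add: nn_integral_cmult)
    also have "\<dots> = (\<integral>\<^sup>+y. (\<integral>\<^sup>+x. f (A x + y) \<partial>lborel) * g y \<partial>lborel)"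
    proof (rule nn_integral_cong)
      fix y
      show "(\<integral>\<^sup>+x. f (A x) \<partial>lborel) * g y = (\<integral>\<^sup>+x. f (A x + y) \<partial>lborel) * g y"
        using nn_integral_lborel_translate[of "\<lambda>x. f (A x)" "inv A y"] iA by simp
    qed
    also have "\<dots> = (\<integral>\<^sup>+y. (\<integral>\<^sup>+x. f (A x + y) * g y \<partial>lborel) \<partial>lborel)"
      by (simp add: nn_integral_multc)
    also have "\<dots> = (\<integral>\<^sup>+x. (\<integral>\<^sup>+y. f (A x + y) * g y \<partial>lborel) \<partial>lborel)"
      by (rule lborel_pair.Fubini') measurable
    also have "\<dots> = (\<integral>\<^sup>+x. (\<integral>\<^sup>+y. f y * g (y - A x) \<partial>lborel) \<partial>lborel)"
    proof (rule nn_integral_cong)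
      fix x
      show "(\<integral>\<^sup>+y. f (A x + y) * g y \<partial>lborel) = (\<integral>\<^sup>+y. f y * g (y - A x) \<partial>lborel)"
        using nn_integral_lborel_translate[of "\<lambda>y. f y * g (y - A x)" "A x"] by (simp add: add.commute)
    qed
    also have "\<dots> = (\<integral>\<^sup>+y. (\<integral>\<^sup>+x. f y * g (y - A x) \<partial>lborel) \<partial>lborel)"
      by (rule lborel_pair.Fubini'[symmetric]) measurable
    also have "\<dots> = (\<integral>\<^sup>+y. k * f y \<partial>lborel)"
    proof (rule nn_integral_cong)
      fix y
      have "(\<integral>\<^sup>+x. g (y - A x) \<partial>lborel) = k"
        using nn_integral_lborel_translate[of "\<lambda>x. g (y - A x)" "inv A y"] iA by (simp add: k_def)
      then show "(\<integral>\<^sup>+x. f y * g (y - A x) \<partial>lborel) = k * f y"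
        by (simp add: nn_integral_cmult mult.commute)
    qed
    also have "\<dots> = k * (\<integral>\<^sup>+y. f y \<partial>lborel)" by (simp add: nn_integral_cmult)
    finally show ?thesis .
  qed
  have AE[measurable]: "A ` ball 0 1 \<in> sets borel"
    using open_bijective_linear_image_eq[OF A] by (intro borel_open) auto
  have ind: "indicator (A ` ball 0 1) (A x) = g x" for x
    using A by (auto simp: g_def indicator_def bij_is_inj inj_image_mem_iff)
  \<comment> \<open>The image of the unit ball shows that \<open>k\<close> is neither 0 nor
    infinite, whence the quotient \<open>k / m\<close> is a positive real.\<close>
  have "m * m = k * emeasure lborel (A ` ball 0 1)"
    using key[of "indicator (A ` ball 0 1)"] ind by (simp add: m_def)
  moreover have "emeasure lborel (A ` ball 0 1) \<noteq> \<infinity>"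
    using emeasure_bounded_finite[OF bounded_linear_image[OF bounded_ball bl], of 0 1] by simp
  ultimately have k: "k \<noteq> 0" "k \<noteq> \<infinity>"
    using m by (auto simp: ennreal_mult_eq_top_iff ennreal_top_mult split: if_splits)
  obtain c where c: "c > 0" "k / m = ennreal c"
  proof -
    obtain m' where m': "m = ennreal m'" "m' > 0" using m by (cases m) (auto simp: less_le)
    obtain k' where k': "k = ennreal k'" "k' > 0" using k by (cases k) (auto simp: less_le)
    have "k / m = ennreal (k' / m')" using m' k' by (simp add: divide_ennreal)
    then show thesis using that[of "k' / m'"] m' k' by simp
  qed
  have "distr lborel borel A = density lborel (\<lambda>_. k / m)"
  proof (rule measure_eqI)
    fix E assume "E \<in> sets (distr lborel borel A)"
    then have E[measurable]: "E \<in> sets borel" by simp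
    have "emeasure (distr lborel borel A) E = (\<integral>\<^sup>+x. indicator E (A x) \<partial>lborel)"
    proof -
      have "emeasure (distr lborel borel A) E = (\<integral>\<^sup>+x. indicator E x \<partial>distr lborel borel A)" by simp
      also have "\<dots> = (\<integral>\<^sup>+x. indicator E (A x) \<partial>lborel)" by (subst nn_integral_distr) auto
      finally show ?thesis .
    qed
    moreover have "(\<integral>\<^sup>+x. indicator E (A x) \<partial>lborel) * m = k * emeasure lborel E"
      using key[of "indicator E"] by simp
    ultimately have "emeasure (distr lborel borel A) E * m = k * emeasure lborel E" by simp
    then have "emeasure (distr lborel borel A) E * m / m = k * emeasure lborel E / m" by (simp only:)
    moreover have "emeasure (distr lborel borel A) E * m / m = emeasure (distr lborel borel A) E"
      using m by (intro mult_divide_eq_ennreal) auto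
    ultimately have "emeasure (distr lborel borel A) E = k / m * emeasure lborel E"
      by (simp only: ennreal_divide_times ennreal_times_divide)
    then show "emeasure (distr lborel borel A) E = emeasure (density lborel (\<lambda>_. k / m)) E"
      by (simp add: emeasure_density nn_integral_cmult)
  qed simp
  then show ?thesis using c by auto
qed

lemma integral_lborel_linear:
  fixes A :: "'a::euclidean_space \<Rightarrow> 'a" and g :: "'a \<Rightarrow> 'b::{banach, second_countable_topology}"
  assumes A: "linear A" and c: "c > 0" "distr lborel borel A = density lborel (\<lambda>_. ennreal c)"
    and g: "g \<in> borel_measurable borel"
  shows "(\<integral>y. g (A y) \<partial>lborel) = c *\<^sub>R (\<integral>y. g y \<partial>lborel)"
proof -
  have meas: "A \<in> measurable lborel borel"
    using A linear_conv_bounded_linear by (auto intro!: borel_measurable_continuous_onI linear_continuous_on)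
  have "(\<integral>y. g (A y) \<partial>lborel) = (\<integral>y. g y \<partial>distr lborel borel A)" by (rule integral_distr[OF meas g, symmetric])
  also have "\<dots> = (\<integral>y. c *\<^sub>R g y \<partial>lborel)" unfolding c(2) using g c(1) by (intro integral_density) auto
  finally show ?thesis by simp
qed

section \<open>Integrability of exponentially weighted powers\<close>

lemma power_le_exp:
  fixes x :: real assumes "x \<ge> 0" shows "x ^ n \<le> real n ^ n * exp x"
proof (cases "n = 0")
  case True then show ?thesis using assms by simp
next
  case False
  have "(x / n) ^ n \<le> (1 + x / n) ^ n" using assms by (intro power_mono) auto
  also have "\<dots> \<le> exp x" using exp_ge_one_plus_x_over_n_power_n[of n x] assms False by simp
  finally show ?thesis using False by (simp add: power_divide field_simps)
qed

text \<open>Domination by the constants \<open>exp (- c * real k)\<close> on balls of radius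
  \<open>k + 1\<close>. The volumes grow polynomially, and half of the exponent absorbs them,
  leaving a geometric series.\<close>

lemma integrable_exp_norm:
  fixes c :: real assumes c: "c > 0"
  shows "integrable lborel (\<lambda>y::'a::euclidean_space. exp (- c * norm y))"
proof (rule integrableI_bounded)
  let ?n = "DIM('a)"
  define V where "V = unit_ball_vol (real ?n)"
  define b where "b k = exp (- c * real k) * (V * real (Suc k) ^ ?n)" for k
  have V: "V \<ge> 0" by (simp add: V_def unit_ball_vol_nonneg)
  have b0: "b k \<ge> 0" for k using V by (simp add: b_def)
  have bb: "b k \<le> (V * (real ?n ^ ?n / (c / 2) ^ ?n) * exp (c / 2)) * exp (- c / 2) ^ k" for k
  proof -
    have "(c / 2 * real (Suc k)) ^ ?n \<le> real ?n ^ ?n * exp (c / 2 * real (Suc k))"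
      using c by (intro power_le_exp) auto
    then have "real (Suc k) ^ ?n \<le> real ?n ^ ?n / (c / 2) ^ ?n * exp (c / 2 * real (Suc k))"
      using c by (simp add: power_mult_distrib field_simps del: of_nat_Suc)
    then have "b k \<le> exp (- c * real k) * (V * (real ?n ^ ?n / (c / 2) ^ ?n * exp (c / 2 * real (Suc k))))"
      unfolding b_def using V by (intro mult_left_mono) auto
    also have "\<dots> = (V * (real ?n ^ ?n / (c / 2) ^ ?n)) * (exp (- c * real k) * exp (c / 2 * real (Suc k)))"
      by (simp only: mult_ac)
    also have "exp (- c * real k) * exp (c / 2 * real (Suc k)) = exp (c / 2) * exp (- c / 2) ^ k"
    proof -
      have "- c * real k + c / 2 * real (Suc k) = c / 2 + real k * (- c / 2)" by (simp add: field_simps)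
      then show ?thesis by (metis exp_add exp_of_nat_mult)
    qed
    finally show ?thesis by (simp only: mult_ac)
  qed
  have "summable (\<lambda>k. (V * (real ?n ^ ?n / (c / 2) ^ ?n) * exp (c / 2)) * exp (- c / 2) ^ k)"
    using c by (intro summable_mult summable_geometric) simp
  then have sb: "summable b" by (rule summable_comparison_test'[of _ 0]) (use bb b0 in auto)
  have le: "ennreal (exp (- c * norm y)) \<le> (\<Sum>k. ennreal (exp (- c * real k)) * indicator (ball 0 (real (Suc k))) y)" for y :: 'a
  proof -
    define k where "k = nat \<lfloor>norm y\<rfloor>"
    have k: "real k \<le> norm y" "norm y < real (Suc k)"
      unfolding k_def using real_of_int_floor_add_one_gt[of "norm y"] by (auto simp: add.commute)
    have "ennreal (exp (- c * norm y)) \<le> ennreal (exp (- c * real k)) * indicator (ball 0 (real (Suc k))) y"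
      using k c by (simp add: ennreal_leI)
    also have "\<dots> \<le> (\<Sum>k. ennreal (exp (- c * real k)) * indicator (ball 0 (real (Suc k))) y)"
    proof -
      have "F k \<le> suminf F" for F :: "nat \<Rightarrow> ennreal"
        using sum_le_suminf[OF summableI, of "{k}" F] by simp
      then show ?thesis .
    qed
    finally show ?thesis .
  qed
  have "(\<integral>\<^sup>+y. ennreal (norm (exp (- c * norm (y::'a)))) \<partial>lborel)
     \<le> (\<integral>\<^sup>+y. (\<Sum>k. ennreal (exp (- c * real k)) * indicator (ball (0::'a) (real (Suc k))) y) \<partial>lborel)"
    using le by (intro nn_integral_mono) simp
  also have "\<dots> = (\<Sum>k. ennreal (exp (- c * real k)) * emeasure lborel (ball (0::'a) (real (Suc k))))"
    by (subst nn_integral_suminf)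
      (auto intro!: borel_measurable_times_ennreal borel_measurable_indicator simp: nn_integral_cmult_indicator)
  also have "\<dots> = (\<Sum>k. ennreal (b k))"
    using V by (intro suminf_cong) (simp add: emeasure_ball b_def V_def ennreal_mult' del: of_nat_Suc)
  also have "\<dots> < \<infinity>" using sb b0 by (simp add: suminf_ennreal2 less_top)
  finally show "(\<integral>\<^sup>+y. ennreal (norm (exp (- c * norm (y::'a)))) \<partial>lborel) < \<infinity>" .
qed measurable

lemma integrable_power_exp_norm:
  fixes c :: real assumes c: "c > 0"
  shows "integrable lborel (\<lambda>y::'a::euclidean_space. norm y ^ k * exp (- c * norm y))"
proof (rule Bochner_Integration.integrable_bound)
  show "integrable lborel (\<lambda>y::'a. (real k ^ k / (c / 2) ^ k) * exp (- (c / 2) * norm y))"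
    using c by (intro integrable_mult_right integrable_exp_norm) simp
  show "AE y::'a in lborel. norm (norm y ^ k * exp (- c * norm y))
      \<le> norm ((real k ^ k / (c / 2) ^ k) * exp (- (c / 2) * norm y))"
  proof (rule AE_I2)
    fix y :: 'a
    have "(c / 2 * norm y) ^ k \<le> real k ^ k * exp (c / 2 * norm y)" using c by (intro power_le_exp) auto
    then have "norm y ^ k \<le> real k ^ k / (c / 2) ^ k * exp (c / 2 * norm y)"
      using c by (simp add: power_mult_distrib field_simps)
    then have "norm y ^ k * exp (- c * norm y) \<le> real k ^ k / (c / 2) ^ k * exp (c / 2 * norm y) * exp (- c * norm y)"
      by (intro mult_right_mono) auto
    also have "\<dots> = real k ^ k / (c / 2) ^ k * exp (- (c / 2) * norm y)"
      by (simp add: algebra_simps flip: exp_add)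
    finally show "norm (norm y ^ k * exp (- c * norm y)) \<le> norm ((real k ^ k / (c / 2) ^ k) * exp (- (c / 2) * norm y))"
      using c by simp
  qed
qed measurable

lemma exp_taylor_bound:
  fixes s :: real shows "\<bar>exp (- s) - 1 + s\<bar> \<le> s\<^sup>2 * exp \<bar>s\<bar>"
proof -
  obtain t where t: "\<bar>t\<bar> \<le> \<bar>- s\<bar>" "exp (- s) = (\<Sum>m<2. (- s) ^ m / fact m) + (exp t / fact 2) * (- s) ^ 2"
    using Maclaurin_exp_le[of "- s" 2] by blast
  then have "exp (- s) - 1 + s = exp t / 2 * s\<^sup>2" by (simp add: numeral_2_eq_2)
  moreover have "0 \<le> exp t / 2 * s\<^sup>2" by simp
  ultimately have "\<bar>exp (- s) - 1 + s\<bar> = exp t / 2 * s\<^sup>2" by linarith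
  moreover have "exp t / 2 * s\<^sup>2 \<le> s\<^sup>2 * exp \<bar>s\<bar>"
  proof -
    have "exp t \<le> exp \<bar>s\<bar>" using t(1) by simp
    then have "exp t / 2 \<le> exp \<bar>s\<bar>" using exp_gt_zero[of t] by linarith
    from mult_right_mono[OF this zero_le_power2[of s]] show ?thesis by (simp only: mult.commute)
  qed
  ultimately show ?thesis by (simp only:)
qed

lemma has_derivative_quadratic_remainder:
  fixes f :: "'a::real_normed_vector \<Rightarrow> 'b::real_normed_vector"
  assumes D: "bounded_linear D" and d: "d > 0"
    and q: "\<And>h. norm h < d \<Longrightarrow> norm (f (x + h) - f x - D h) \<le> Q * (norm h)\<^sup>2"
  shows "(f has_derivative D) (at x)"
  unfolding has_derivative_at
proof (intro conjI D)
  have "\<forall>\<^sub>F h in at 0. norm (norm (f (x + h) - f x - D h) / norm h) \<le> Q * norm h"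
    unfolding eventually_at
  proof (intro exI[of _ d] conjI ballI impI d)
    fix h :: 'a assume h: "h \<noteq> 0 \<and> dist h 0 < d"
    then have "norm (f (x + h) - f x - D h) / norm h \<le> Q * (norm h)\<^sup>2 / norm h"
      using q[of h] by (intro divide_right_mono) auto
    then show "norm (norm (f (x + h) - f x - D h) / norm h) \<le> Q * norm h"
      using h by (simp add: power2_eq_square)
  qed
  moreover have "((\<lambda>h::'a. Q * norm h) \<longlongrightarrow> 0) (at 0)"
    using tendsto_mult[OF tendsto_const tendsto_norm[OF tendsto_ident_at], of Q "0::'a" UNIV] by simp
  ultimately show "(\<lambda>h. norm (f (x + h) - f x - D h) / norm h) \<midarrow>0\<rightarrow> 0"
    by (rule Lim_null_comparison)
qed

lemma integral_pos_on_open: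
  fixes f :: "'a::euclidean_space \<Rightarrow> real"
  assumes f: "integrable lborel f" "\<And>y. 0 \<le> f y" and U: "open U" "U \<noteq> {}" "\<And>y. y \<in> U \<Longrightarrow> 0 < f y"
  shows "0 < (\<integral>y. f y \<partial>lborel)"
proof (rule ccontr)
  assume "\<not> 0 < (\<integral>y. f y \<partial>lborel)"
  then have "(\<integral>y. f y \<partial>lborel) = 0" using integral_nonneg_AE[of f lborel] f(2) by (simp add: order_antisym)
  then have "AE y in lborel. f y = 0" using integral_nonneg_eq_0_iff_AE[OF f(1)] f(2) by simp
  then have "AE y in lborel. y \<notin> U" by (rule AE_mp) (use U(3) in \<open>force intro!: AE_I2\<close>)
  then have N: "U \<in> null_sets lborel" using U(1) by (simp add: AE_iff_null_sets)
  obtain a where "a \<in> U" using U(2) by blast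
  then obtain r where r: "r > 0" "ball a r \<subseteq> U" using U(1) openE by blast
  have "ball a r \<in> null_sets lborel" by (rule null_sets_subset[OF N _ r(2)]) simp
  then have "emeasure lborel (ball a r) = 0" by auto
  moreover have "0 < unit_ball_vol (real DIM('a)) * r ^ DIM('a)"
    using r by (intro mult_pos_pos unit_ball_vol_pos) auto
  ultimately show False using r by (metis emeasure_ball ennreal_eq_0_iff less_imp_le not_le)
qed

section \<open>The star map of a symmetric cone\<close>

locale symmetric_cone_form = proper_cone +
  fixes B :: "'a \<Rightarrow> 'a \<Rightarrow> real"
  assumes B: "is_inner_product B" and C_dual: "C = {y. \<forall>x \<in> closure C - {0}. B y x > 0}"
    and transitive: "\<And>x y. x \<in> C \<Longrightarrow> y \<in> C \<Longrightarrow> \<exists>A. aut A \<and> A x = y"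
begin

lemma B_bb: "bounded_bilinear B"
  using B unfolding is_inner_product_def by (simp add: bilinear_conv_bounded_bilinear)

sublocale B: bounded_bilinear B
  by (rule B_bb)

lemma B_sym: "B x y = B y x" and B_pos: "x \<noteq> 0 \<Longrightarrow> B x x > 0"
  using B unfolding is_inner_product_def by auto

lemma B_self: "B x x = 0 \<longleftrightarrow> x = 0"
  using B_pos[of x] B.zero_left by (cases "x = 0") auto

lemma B_eqI: assumes "\<And>z. B z x = B z y" shows "x = y"
proof -
  have "B (x - y) (x - y) = 0" using assms[of "x - y"] by (simp add: B.diff_right)
  then show ?thesis by (simp add: B_self)
qed

lemma C_B_pos: "y \<in> C \<Longrightarrow> x \<in> K \<Longrightarrow> x \<noteq> 0 \<Longrightarrow> 0 < B y x"
  using C_dual by blast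

lemma K_B_nonneg:
  assumes "y \<in> K" "x \<in> K" shows "0 \<le> B y x"
proof -
  obtain e where e: "e \<in> C" using C_nonempty by blast
  have "0 \<le> B y x + d * B e x" if "d > 0" for d
  proof (cases "x = 0")
    case False
    have "d *\<^sub>R e + y \<in> C" using C_add_K[OF C_scale[OF e that] assms(1)] .
    then have "0 < B (d *\<^sub>R e + y) x" using C_B_pos assms False by blast
    then show ?thesis by (simp add: B.add_left B.scaleR_left)
  qed (simp add: B.zero_right)
  moreover have "((\<lambda>d. B y x + d * B e x) \<longlongrightarrow> B y x + 0 * B e x) (at_right 0)"
    by (intro tendsto_intros)
  ultimately have "0 \<le> B y x + 0 * B e x"
    by (intro tendsto_lowerbound[where F = "at_right 0"]) (auto simp: eventually_at_right_less eventually_at_filter)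
  then show ?thesis by simp
qed

lemma K_B_I: assumes "\<And>x. x \<in> K \<Longrightarrow> 0 \<le> B y x" shows "y \<in> K"
proof -
  obtain e where e: "e \<in> C" using C_nonempty by blast
  show ?thesis
  proof (rule K_archimedean)
    fix d :: real assume "d > 0"
    then have de: "d *\<^sub>R e \<in> C" using C_scale e by blast
    have "y + d *\<^sub>R e \<in> C"
      by (subst C_dual) (use assms C_B_pos[OF de] in \<open>auto simp: B.add_left intro: add_nonneg_pos\<close>)
    then show "y + d *\<^sub>R e \<in> K" by (rule C_sub_K)
  qed
qed

text \<open>The ambient \<open>\<bullet>\<close> and the form \<open>B\<close> differ. Expressing
  \<open>B x\<close> as an ambient inner product makes \<open>adjoint\<close> and the compactness
  bound, both tied to \<open>\<bullet>\<close>, available for \<open>B\<close>.\<close>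

definition riesz :: "'a \<Rightarrow> 'a" where "riesz x = (\<Sum>i\<in>Basis. B x i *\<^sub>R i)"

lemma riesz_inner: "riesz x \<bullet> y = B x y"
proof -
  have "B x y = B x (\<Sum>i\<in>Basis. (y \<bullet> i) *\<^sub>R i)" by (simp add: euclidean_representation)
  also have "\<dots> = (\<Sum>i\<in>Basis. (y \<bullet> i) * B x i)" by (simp add: B.sum_right B.scaleR_right)
  also have "\<dots> = (\<Sum>i\<in>Basis. B x i * (i \<bullet> y))" by (simp add: inner_commute mult.commute)
  also have "\<dots> = riesz x \<bullet> y" by (simp add: riesz_def inner_sum_left)
  finally show ?thesis by simp
qed

lemma inner_riesz: "y \<bullet> riesz x = B x y"
  using riesz_inner[of x y] by (simp add: inner_commute)

lemma riesz_linear: "linear riesz"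
  unfolding riesz_def
  by (rule linearI) (simp_all add: B.add_left B.scaleR_left scaleR_add_left sum.distrib scaleR_sum_right)

lemma riesz_bij: "bij riesz"
proof -
  have "x = 0" if "riesz x = 0" for x using riesz_inner[of x x] that B_self by simp
  then have "inj riesz" using linear_injective_0[OF riesz_linear] by blast
  then show ?thesis using linear_injective_imp_surjective[OF riesz_linear] by (simp add: bij_def)
qed

lemma B_lower_bound: assumes "x \<in> C" shows "\<exists>m>0. \<forall>y\<in>K. m * norm y \<le> B x y"
  using closed_cone_inner_lower_bound[OF closed_closure K_scale, of "riesz x"] C_B_pos[OF assms]
  by (simp add: inner_riesz)

text \<open>The adjoint with respect to \<open>B\<close>, obtained from the ambient one by
  conjugation.\<close>

definition adj :: "('a \<Rightarrow> 'a) \<Rightarrow> 'a \<Rightarrow> 'a" where "adj A = inv riesz \<circ> adjoint A \<circ> riesz"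

lemma adj_works: assumes "linear A" shows "B x (adj A y) = B (A x) y"
proof -
  have "B x (adj A y) = riesz (adj A y) \<bullet> x" using riesz_inner B_sym by metis
  also have "riesz (adj A y) = adjoint A (riesz y)" using riesz_bij by (simp add: adj_def bij_is_surj surj_f_inv_f)
  also have "\<dots> \<bullet> x = riesz y \<bullet> A x" using adjoint_works[OF assms] by (metis inner_commute)
  finally show ?thesis using riesz_inner B_sym by metis
qed

text \<open>Self-duality makes the \<open>B\<close>-adjoint preserve the cone:
  \<open>adj A x\<close> pairs with a point of the cone as \<open>x\<close> does with its image
  under \<open>A\<close>.\<close>

lemma adj_aut: assumes A: "aut A"
  shows "aut (adj A)" "adj A (adj (inv A) x) = x" "adj (inv A) (adj A x) = x" "adj (adj A) = A"
proof -
  note lA = aut_linear[OF A] and liA = aut_inv_linear[OF A]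
  have "linear (inv riesz)" using riesz_linear riesz_bij by (simp add: bij_is_inj inj_linear_imp_inv_linear)
  then have lin: "linear (adj M)" if "linear M" for M
    unfolding adj_def using that by (intro linear_compose riesz_linear adjoint_linear)
  show 1: "adj A (adj (inv A) x) = x" for x
    by (rule B_eqI) (simp add: adj_works[OF lA] adj_works[OF liA] aut_inv_left[OF A])
  show 2: "adj (inv A) (adj A x) = x" for x
    by (rule B_eqI) (simp add: adj_works[OF lA] adj_works[OF liA] aut_inv_right[OF A])
  have K: "adj M x \<in> K" if "aut M" "x \<in> K" for M x
  proof (rule K_B_I)
    fix z assume "z \<in> K"
    then show "0 \<le> B (adj M x) z"
      using K_B_nonneg that aut_K B_sym[of "adj M x" z] by (simp add: adj_works aut_linear)
  qed
  have "bij (adj A)" by (rule o_bij[of "adj (inv A)"]) (auto simp: 1 2)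
  moreover have "adj A ` K = K"
  proof
    show "adj A ` K \<subseteq> K" using K A by blast
    show "K \<subseteq> adj A ` K" using K[OF aut_inv[OF A]] 1 by (metis imageI subsetI)
  qed
  ultimately show "aut (adj A)" by (intro autI_closure lin lA)
  show "adj (adj A) = A"
  proof
    fix x show "adj (adj A) x = A x"
      by (rule B_eqI) (use adj_works[OF lin[OF lA]] adj_works[OF lA] B_sym in metis)
  qed
qed

section \<open>Laplace-type integrals over the cone\<close>

definition wt :: "'a \<Rightarrow> 'a \<Rightarrow> real" where "wt x y = indicator C y * exp (- B x y)"

lemma B_measurable[measurable]: "(\<lambda>y. B x y) \<in> borel_measurable borel"
  by (intro borel_measurable_continuous_onI linear_continuous_on B.bounded_linear_right)

lemma C_measurable[measurable]: "C \<in> sets borel"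
  using C_open by (rule borel_open)

lemma wt_measurable[measurable]: "wt x \<in> borel_measurable borel"
  unfolding wt_def[abs_def] by measurable

lemma wt_nonneg: "0 \<le> wt x y"
  by (simp add: wt_def)

lemma wt_pos: "y \<in> C \<Longrightarrow> 0 < wt x y"
  by (simp add: wt_def)

text \<open>On the cone \<open>B x y\<close> dominates a multiple of \<open>norm y\<close>, so the
  weight decays exponentially and beats the polynomial growth of \<open>g\<close>.\<close>

lemma wt_integrable:
  fixes g :: "'a \<Rightarrow> 'b::{banach, second_countable_topology}"
  assumes x: "x \<in> C" and g[measurable]: "g \<in> borel_measurable borel" and b: "\<And>y. norm (g y) \<le> M * norm y ^ k"
  shows "integrable lborel (\<lambda>y. wt x y *\<^sub>R g y)"
proof -
  obtain m where m: "m > 0" "\<And>y. y \<in> K \<Longrightarrow> m * norm y \<le> B x y" using B_lower_bound[OF x] by blast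
  show ?thesis
  proof (rule Bochner_Integration.integrable_bound)
    show "integrable lborel (\<lambda>y::'a. M * (norm y ^ k * exp (- m * norm y)))"
      by (intro integrable_mult_right integrable_power_exp_norm m)
    show "AE y in lborel. norm (wt x y *\<^sub>R g y) \<le> norm (M * (norm y ^ k * exp (- m * norm y)))"
    proof (rule AE_I2)
      fix y
      have w: "wt x y \<le> exp (- m * norm y)" using m(2)[of y] C_sub_K[of y] by (auto simp: wt_def indicator_def)
      have "norm (wt x y *\<^sub>R g y) \<le> exp (- m * norm y) * (M * norm y ^ k)"
        using w b[of y] wt_nonneg[of x y] by (simp add: mult_mono)
      also have "\<dots> \<le> norm (M * (norm y ^ k * exp (- m * norm y)))" by (simp add: mult_ac)
      finally show "norm (wt x y *\<^sub>R g y) \<le> norm (M * (norm y ^ k * exp (- m * norm y)))" .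
    qed
  qed measurable
qed

text \<open>Differentiation under the integral sign, by a pointwise quadratic remainder of the
  exponential with an integrable bound uniform in small \<open>h\<close>. The general
  \<open>g\<close> covers \<open>psi\<close> and \<open>moment\<close> at once.\<close>

lemma wt_derivative:
  fixes g :: "'a \<Rightarrow> 'b::{banach, second_countable_topology}"
  assumes x: "x \<in> C" and g[measurable]: "g \<in> borel_measurable borel" and b: "\<And>y. norm (g y) \<le> M * norm y ^ k"
  shows "((\<lambda>x. \<integral>y. wt x y *\<^sub>R g y \<partial>lborel) has_derivative (\<lambda>h. - (\<integral>y. wt x y *\<^sub>R (B h y *\<^sub>R g y) \<partial>lborel))) (at x)"
    (is "(_ has_derivative (\<lambda>h. - ?I h)) _")
proof -
  obtain m where m: "m > 0" "\<And>y. y \<in> K \<Longrightarrow> m * norm y \<le> B x y" using B_lower_bound[OF x] by blast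
  obtain \<beta> where beta: "\<beta> > 0" "\<And>x y. norm (B x y) \<le> norm x * norm y * \<beta>" using B.pos_bounded by blast
  obtain d0 where d0: "d0 > 0" "ball x d0 \<subseteq> C" using x C_open openE by blast
  \<comment> \<open>Within \<open>m / (2 * \<beta>)\<close> the factor
    \<open>exp \<bar>B h y\<bar>\<close> uses up at most half of the decay of the weight.\<close>
  define d where "d = min d0 (m / (2 * \<beta>))"
  have d: "d > 0" using d0 m beta by (simp add: d_def)
  have i1: "integrable lborel (\<lambda>y. wt x y *\<^sub>R (B h y *\<^sub>R g y))" for h
  proof (rule wt_integrable[OF x])
    show "norm (B h y *\<^sub>R g y) \<le> (norm h * \<beta> * M) * norm y ^ Suc k" for y
      using mult_mono[OF beta(2)[of h y] b[of y]] beta(1) by (simp add: mult_ac)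
  qed measurable
  define J where "J = (\<integral>y. norm y ^ (k + 2) * exp (- (m / 2) * norm (y::'a)) \<partial>lborel)"
  have iJ: "integrable lborel (\<lambda>y::'a. norm y ^ (k + 2) * exp (- (m / 2) * norm y))"
    by (rule integrable_power_exp_norm) (use m in simp)
  show ?thesis
  proof (rule has_derivative_quadratic_remainder[OF _ d])
    have "linear (\<lambda>h. - ?I h)"
    proof (rule linearI)
      fix h1 h2
      have "?I (h1 + h2)
        = (\<integral>y. wt x y *\<^sub>R (B h1 y *\<^sub>R g y) + wt x y *\<^sub>R (B h2 y *\<^sub>R g y) \<partial>lborel)"
        by (simp only: B.add_left scaleR_add_left scaleR_add_right)
      also have "\<dots> = ?I h1 + ?I h2"
        by (rule Bochner_Integration.integral_add[OF i1 i1])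
      finally show "- ?I (h1 + h2)
        = - ?I h1 + - ?I h2" by simp
    next
      fix c h
      have "?I (c *\<^sub>R h) = (\<integral>y. c *\<^sub>R (wt x y *\<^sub>R (B h y *\<^sub>R g y)) \<partial>lborel)"
        by (intro Bochner_Integration.integral_cong) (simp_all add: B.scaleR_left)
      also have "\<dots> = c *\<^sub>R ?I h" by (rule integral_scaleR_right)
      finally show "- ?I (c *\<^sub>R h) = c *\<^sub>R - ?I h"
        by (simp only: scaleR_minus_right)
    qed
    then show "bounded_linear (\<lambda>h. - ?I h)"
      by (simp add: linear_conv_bounded_linear)
    fix h :: 'a assume h: "norm h < d"
    have xh: "x + h \<in> C" using h d0 by (intro subsetD[OF d0(2)]) (simp add: dist_norm d_def)
    let ?R = "\<lambda>y. (wt (x + h) y *\<^sub>R g y - wt x y *\<^sub>R g y) + wt x y *\<^sub>R (B h y *\<^sub>R g y)"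
    have r: "(\<integral>y. wt (x + h) y *\<^sub>R g y \<partial>lborel) - (\<integral>y. wt x y *\<^sub>R g y \<partial>lborel) - - ?I h
      = (\<integral>y. ?R y \<partial>lborel)"
      using Bochner_Integration.integral_add[OF Bochner_Integration.integrable_diff[OF
            wt_integrable[OF xh g b] wt_integrable[OF x g b]] i1[of h]]
        Bochner_Integration.integral_diff[OF wt_integrable[OF xh g b] wt_integrable[OF x g b]]
      by (simp only: diff_minus_eq_add)
    have hb: "norm h * \<beta> \<le> m / 2" using h beta by (simp add: d_def field_simps)
    have le: "norm (?R y)
      \<le> (\<beta>\<^sup>2 * M * (norm h)\<^sup>2) * (norm y ^ (k + 2) * exp (- (m / 2) * norm y))" for y
    proof (cases "y \<in> C")
      case True
      define s where "s = B h y"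
      have sb: "\<bar>s\<bar> \<le> norm h * \<beta> * norm y" using beta(2)[of h y] by (simp add: s_def mult_ac)
      also have "\<dots> \<le> m / 2 * norm y" using hb by (rule mult_right_mono) simp
      finally have sm: "\<bar>s\<bar> \<le> m / 2 * norm y" .
      have w: "wt x y \<le> exp (- m * norm y)" using m(2)[of y] C_sub_K[OF True] True by (simp add: wt_def)
      have e: "wt (x + h) y = wt x y * exp (- s)" using True by (simp add: wt_def s_def B.add_left exp_add[symmetric])
      have "?R y
        = (wt x y * (exp (- s) - 1 + s)) *\<^sub>R g y"
        unfolding e s_def[symmetric] by (simp add: algebra_simps)
      then have "norm (?R y)
        = wt x y * \<bar>exp (- s) - 1 + s\<bar> * norm (g y)"
        using wt_nonneg[of x y] by (simp add: abs_mult)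
      also have "\<dots> \<le> exp (- m * norm y) * (s\<^sup>2 * exp \<bar>s\<bar>) * (M * norm y ^ k)"
        using w wt_nonneg[of x y] exp_taylor_bound[of s] b[of y] by (intro mult_mono) auto
      also have "\<dots> \<le> exp (- m * norm y) * ((norm h * \<beta> * norm y)\<^sup>2 * exp (m / 2 * norm y)) * (M * norm y ^ k)"
      proof -
        have "s\<^sup>2 \<le> (norm h * \<beta> * norm y)\<^sup>2" using power_mono[OF sb, of 2] by simp
        moreover have "0 \<le> M * norm y ^ k" using b[of y] norm_ge_zero order_trans by blast
        ultimately show ?thesis using sm by (intro mult_right_mono mult_left_mono mult_mono) auto
      qed
      also have "\<dots> = (\<beta>\<^sup>2 * M * (norm h)\<^sup>2) * (norm y ^ (k + 2) * (exp (- m * norm y) * exp (m / 2 * norm y)))"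
        by (simp add: power_mult_distrib power_add power2_eq_square mult_ac)
      also have "exp (- m * norm y) * exp (m / 2 * norm y) = exp (- (m / 2) * norm y)"
        by (simp add: algebra_simps flip: exp_add)
      finally show ?thesis .
    next
      case False
      obtain i :: 'a where "i \<in> Basis" using nonempty_Basis by blast
      then have "norm (g i) \<le> M" using b[of i] by simp
      then have "0 \<le> M" using norm_ge_zero order_trans by blast
      moreover have "wt (x + h) y = 0" "wt x y = 0" using False by (simp_all add: wt_def)
      ultimately show ?thesis by simp
    qed
    have "norm (\<integral>y. ?R y \<partial>lborel)
      \<le> (\<integral>y. norm (?R y) \<partial>lborel)"
      by (rule integral_norm_bound)
    also have "\<dots> \<le> (\<integral>y. (\<beta>\<^sup>2 * M * (norm h)\<^sup>2) * (norm (y::'a) ^ (k + 2) * exp (- (m / 2) * norm y)) \<partial>lborel)"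
    proof (rule Bochner_Integration.integral_mono)
      show "integrable lborel (\<lambda>y. norm (?R y))"
        by (intro integrable_norm Bochner_Integration.integrable_add Bochner_Integration.integrable_diff
            i1 wt_integrable[OF x g b] wt_integrable[OF xh g b])
      show "integrable lborel (\<lambda>y::'a. (\<beta>\<^sup>2 * M * (norm h)\<^sup>2) * (norm y ^ (k + 2) * exp (- (m / 2) * norm y)))"
        by (intro integrable_mult_right iJ)
    qed (rule le)
    also have "\<dots> = (\<beta>\<^sup>2 * M * (norm h)\<^sup>2) * J" unfolding J_def by (rule integral_mult_right_zero)
    also have "\<dots> = (\<beta>\<^sup>2 * M * J) * (norm h)\<^sup>2" by (simp only: mult_ac)
    finally show "norm ((\<integral>y. wt (x + h) y *\<^sub>R g y \<partial>lborel) - (\<integral>y. wt x y *\<^sub>R g y \<partial>lborel) - - ?I h)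
      \<le> (\<beta>\<^sup>2 * M * J) * (norm h)\<^sup>2" unfolding r .
  qed
qed

text \<open>The Koecher-Vinberg characteristic function of the cone. The factor \<open>1\<close>
  presents it as an instance of the integrals in \<open>wt_integrable\<close> and
  \<open>wt_derivative\<close>.\<close>

definition psi :: "'a \<Rightarrow> real" where "psi x = (\<integral>y. wt x y *\<^sub>R 1 \<partial>lborel)"

definition moment :: "'a \<Rightarrow> 'a" where "moment x = (\<integral>y. wt x y *\<^sub>R y \<partial>lborel)"

definition star :: "'a \<Rightarrow> 'a" where "star x = (1 / psi x) *\<^sub>R moment x"

lemma psi_integrable: "x \<in> C \<Longrightarrow> integrable lborel (\<lambda>y. wt x y *\<^sub>R (1::real))"
  by (rule wt_integrable[where M = 1 and k = 0]) auto

lemma moment_integrable: "x \<in> C \<Longrightarrow> integrable lborel (\<lambda>y. wt x y *\<^sub>R y)"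
  by (rule wt_integrable[where M = 1 and k = 1]) auto

lemma B_wt_integrable: assumes "x \<in> C" shows "integrable lborel (\<lambda>y. wt x y * B h y)"
  using integrable_bounded_linear[OF B.bounded_linear_right moment_integrable[OF assms], of h]
  by (simp add: B.scaleR_right)

lemma B_moment: assumes "x \<in> C" shows "B h (moment x) = (\<integral>y. wt x y * B h y \<partial>lborel)"
  using integral_bounded_linear[OF B.bounded_linear_right moment_integrable[OF assms], of h]
  by (simp add: moment_def B.scaleR_right)

lemma psi_pos: assumes "x \<in> C" shows "psi x > 0"
  unfolding psi_def
  by (rule integral_pos_on_open[OF psi_integrable[OF assms] _ C_open C_nonempty]) (auto simp: wt_nonneg wt_pos)

lemma psi_derivative: assumes "x \<in> C" shows "(psi has_derivative (\<lambda>h. - B h (moment x))) (at x)"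
  using wt_derivative[OF assms, of "\<lambda>_. 1 :: real" 1 0] B_moment[OF assms] by (simp add: psi_def[abs_def])

lemma moment_derivative: assumes "x \<in> C"
  shows "(moment has_derivative (\<lambda>h. - (\<integral>y. wt x y *\<^sub>R (B h y *\<^sub>R y) \<partial>lborel))) (at x)"
  using wt_derivative[OF assms, of "\<lambda>y. y" 1 1] by (simp add: moment_def[abs_def])

lemma star_in: assumes x: "x \<in> C" shows "star x \<in> C"
proof (subst C_dual, rule CollectI, rule ballI)
  fix z assume z: "z \<in> K - {0}"
  have "0 < (\<integral>y. wt x y * B z y \<partial>lborel)"
  proof (rule integral_pos_on_open[OF B_wt_integrable[OF x] _ C_open C_nonempty])
    fix y
    show "y \<in> C \<Longrightarrow> 0 < wt x y * B z y" using z C_B_pos[of y z] wt_pos[of y x] B_sym[of y z] by simp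
    then show "0 \<le> wt x y * B z y" by (cases "y \<in> C") (auto simp: wt_def)
  qed
  then show "0 < B (star x) z"
    using psi_pos[OF x] B_moment[OF x, of z] B_sym[of "moment x" z] by (simp add: star_def B.scaleR_left)
qed

text \<open>Substitution by \<open>M = adj (inv A)\<close>, which preserves the cone and satisfies
  \<open>B (A x) (M y) = B x y\<close>; the Jacobian factor \<open>c\<close> cancels between moment
  and mass.\<close>

lemma star_aut: assumes x: "x \<in> C" and A: "aut A" shows "star (A x) = adj (inv A) (star x)"
proof -
  define M where "M = adj (inv A)"
  have M: "aut M" unfolding M_def by (rule adj_aut(1)[OF aut_inv[OF A]])
  note lM = aut_linear[OF M]
  obtain c where c: "c > 0" "distr lborel borel M = density lborel (\<lambda>_. ennreal c)"
    using distr_lborel_linear[OF lM aut_bij[OF M]] by blast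
  have "M y \<in> C \<longleftrightarrow> y \<in> C" for y using aut_in[OF M] aut_in[OF aut_inv[OF M], of "M y"] aut_inv_left[OF M] by auto
  moreover have "B (A x) (M y) = B x y" for y
    using adj_works[OF aut_inv_linear[OF A], of "A x" y] aut_inv_left[OF A] by (simp add: M_def)
  ultimately have w: "wt (A x) (M y) = wt x y" for y by (simp add: wt_def indicator_def)
  have "psi x = c * psi (A x)"
    using integral_lborel_linear[OF lM c, of "\<lambda>y. wt (A x) y *\<^sub>R (1::real)"] by (simp add: psi_def w)
  moreover have "M (moment x) = c *\<^sub>R moment (A x)"
  proof -
    have "(\<integral>y. wt (A x) (M y) *\<^sub>R M y \<partial>lborel) = c *\<^sub>R moment (A x)"
      unfolding moment_def by (rule integral_lborel_linear[OF lM c]) measurable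
    moreover have "M (moment x) = (\<integral>y. wt x y *\<^sub>R M y \<partial>lborel)"
    proof -
      have "bounded_linear M" using lM by (simp add: linear_conv_bounded_linear)
      from integral_bounded_linear[OF this moment_integrable[OF x]] show ?thesis
        by (simp add: moment_def linear_scale[OF lM])
    qed
    ultimately show ?thesis by (simp add: w)
  qed
  ultimately show ?thesis
    unfolding star_def M_def[symmetric] using c(1) by (simp add: linear_scale[OF lM])
qed

end

section \<open>Behaviour at the boundary and the fixed point\<close>

lemma integral_lborel_translate:
  fixes f :: "'a::euclidean_space \<Rightarrow> real"
  assumes f: "integrable lborel f"
  shows "integrable lborel (\<lambda>y. f (a + y))" "(\<integral>y. f (a + y) \<partial>lborel) = (\<integral>y. f y \<partial>lborel)"
proof -
  have m: "f \<in> borel_measurable borel" using f by (simp add: borel_measurable_integrable)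
  have a: "(+) a \<in> measurable lborel borel" by simp
  show "integrable lborel (\<lambda>y. f (a + y))"
    using integrable_distr_eq[OF a m] f lborel_distr_plus[of a] by simp
  show "(\<integral>y. f (a + y) \<partial>lborel) = (\<integral>y. f y \<partial>lborel)"
    using integral_distr[OF a m] lborel_distr_plus[of a] by simp
qed

context symmetric_cone_form
begin

text \<open>If \<open>psi\<close> stayed bounded near a boundary point \<open>x\<close>, then \<open>wt x\<close> would be integrable by Fatou;
  but it is invariant under translation by a vector \<open>z\<close> of the cone with \<open>B x z = 0\<close>, which maps
  \<open>C\<close> into a strictly smaller set.\<close>

lemma psi_bounded_limit:
  assumes u: "\<And>n. u n \<in> C" and lim: "u \<longlonglongrightarrow> x" and b: "\<And>n. psi (u n) \<le> b"
  shows "x \<in> C"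
proof (rule ccontr)
  assume xC: "x \<notin> C"
  have xK: "x \<in> K" using K_limit[OF C_sub_K[OF u] lim] .
  obtain z where z: "z \<in> K" "z \<noteq> 0" "\<not> B x z > 0" using xC by (subst (asm) C_dual) auto
  then have Bz: "B x z = 0" using K_B_nonneg[OF xK] by force
  have eq: "(\<integral>\<^sup>+y. ennreal (wt (u n) y) \<partial>lborel) = ennreal (psi (u n))" for n
    using nn_integral_eq_integral[OF psi_integrable[OF u]] wt_nonneg by (simp add: psi_def)
  have "(\<lambda>n. wt (u n) y) \<longlonglongrightarrow> wt x y" for y
    unfolding wt_def by (intro tendsto_intros B.tendsto lim)
  then have "(\<lambda>n. ennreal (wt (u n) y)) \<longlonglongrightarrow> ennreal (wt x y)" for y by (rule tendsto_ennrealI)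
  then have li: "liminf (\<lambda>n. ennreal (wt (u n) y)) = ennreal (wt x y)" for y
    by (intro lim_imp_Liminf) auto
  have "(\<integral>\<^sup>+y. ennreal (wt x y) \<partial>lborel) \<le> liminf (\<lambda>n. \<integral>\<^sup>+y. ennreal (wt (u n) y) \<partial>lborel)"
    using nn_integral_liminf[of "\<lambda>n y. ennreal (wt (u n) y)" lborel] by (simp add: li)
  also have "\<dots> \<le> liminf (\<lambda>n. ennreal b)"
    by (intro Liminf_mono always_eventually allI) (simp add: eq ennreal_leI b)
  also have "\<dots> = ennreal b" by (simp add: Liminf_const)
  finally have "(\<integral>\<^sup>+y. ennreal (norm (wt x y)) \<partial>lborel) < \<infinity>"
    using wt_nonneg by (simp add: order_le_less_trans[OF _ ennreal_less_top])
  then have I: "integrable lborel (wt x)" by (intro integrableI_bounded) simp_all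
  define D where "D y = wt x y - wt x (- z + y)" for y
  have iD: "integrable lborel D" unfolding D_def[abs_def]
    using I integral_lborel_translate(1)[OF I, of "- z"] by simp
  have "(\<integral>y. D y \<partial>lborel) = 0"
    unfolding D_def using I integral_lborel_translate[OF I, of "- z"] by simp
  moreover have "0 < (\<integral>y. D y \<partial>lborel)"
  proof (rule integral_pos_on_open[OF iD])
    \<comment> \<open>Points of the cone whose translate by \<open>- z\<close> has left the closed
      cone; there the subtracted weight vanishes and \<open>D\<close> is positive.\<close>
    let ?U = "C \<inter> (\<lambda>y. - z + y) -` (- K)"
    show "0 \<le> D y" for y
    proof (cases "- z + y \<in> C")
      case True
      then have "y \<in> C" using C_add_K[OF True z(1)] by simp
      then show ?thesis using True Bz by (simp add: D_def wt_def B.diff_right)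
    next
      case False
      then show ?thesis by (simp add: D_def wt_def)
    qed
    show "open ?U" by (intro open_Int C_open continuous_open_vimage) (auto intro!: continuous_intros)
    show "?U \<noteq> {}"
    proof
      assume e: "?U = {}"
      obtain c where c: "c \<in> C" using C_nonempty by blast
      have "- z + d *\<^sub>R c \<in> K" if "d > 0" for d using e C_scale[OF c that] by blast
      then have "- z \<in> K" by (rule K_archimedean)
      then show False using K_pointed z by blast
    qed
    show "0 < D y" if y: "y \<in> ?U" for y
    proof -
      have "- z + y \<notin> C" using y C_sub_K by blast
      then show ?thesis using y by (simp add: D_def wt_def)
    qed
  qed
  ultimately show False by simp
qed

text \<open>Only the part of the cone in the unit ball is integrated. The decay allowed is
  exponential in \<open>norm x\<close>, which the factor \<open>exp (B x x / 2)\<close> of the fixed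
  point argument outgrows.\<close>

lemma psi_lower_bound: "\<exists>v>0. \<exists>\<beta>>0. \<forall>x\<in>C. v * exp (- \<beta> * norm x) \<le> psi x"
proof -
  obtain \<beta> where beta: "\<beta> > 0" "\<And>x y. norm (B x y) \<le> norm x * norm y * \<beta>" using B.pos_bounded by blast
  define S where "S = C \<inter> ball 0 1"
  define v where "v = (\<integral>y. indicator S y \<partial>lborel :: real)"
  have oS: "open S" unfolding S_def by (intro open_Int C_open open_ball)
  obtain c where c: "c \<in> C" using C_nonempty by blast
  have "(1 / (norm c + 1)) *\<^sub>R c \<in> S"
    using C_scale[OF c, of "1 / (norm c + 1)"] by (simp add: S_def add_nonneg_pos)
  then have neS: "S \<noteq> {}" by blast
  have "emeasure lborel S < \<infinity>"
    by (rule emeasure_bounded_finite) (simp add: S_def bounded_Int)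
  then have iS: "integrable lborel (indicator S :: 'a \<Rightarrow> real)"
    using oS by (simp add: integrable_real_indicator)
  have v: "v > 0" unfolding v_def by (rule integral_pos_on_open[OF iS _ oS neS]) auto
  have "v * exp (- \<beta> * norm x) \<le> psi x" if x: "x \<in> C" for x
  proof -
    have "(\<integral>y. indicator S y * exp (- \<beta> * norm x) \<partial>lborel) \<le> (\<integral>y. wt x y *\<^sub>R 1 \<partial>lborel)"
    proof (rule Bochner_Integration.integral_mono[OF _ psi_integrable[OF x]])
      show "integrable lborel (\<lambda>y. indicator S y * exp (- \<beta> * norm x))" using iS by simp
      fix y
      show "indicator S y * exp (- \<beta> * norm x) \<le> wt x y *\<^sub>R 1"
      proof (cases "y \<in> S")
        case True
        have "B x y \<le> norm x * norm y * \<beta>" using beta(2)[of x y] by simp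
        also have "\<dots> \<le> norm x * 1 * \<beta>"
          using True beta(1) by (intro mult_right_mono mult_left_mono) (auto simp: S_def)
        finally show ?thesis using True by (simp add: wt_def S_def mult.commute)
      next
        case False
        then show ?thesis using wt_nonneg by simp
      qed
    qed
    then show ?thesis by (simp add: v_def psi_def)
  qed
  then show ?thesis using v beta(1) by blast
qed

lemma B_coercive: "\<exists>\<gamma>>0. \<forall>x. \<gamma> * (norm x)\<^sup>2 \<le> B x x"
proof -
  have "continuous_on (sphere 0 1) (\<lambda>x. B x x)" by (intro B.continuous_on continuous_intros)
  moreover have "sphere (0::'a) 1 \<noteq> {}" by simp
  ultimately obtain s where s: "s \<in> sphere 0 1" "\<And>y. y \<in> sphere 0 1 \<Longrightarrow> B s s \<le> B y y"
    using continuous_attains_inf[OF compact_sphere] by blast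
  have "s \<noteq> 0" using s by auto
  have "B s s * (norm x)\<^sup>2 \<le> B x x" for x
  proof (cases "x = 0")
    case False
    then have "B s s \<le> B ((1 / norm x) *\<^sub>R x) ((1 / norm x) *\<^sub>R x)" by (intro s) simp
    then show ?thesis using False by (simp add: B.scaleR_left B.scaleR_right field_simps power2_eq_square)
  qed (simp add: B.zero_left)
  then show ?thesis using B_pos[OF \<open>s \<noteq> 0\<close>] by blast
qed

text \<open>Critical points of \<open>psi x * exp (B x x / 2)\<close> are fixed points of \<open>star\<close>.\<close>

lemma star_fixed_point: "\<exists>e\<in>C. star e = e"
proof -
  define P where "P x = psi x * exp (B x x / 2)" for x
  have Pd: "(P has_derivative (\<lambda>h. exp (B x x / 2) * (psi x * B h x - B h (moment x)))) (at x)" if x: "x \<in> C" for x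
  proof -
    have "((\<lambda>x. B x x / 2) has_derivative (\<lambda>h. (B x h + B h x) / 2)) (at x)"
      by (rule bounded_linear.has_derivative[OF bounded_linear_divide B.FDERIV[OF has_derivative_ident has_derivative_ident]])
    then have 1: "((\<lambda>x. B x x / 2) has_derivative (\<lambda>h. B h x)) (at x)" using B_sym[of x] by simp
    have "(P has_derivative (\<lambda>h. psi x * (B h x * exp (B x x / 2)) + - B h (moment x) * exp (B x x / 2))) (at x)"
      unfolding P_def[abs_def] by (intro has_derivative_mult psi_derivative[OF x] has_derivative_exp 1)
    then show ?thesis by (simp add: algebra_simps)
  qed
  have Pc: "continuous_on C P"
    using Pd has_derivative_continuous continuous_at_imp_continuous_on by blast
  obtain x1 where x1: "x1 \<in> C" using C_nonempty by blast
  \<comment> \<open>A sublevel set: bounded since \<open>exp (B x x / 2)\<close> outgrows the decay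
    of \<open>psi\<close>, and closed in the whole space since \<open>psi\<close> cannot stay
    bounded along a sequence in \<open>C\<close> tending to a boundary point.\<close>
  define Z where "Z = {x\<in>C. P x \<le> P x1}"
  obtain v \<beta> where vb: "v > 0" "\<beta> > 0" "\<And>x. x \<in> C \<Longrightarrow> v * exp (- \<beta> * norm x) \<le> psi x"
    using psi_lower_bound by blast
  obtain \<gamma> where gam: "\<gamma> > 0" "\<And>x. \<gamma> * (norm x)\<^sup>2 \<le> B x x" using B_coercive by blast
  have P1: "P x1 > 0" using psi_pos[OF x1] by (simp add: P_def)
  define q where "q = \<bar>ln (P x1 / v)\<bar>"
  have bZ: "norm x \<le> max 1 (2 * (\<beta> + q) / \<gamma>)" if x: "x \<in> Z" for x
  proof (cases "norm x \<le> 1")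
    case False
    define t where "t = norm x"
    have t: "t > 1" using False by (simp add: t_def)
    have xC: "x \<in> C" using x by (simp add: Z_def)
    have "v * exp (\<gamma> * t\<^sup>2 / 2 - \<beta> * t) = v * exp (- \<beta> * t) * exp (\<gamma> * t\<^sup>2 / 2)"
    proof -
      have "\<gamma> * t\<^sup>2 / 2 - \<beta> * t = - \<beta> * t + \<gamma> * t\<^sup>2 / 2" by simp
      then show ?thesis by (simp only: exp_add mult.assoc)
    qed
    also have "\<dots> \<le> psi x * exp (B x x / 2)"
      using vb(3)[OF xC] gam(2)[of x] psi_pos[OF xC] by (intro mult_mono) (auto simp: t_def)
    also have "\<dots> \<le> P x1" using x by (simp add: Z_def P_def)
    finally have "exp (\<gamma> * t\<^sup>2 / 2 - \<beta> * t) \<le> P x1 / v" using vb(1) by (simp add: field_simps)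
    then have "\<gamma> * t\<^sup>2 / 2 - \<beta> * t \<le> ln (P x1 / v)" using P1 vb(1) by (simp add: ln_ge_iff)
    then have "\<gamma> * t\<^sup>2 / 2 - \<beta> * t \<le> q" by (simp add: q_def)
    also have "q \<le> q * t" using t by (simp add: q_def mult_le_cancel_left1)
    finally have "(\<gamma> * t / 2) * t \<le> (\<beta> + q) * t" by (simp add: power2_eq_square algebra_simps)
    then have "\<gamma> * t / 2 \<le> \<beta> + q" using t by simp
    then have "t \<le> 2 * (\<beta> + q) / \<gamma>" using gam(1) by (simp add: field_simps)
    then show ?thesis by (simp add: t_def)
  qed simp
  have "closed Z" unfolding closed_sequential_limits
  proof (intro allI impI)
    fix u l assume u: "(\<forall>n. u n \<in> Z) \<and> u \<longlonglongrightarrow> l"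
    then have uC: "u n \<in> C" and uP: "P (u n) \<le> P x1" for n by (auto simp: Z_def)
    have "psi (u n) \<le> P x1" for n
    proof -
      have "1 \<le> exp (B (u n) (u n) / 2)" using K_B_nonneg[of "u n" "u n"] C_sub_K[OF uC] by simp
      then have "psi (u n) * 1 \<le> P (u n)" unfolding P_def using psi_pos[OF uC[of n]] by (intro mult_left_mono) auto
      then show ?thesis using uP[of n] by simp
    qed
    then have l: "l \<in> C" using psi_bounded_limit[of u l "P x1"] u uC by blast
    then have "isCont P l" using Pd has_derivative_continuous by blast
    then have "(\<lambda>n. P (u n)) \<longlonglongrightarrow> P l" using u isCont_tendsto_compose by blast
    then have "P l \<le> P x1" using LIMSEQ_le_const2 uP by blast
    then show "l \<in> Z" using l by (simp add: Z_def)
  qed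
  moreover have "bounded Z" using bZ by (auto simp: bounded_iff)
  ultimately have cZ: "compact Z" by (simp add: compact_eq_bounded_closed)
  have neZ: "Z \<noteq> {}" using x1 by (auto simp: Z_def)
  have PZ: "continuous_on Z P" by (rule continuous_on_subset[OF Pc]) (auto simp: Z_def)
  obtain e where e: "e \<in> Z" "\<forall>x\<in>Z. P e \<le> P x" using continuous_attains_inf[OF cZ neZ PZ] by blast
  have eC: "e \<in> C" using e by (simp add: Z_def)
  have "P e \<le> P x" if "x \<in> C" for x using e that by (cases "P x \<le> P x1") (auto simp: Z_def)
  then have "(\<lambda>h. exp (B e e / 2) * (psi e * B h e - B h (moment e))) = (\<lambda>h. 0)"
    using differential_zero_maxmin[OF eC C_open Pd[OF eC]] by blast
  then have "psi e * B h e = B h (moment e)" for h by (simp add: fun_eq_iff)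
  then have "psi e *\<^sub>R e = moment e" by (intro B_eqI) (simp add: B.scaleR_right)
  then have "star e = e" using psi_pos[OF eC] by (simp add: star_def flip: \<open>psi e *\<^sub>R e = moment e\<close>)
  then show ?thesis using eC by blast
qed

text \<open>With \<open>x = A e\<close> and \<open>star e = e\<close>, equivariance gives
  \<open>star x = adj (inv A) e\<close>; applied again, to this automorphism, it gives back
  \<open>A e\<close>.\<close>

lemma star_involution: assumes x: "x \<in> C" shows "star (star x) = x"
proof -
  obtain e where e: "e \<in> C" "star e = e" using star_fixed_point by blast
  obtain A where A: "aut A" "A e = x" using transitive e(1) x by blast
  note iA = aut_inv[OF A(1)]
  have "inv (adj (inv A)) = adj A" by (rule inv_equality) (simp_all add: adj_aut(2,3)[OF A(1)])
  then have "star (adj (inv A) e) = adj (adj A) (star e)"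
    using star_aut[OF e(1) adj_aut(1)[OF iA]] by simp
  then show ?thesis using star_aut[OF e(1) A(1)] e(2) A adj_aut(4)[OF A(1)] by simp
qed

text \<open>The derivative \<open>D\<close> of \<open>star\<close> at the fixed point is minus a covariance form, hence negative
  semidefinite, and squares to the identity.\<close>

lemma star_derivative_fixed:
  assumes e: "e \<in> C" "star e = e" shows "(star has_derivative uminus) (at e)"
proof -
  define S where "S h = (\<integral>y. wt e y *\<^sub>R (B h y *\<^sub>R y) \<partial>lborel)" for h
  have pe: "psi e > 0" using psi_pos e by blast
  have "moment e = psi e *\<^sub>R star e" using pe by (simp add: star_def)
  then have me: "moment e = psi e *\<^sub>R e" by (simp only: e(2))
  define D where "D h = inverse (psi e) *\<^sub>R (- S h) + (- (inverse (psi e) * - B h (moment e) * inverse (psi e))) *\<^sub>R moment e" for h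
  have der: "(star has_derivative D) (at e)"
  proof -
    have "((\<lambda>x. inverse (psi x) *\<^sub>R moment x) has_derivative D) (at e)"
      unfolding D_def[abs_def] S_def using pe
      by (intro has_derivative_scaleR Deriv.has_derivative_inverse[OF _ psi_derivative[OF e(1)]] moment_derivative[OF e(1)]) simp
    then show ?thesis by (simp add: star_def[abs_def] inverse_eq_divide)
  qed
  have lD: "linear D" using der by (rule has_derivative_linear)
  obtain \<beta> where beta: "\<beta> > 0" "\<And>x y. norm (B x y) \<le> norm x * norm y * \<beta>" using B.pos_bounded by blast
  \<comment> \<open>For the normalised weight this is minus the variance of \<open>B h\<close>,
    whose mean is \<open>B h e\<close> because \<open>e\<close> is its own centroid.\<close>
  have neg: "B (D h) h \<le> 0" for h
  proof -
    have i2: "integrable lborel (\<lambda>y. wt e y *\<^sub>R (B h y *\<^sub>R y))"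
    proof (rule wt_integrable[OF e(1)])
      show "norm (B h y *\<^sub>R y) \<le> (norm h * \<beta>) * norm y ^ 2" for y
        using mult_right_mono[OF beta(2)[of h y] norm_ge_zero[of y]] by (simp add: power2_eq_square mult_ac)
    qed measurable
    have BS: "B h (S h) = (\<integral>y. wt e y * (B h y)\<^sup>2 \<partial>lborel)"
      using integral_bounded_linear[OF B.bounded_linear_right i2, of h]
      by (simp add: S_def B.scaleR_right power2_eq_square mult.assoc)
    have i3: "integrable lborel (\<lambda>y. wt e y * (B h y)\<^sup>2)"
      using integrable_bounded_linear[OF B.bounded_linear_right i2, of h]
      by (simp add: B.scaleR_right power2_eq_square mult.assoc)
    have i1: "integrable lborel (\<lambda>y. wt e y * B h y)" by (rule B_wt_integrable[OF e(1)])
    have i0: "integrable lborel (wt e)" using psi_integrable[OF e(1)] by simp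
    have "0 \<le> (\<integral>y. wt e y * (B h y - B h e)\<^sup>2 \<partial>lborel)"
      by (rule Bochner_Integration.integral_nonneg) (simp add: wt_nonneg)
    also have "\<dots> = (\<integral>y. (wt e y * (B h y)\<^sup>2 - (2 * B h e) * (wt e y * B h y)) + (B h e)\<^sup>2 * wt e y \<partial>lborel)"
      by (intro Bochner_Integration.integral_cong) (simp_all add: power2_eq_square algebra_simps)
    also have "\<dots> = B h (S h) - (2 * B h e) * B h (moment e) + (B h e)\<^sup>2 * psi e"
      using i0 i1 i3 by (simp add: BS B_moment[OF e(1)] psi_def)
    also have "\<dots> = B h (S h) - psi e * (B h e)\<^sup>2"
      by (simp add: me B.scaleR_right power2_eq_square)
    finally have "psi e * (B h e)\<^sup>2 \<le> B h (S h)" by simp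
    then have "(B h e)\<^sup>2 \<le> B h (S h) / psi e" using pe by (simp add: field_simps)
    moreover have "B h (D h) = - (B h (S h) / psi e) + (B h e)\<^sup>2"
    proof -
      have "D h = B h e *\<^sub>R e - inverse (psi e) *\<^sub>R S h"
        using pe by (simp add: D_def me B.scaleR_right)
      then show ?thesis by (simp add: B.diff_right B.scaleR_right power2_eq_square divide_inverse mult.commute)
    qed
    ultimately show ?thesis using B_sym[of h "D h"] by simp
  qed
  have "((\<lambda>x. star (star x)) has_derivative (\<lambda>h. D (D h))) (at e)"
    using has_derivative_compose[OF der, of star D] der e(2) by simp
  moreover have "((\<lambda>x. star (star x)) has_derivative (\<lambda>h. h)) (at e)"
    by (rule has_derivative_transform_within_open[OF has_derivative_ident C_open e(1)]) (simp add: star_involution)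
  ultimately have DD: "D (D h) = h" for h using has_derivative_unique by metis
  have "D h = - h" for h
  proof -
    \<comment> \<open>\<open>h + D h\<close> is fixed by \<open>D\<close>, and negative
      semidefiniteness allows no nonzero fixed vector.\<close>
    have "D (h + D h) = h + D h" using DD linear_add[OF lD] by (simp add: add.commute)
    then have "B (h + D h) (h + D h) \<le> 0" using neg[of "h + D h"] by simp
    then have "h + D h = 0" using B_pos[of "h + D h"] by force
    then show ?thesis by (simp add: eq_neg_iff_add_eq_0 add.commute)
  qed
  then have "D = uminus" by auto
  then show ?thesis using der by simp
qed

lemma star_derivative:
  assumes x: "x \<in> C" shows "\<exists>T. aut T \<and> (star has_derivative (\<lambda>h. - T h)) (at x)"
proof -
  obtain e where e: "e \<in> C" "star e = e" using star_fixed_point by blast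
  obtain A where A: "aut A" "A e = x" using transitive e(1) x by blast
  note iA = aut_inv[OF A(1)]
  define M where "M = adj (inv A)"
  have M: "aut M" unfolding M_def by (rule adj_aut(1)[OF iA])
  have blM: "bounded_linear M" and bli: "bounded_linear (inv A)"
    using aut_linear[OF M] aut_linear[OF iA] by (simp_all add: linear_conv_bounded_linear)
  have ie: "inv A x = e" using A aut_inv_left by blast
  have "(star has_derivative uminus) (at (inv A x))" unfolding ie by (rule star_derivative_fixed[OF e])
  then have "((\<lambda>z. star (inv A z)) has_derivative (\<lambda>h. - inv A h)) (at x)"
    using has_derivative_compose[OF bounded_linear_imp_has_derivative[OF bli]] by blast
  from bounded_linear.has_derivative[OF blM this]
  have "((\<lambda>z. M (star (inv A z))) has_derivative (\<lambda>h. - M (inv A h))) (at x)"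
    by (simp add: linear_neg[OF aut_linear[OF M]])
  then have "(star has_derivative (\<lambda>h. - M (inv A h))) (at x)"
  proof (rule has_derivative_transform_within_open[OF _ C_open x])
    fix z assume "z \<in> C"
    then have "inv A z \<in> C" using aut_in[OF iA] by blast
    then show "M (star (inv A z)) = star z"
      using star_aut[OF _ A(1), of "inv A z"] aut_inv_right[OF A(1)] by (simp add: M_def)
  qed
  then show ?thesis using aut_comp[OF M iA] by (intro exI[of _ "M \<circ> inv A"]) (simp add: o_def)
qed

text \<open>The segment from \<open>x\<close> to \<open>y\<close> stays in \<open>C\<close>, and
  along it every functional of the dual cone has derivative
  \<open>- (f \<bullet> T (y - x)) \<le> 0\<close>.\<close>

lemma star_antitone:
  assumes x: "x \<in> C" "y \<in> C" "y - x \<in> K" shows "star x - star y \<in> K"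
  unfolding bipolar
proof
  fix f assume f: "f \<in> Kd"
  define g where "g t = f \<bullet> star (x + t *\<^sub>R (y - x))" for t
  have "g 1 \<le> g 0"
  proof (rule DERIV_nonpos_imp_nonincreasing[of 0 1 g])
    fix t :: real assume t: "0 \<le> t" "t \<le> 1"
    have "x + t *\<^sub>R (y - x) \<in> C" using C_add_K[OF x(1) K_scale[OF x(3) t(1)]] .
    then obtain T where T: "aut T" "(star has_derivative (\<lambda>h. - T h)) (at (x + t *\<^sub>R (y - x)))"
      using star_derivative by blast
    have "((\<lambda>t. x + t *\<^sub>R (y - x)) has_derivative (\<lambda>s. s *\<^sub>R (y - x))) (at t)"
      by (auto intro!: derivative_eq_intros)
    from has_derivative_compose[OF this T(2)]
    have "((\<lambda>t. star (x + t *\<^sub>R (y - x))) has_derivative (\<lambda>s. - (s *\<^sub>R T (y - x)))) (at t)"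
      by (simp add: linear_scale[OF aut_linear[OF T(1)]])
    from has_derivative_inner_right[OF this, of f]
    have "(g has_derivative (\<lambda>s. - (f \<bullet> T (y - x)) * s)) (at t)"
      by (simp add: g_def[abs_def] mult.commute)
    then have "DERIV g t :> - (f \<bullet> T (y - x))" unfolding has_field_derivative_def .
    moreover have "f \<bullet> T (y - x) \<ge> 0" using Kd_nonneg[OF f] aut_K[OF T(1)] x(3) by blast
    ultimately show "\<exists>d. DERIV g t :> d \<and> d \<le> 0" by (intro exI[of _ "- (f \<bullet> T (y - x))"]) simp
  qed simp
  then show "0 \<le> f \<bullet> (star x - star y)" by (simp add: g_def inner_diff_right)
qed

text \<open>Dilations are automorphisms and self-adjoint for \<open>B\<close>, so this is an
  instance of equivariance.\<close>

lemma star_scale: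
  assumes x: "x \<in> C" and t: "t > 0" shows "star (t *\<^sub>R x) = (1 / t) *\<^sub>R star x"
proof -
  define A where "A = (\<lambda>x::'a. t *\<^sub>R x)"
  have lin: "linear A" unfolding A_def by (simp add: linear_scale_self)
  have inv: "inv A = (\<lambda>x. (1 / t) *\<^sub>R x)"
    by (rule inv_equality) (use t in \<open>simp_all add: A_def\<close>)
  have bij: "bij A" by (rule o_bij[of "\<lambda>x. (1 / t) *\<^sub>R x"]) (use t in \<open>auto simp: A_def o_def\<close>)
  have "A ` C = C"
  proof
    show "A ` C \<subseteq> C" using C_scale t by (auto simp: A_def)
    show "C \<subseteq> A ` C"
    proof
      fix c assume "c \<in> C"
      then have "(1 / t) *\<^sub>R c \<in> C" "c = A ((1 / t) *\<^sub>R c)" using C_scale t by (auto simp: A_def)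
      then show "c \<in> A ` C" by blast
    qed
  qed
  then have A: "aut A" using lin bij by (simp add: aut_def)
  have "adj (inv A) z = (1 / t) *\<^sub>R z" for z
  proof (rule B_eqI)
    fix u show "B u (adj (inv A) z) = B u ((1 / t) *\<^sub>R z)"
      using adj_works[OF aut_inv_linear[OF A], of u z] by (simp add: inv B.scaleR_left B.scaleR_right)
  qed
  then show ?thesis using star_aut[OF x A] by (simp add: A_def)
qed

text \<open>Homogeneity reduces a multiplier \<open>l\<close> to the comparison of \<open>x\<close>
  with \<open>w = (1 / l) *\<^sub>R y\<close>, and the involution turns the one-sided
  \<open>star_antitone\<close> into an equivalence.\<close>

lemma star_gauge_reversing: "gauge_reversing C star"
  unfolding gauge_reversing_iff
proof (intro conjI ballI allI impI)
  show "star \<in> C \<rightarrow> C" using star_in by blast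
  fix x y and l :: real assume x: "x \<in> C" and y: "y \<in> C" and l: "l > 0"
  define w where "w = (1 / l) *\<^sub>R y"
  have w: "w \<in> C" using C_scale[OF y] l by (simp add: w_def)
  have sw: "star w = l *\<^sub>R star y" using star_scale[OF y, of "1 / l"] l by (simp add: w_def)
  have ws: "star (l *\<^sub>R star y) = w" using star_involution[OF w] sw by simp
  have "l *\<^sub>R star y - star x \<in> K \<longleftrightarrow> x - w \<in> K"
  proof
    assume "l *\<^sub>R star y - star x \<in> K"
    then show "x - w \<in> K"
      using star_antitone[OF star_in[OF x] star_in[OF w]] by (simp add: sw ws star_involution[OF x])
  next
    assume "x - w \<in> K"
    then show "l *\<^sub>R star y - star x \<in> K" using star_antitone[OF w x] sw by simp
  qed
  also have "\<dots> \<longleftrightarrow> l *\<^sub>R x - y \<in> K"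
  proof
    assume "x - w \<in> K"
    from K_scale[OF this, of l] show "l *\<^sub>R x - y \<in> K" using l by (simp add: w_def scaleR_diff_right)
  next
    assume "l *\<^sub>R x - y \<in> K"
    from K_scale[OF this, of "1 / l"] show "x - w \<in> K" using l by (simp add: w_def scaleR_diff_right)
  qed
  finally show "l *\<^sub>R star y - star x \<in> K \<longleftrightarrow> l *\<^sub>R x - y \<in> K" .
qed

end

theorem theorem1p1:
  fixes C :: "'a::euclidean_space set"
  assumes "proper_open_convex_cone C"
  shows "(\<exists>\<phi>. gauge_reversing C \<phi>) \<longleftrightarrow> symmetric_cone C"
proof -
  interpret proper_cone C by unfold_locales (rule assms)
  show ?thesis
  proof
    assume "\<exists>\<phi>. gauge_reversing C \<phi>"
    then show "symmetric_cone C" using gauge_reversing_imp_symmetric by blast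
  next
    assume s: "symmetric_cone C"
    then obtain B where B: "is_inner_product B" "C = {y. \<forall>x \<in> closure C - {0}. B y x > 0}"
      unfolding symmetric_cone_def self_dual_cone_def by blast
    have "\<exists>A. aut A \<and> A x = y" if "x \<in> C" "y \<in> C" for x y
      using s that unfolding symmetric_cone_def homogeneous_cone_def aut_def by blast
    then interpret symmetric_cone_form C B by unfold_locales (use B in blast)+
    show "\<exists>\<phi>. gauge_reversing C \<phi>" using star_gauge_reversing by blast
  qed
qed

end
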